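(* Let $E,A\in\mathbb R^{n\times n}$, $B\in\mathbb R^{n\times m}$, $C\in\mathbb R^{m\times n}$ with $\operatorname{rank}(C)=m$ be such that the descriptor system $E\dot x=Ax+Bu$, $y=Cx$ is port-Hamiltonian, and put $r_b=\operatorname{rank}(B)$. Suppose that the system is completely observable, i.e. $\operatorname{rank}\begin{bmatrix}\alpha E-\beta A\\ C\end{bmatrix}=n$ for all $(\alpha,\beta)\in\mathbb C^2\setminus\{(0,0)\}$. Let $r$ be an integer. Then the following assertions hold. (i) There exists a matrix $K\in\mathbb R^{m\times m}$ such that $(E+BKC,A)$ is regular, $\operatorname{ind}(E+BKC,A)\le 1$, $\operatorname{rank}(E+BKC)=r$, and the closed-loop system $(E+BKC)\dot x=Ax+Bv$, $y=Cx$ is port-Hamiltonian, if and only if $$n-\operatorname{rank}\big[\mathcal T_\infty^T(E\mathcal S_\infty(C))\,A\,\mathcal S_\infty(\mathcal T_\infty^T(B)E)\big]\le r\le n,$$ and $n-r$ is even whenever $\operatorname{rank}\big[\mathcal T_\infty^T(E\mathcal S_\infty(C))\,A\,\mathcal S_\infty(\mathcal T_\infty^T(B)E)\big]>0$ is even and the matrix $$\big(\mathcal T_\infty^T(E\mathcal S_\infty(C))\,B\big)^{-1}\big[\mathcal T_\infty^T(E\mathcal S_\infty(C))\,A\,\mathcal S_\infty(\mathcal T_\infty^T(B)E)\big]\big(C\,\mathcal S_\infty(\mathcal T_\infty^T(B)E)\big)^{-1}$$ is skew-symmetric. (ii) There exist matrices $F,K\in\mathbb R^{m\times m}$ such that $(E+BKC,A+BFC)$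 is regular, $\operatorname{ind}(E+BKC,A+BFC)\le 1$, $\operatorname{rank}(E+BKC)=r$, and the closed-loop system $(E+BKC)\dot x=(A+BFC)x+Bv$, $y=Cx$ is port-Hamiltonian, if and only if $$n-r_b\le r\le n .$$
   Context: Port-Hamiltonian: a system $E\dot x=Ax+Bu$, $y=Cx$ with $E,A\in\mathbb R^{n\times n}$, $B\in\mathbb R^{n\times m}$, $C\in\mathbb R^{m\times n}$ is called port-Hamiltonian if there exist $J,R,Q\in\mathbb R^{n\times n}$ and $G,P\in\mathbb R^{n\times m}$ with $J=-J^T$ such that $$A=(J-R)Q,\quad B=G-P,\quad C=(G+P)^TQ,$$ $$Q^TE=E^TQ\ge 0,\quad Q^TRQ=Q^TR^TQ\ge 0,\quad Q^TP=0,$$ where $M\ge 0$ means that $M$ is symmetric positive semidefinite. $E$ and $Q$ may be singular. A closed-loop system is port-Hamiltonian if the same definition holds with the closed-loop coefficient matrices in place of $E,A,B,C$. Regularity and index: the pencil $(E,A)$ is regular if $\det(\alpha E-\beta A)\ne 0$ for some $(\alpha,\beta)\in\mathbb C^2$. For a regular pencil there are nonsingular $X,Y$ with $X(sE-A)Y=\operatorname{diag}(sI-\hat J,\ sN-I)$ with $N$ nilpotent; the index $\operatorname{ind}(E,A)$ is the degree of nilpotency of $N$ (the smallest $i$ with $N^i=0$; it is $0$ if the block $N$ is absent). A pencil is regular with index at most one if and only if it has exactly $\operatorname{rank}(E)$ finite eigenvalues (counted with multiplicity). Notation: $\mathcal S_\infty(M)$ denotes a full column rank (real) matrix whose columns span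 the right nullspace of $M$, and $\mathcal T_\infty(M)$ a full column rank (real) matrix whose columns span the left nullspace of $M$ (so $\mathcal T_\infty^T(M)M=0$, where $\mathcal T_\infty^T(M)=(\mathcal T_\infty(M))^T$); if the nullspace is trivial the matrix is empty. *)

theory Defs
  imports
    Complex_Main
    "Jordan_Normal_Form.DL_Rank"
    "Jordan_Normal_Form.Matrix_Kernel"
    "Jordan_Normal_Form.Gauss_Jordan_Elimination"
begin

abbreviation mrank :: "'a :: field mat \<Rightarrow> nat" where
  "mrank M \<equiv> vec_space.rank (dim_row M) M"

abbreviation cmat :: "real mat \<Rightarrow> complex mat" where
  "cmat \<equiv> map_mat complex_of_real"

(* M^T = M also forces M to be square. *)
definition psd :: "real mat \<Rightarrow> bool" where
  "psd M \<longleftrightarrow> transpose_mat M = M \<and> (\<forall>v \<in> carrier_vec (dim_row M). 0 \<le> v \<bullet> (M *\<^sub>v v))"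

definition skew_symmetric :: "real mat \<Rightarrow> bool" where
  "skew_symmetric M \<longleftrightarrow> transpose_mat M = - M"

definition port_hamiltonian ::
    "nat \<Rightarrow> nat \<Rightarrow> real mat \<Rightarrow> real mat \<Rightarrow> real mat \<Rightarrow> real mat \<Rightarrow> bool" where
  "port_hamiltonian n m E A B C \<longleftrightarrow>
     E \<in> carrier_mat n n \<and> A \<in> carrier_mat n n \<and> B \<in> carrier_mat n m \<and> C \<in> carrier_mat m n \<and>
     (\<exists>J \<in> carrier_mat n n. \<exists>R \<in> carrier_mat n n. \<exists>Q \<in> carrier_mat n n.
      \<exists>G \<in> carrier_mat n m. \<exists>P \<in> carrier_mat n m.
        skew_symmetric J \<and>
        A = (J - R) * Q \<and>
        B = G - P \<and>
        C = transpose_mat (G + P) * Q \<and>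
        transpose_mat Q * E = transpose_mat E * Q \<and>
        psd (transpose_mat Q * E) \<and>
        transpose_mat Q * R * Q = transpose_mat Q * transpose_mat R * Q \<and>
        psd (transpose_mat Q * R * Q) \<and>
        transpose_mat Q * P = 0\<^sub>m n m)"

definition regular_pencil :: "real mat \<Rightarrow> real mat \<Rightarrow> bool" where
  "regular_pencil E A \<longleftrightarrow> (\<exists>\<alpha> \<beta> :: complex. det (\<alpha> \<cdot>\<^sub>m cmat E - \<beta> \<cdot>\<^sub>m cmat A) \<noteq> 0)"

(* Intended for nilpotent N.  Since N^0 is the identity matrix, the degree is 0 exactly when
   N is the 0 x 0 matrix. *)
definition nilpotency_degree :: "'a :: semiring_1 mat \<Rightarrow> nat" where
  "nilpotency_degree N = (LEAST i. N ^\<^sub>m i = 0\<^sub>m (dim_row N) (dim_row N))"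

(* X (s E - A) Y = diag (s I - Jh, s N - I) identically in s, with N nilpotent;
   either diagonal block may be 0 x 0. *)
definition weierstrass_form ::
    "real mat \<Rightarrow> real mat \<Rightarrow> real mat \<Rightarrow> real mat \<Rightarrow> real mat \<Rightarrow> real mat \<Rightarrow> bool" where
  "weierstrass_form E A X Y Jh N \<longleftrightarrow>
     (let n = dim_row E; p = dim_row Jh; q = dim_row N in
        p + q = n \<and> E \<in> carrier_mat n n \<and> A \<in> carrier_mat n n \<and>
        X \<in> carrier_mat n n \<and> Y \<in> carrier_mat n n \<and> invertible_mat X \<and> invertible_mat Y \<and>
        Jh \<in> carrier_mat p p \<and> N \<in> carrier_mat q q \<and> (\<exists>i. N ^\<^sub>m i = 0\<^sub>m q q) \<and>
        (\<forall>s :: real. X * (s \<cdot>\<^sub>m E - A) * Y =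
           four_block_mat (s \<cdot>\<^sub>m 1\<^sub>m p - Jh) (0\<^sub>m p q) (0\<^sub>m q p) (s \<cdot>\<^sub>m N - 1\<^sub>m q)))"

(* "The index of (E, A) is nu".  The index is introduced as a relation: every regular pencil
   has a Weierstrass form, and all its Weierstrass forms share the same degree. *)
definition has_index :: "real mat \<Rightarrow> real mat \<Rightarrow> nat \<Rightarrow> bool" where
  "has_index E A \<nu> \<longleftrightarrow>
     (\<exists>X Y Jh N. weierstrass_form E A X Y Jh N \<and> \<nu> = nilpotency_degree N)"

definition completely_observable ::
    "nat \<Rightarrow> real mat \<Rightarrow> real mat \<Rightarrow> real mat \<Rightarrow> bool" where
  "completely_observable n E A C \<longleftrightarrow>
     (\<forall>\<alpha> \<beta> :: complex. (\<alpha>, \<beta>) \<noteq> (0, 0) \<longrightarrow>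
        mrank ((\<alpha> \<cdot>\<^sub>m cmat E - \<beta> \<cdot>\<^sub>m cmat A) @\<^sub>r cmat C) = n)"

(* S is an admissible choice of S_infty(M); S has no columns if the nullspace is trivial. *)
definition is_S_infty :: "real mat \<Rightarrow> real mat \<Rightarrow> bool" where
  "is_S_infty M S \<longleftrightarrow>
     dim_row S = dim_col M \<and> mrank S = dim_col S \<and>
     vec_space.col_space (dim_row S) S = mat_kernel M"

(* T is an admissible choice of T_infty(M): the left nullspace of M is the kernel of M^T. *)
definition is_T_infty :: "real mat \<Rightarrow> real mat \<Rightarrow> bool" where
  "is_T_infty M T \<longleftrightarrow> is_S_infty (transpose_mat M) T"

(* Unspecified if M is not invertible. *)
definition mat_inv :: "'a :: field mat \<Rightarrow> 'a mat" where
  "mat_inv M = the (mat_inverse M)"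

end

theory Submission
  imports Defs "Jordan_Normal_Form.Char_Poly"
begin

text \<open>
The defining data of a port-Hamiltonian system can be condensed into the matrix \<open>Q\<close>: one has
\<open>C = B\<^sup>T Q\<close>, \<open>Q\<^sup>T E\<close> is symmetric positive semidefinite, \<open>Q\<^sup>T A\<close> is dissipative (its quadratic form is
nowhere positive), and \<open>Q\<close> is a right factor of \<open>A\<close> (\<open>port_hamiltonianD\<close>, \<open>port_hamiltonianI\<close>). Complete
observability is used through two special pencils. At \<open>(\<alpha>, \<beta>) = (0, 1)\<close> it makes \<open>Q\<close> invertible, because \<open>Q\<close> is a
right factor of both \<open>A\<close> and \<open>C\<close>. At \<open>(\<alpha>, \<beta>) = (1, 0)\<close> it says that \<open>E\<close> is injective on the null space
of \<open>C\<close>.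

Let the columns of \<open>S\<close> be a basis of the null space of \<open>C\<close>, and choose \<open>Z\<close> with \<open>C Z = I\<close> and
\<open>E Z = B Y\<close>. The columns of \<open>[S, Z]\<close> and those of \<open>[E S, B]\<close> form bases, and with respect to them
\<open>E + B K C\<close> becomes \<open>diag(I, Y + K)\<close>. So the feedback \<open>K\<close> amounts to the free choice of an \<open>m \<times> m\<close> matrix
\<open>L = Y + K\<close>, the rank of the closed loop is \<open>n - m + rank L\<close>, and the index is at most one iff it is so for the
small pencil formed by \<open>L\<close> and the lower right block \<open>M\<close> of the transformed \<open>A\<close>. This block is the matrix
displayed in the first assertion, and it is dissipative. If the closed loop is port-Hamiltonian with
whatever \<open>Q\<close>, then \<open>L\<close> is positive semidefinite; conversely for semidefinite \<open>L\<close> the original \<open>Q\<close> serves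
the closed loop too. All this is in the locale \<open>feedback_coordinates\<close>, and \<open>feedback_coordinates_exist\<close>
provides such coordinates.

What remains is to find the numbers \<open>j\<close> such that some semidefinite \<open>L\<close> of rank \<open>m - j\<close> forms with \<open>M\<close> a
regular pencil of index at most one. For symmetric \<open>L\<close> with null-space basis \<open>V\<close> this condition makes the
\<open>j \<times> j\<close> compression \<open>V\<^sup>T M V\<close> invertible. Hence \<open>j \<le> rank M\<close>, and \<open>j\<close> is even if \<open>M\<close> is
skew-symmetric, since skew-symmetric matrices of odd size are singular (\<open>impulse_free_kernel_dim\<close>).
All other \<open>j\<close> occur (\<open>psd_impulse_free_exists\<close>): a congruence splits off from \<open>M\<close> a \<open>1 \<times> 1\<close> pivot as long as its
quadratic form does not vanish, and a \<open>2 \<times> 2\<close> pivot once it is skew-symmetric, and for each pivot one may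
choose whether it belongs to the null space of \<open>L\<close>.

In the second assertion the choice \<open>F = - I\<close> turns \<open>M\<close> into \<open>M - I\<close>, whose quadratic form is negative definite.
Then every semidefinite \<open>L\<close> is admissible, so that only \<open>n - m \<le> r \<le> n\<close> remains, with \<open>m = rank B\<close>.
\<close>

section \<open>Matrix algebra with conditions on dimensions\<close>

text \<open>
Premises that equate dimensions can be discharged by simplification alone, whereas \<open>carrier_mat\<close> premises leave
the inner dimensions to be guessed. In this form the laws are conditional rewrite rules for long products.
\<close>

lemma mat_assoc:
  fixes A :: "'a :: semiring_0 mat"
  assumes "dim_col A = dim_row B" and "dim_col B = dim_row D"
  shows "A * B * D = A * (B * D)"
  using assms by (intro assoc_mult_mat[of _ "dim_row A" "dim_row B" _ "dim_row D" _ "dim_col D"]) auto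

lemma mat_vec_assoc:
  fixes A :: "'a :: semiring_0 mat"
  assumes "dim_col A = dim_row B" and "dim_col B = dim_vec v"
  shows "A * B *\<^sub>v v = A *\<^sub>v (B *\<^sub>v v)"
  using assms by (intro assoc_mult_mat_vec[of _ "dim_row A" "dim_row B" _ "dim_vec v"]) auto

lemma mat_transpose_mult:
  fixes A :: "'a :: comm_semiring_0 mat"
  assumes "dim_col A = dim_row B"
  shows "(A * B)\<^sup>T = B\<^sup>T * A\<^sup>T"
  using assms by (intro transpose_mult[of _ "dim_row A" "dim_row B" _ "dim_col B"]) auto

lemma mat_mult_add:
  fixes A :: "'a :: semiring_0 mat"
  assumes "dim_col A = dim_row B" "dim_row B = dim_row D" "dim_col B = dim_col D"
  shows "A * (B + D) = A * B + A * D"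
  using assms by (intro mult_add_distrib_mat[of _ "dim_row A" "dim_row B" _ "dim_col B"]) auto

lemma mat_add_mult:
  fixes A :: "'a :: semiring_0 mat"
  assumes "dim_col A = dim_row D" "dim_row A = dim_row B" "dim_col A = dim_col B"
  shows "(A + B) * D = A * D + B * D"
  using assms by (intro add_mult_distrib_mat[of _ "dim_row A" "dim_col A" _ _ "dim_col D"]) auto

lemma mat_add_vec:
  fixes A :: "'a :: semiring_0 mat"
  assumes "dim_col A = dim_vec v" "dim_row A = dim_row B" "dim_col A = dim_col B"
  shows "(A + B) *\<^sub>v v = A *\<^sub>v v + B *\<^sub>v v"
  using assms by (intro add_mult_distrib_mat_vec[of _ "dim_row A" "dim_col A"]) (auto intro: carrier_vecI)

lemma mat_vec_add:
  fixes A :: "'a :: semiring_0 mat"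
  assumes "dim_col A = dim_vec v" "dim_vec v = dim_vec w"
  shows "A *\<^sub>v (v + w) = A *\<^sub>v v + A *\<^sub>v w"
  using assms by (intro mult_add_distrib_mat_vec[of _ "dim_row A" "dim_vec v"]) (auto intro: carrier_vecI)

lemma transpose_scalar_prod:
  fixes A :: "'a :: comm_semiring_0 mat"
  assumes "dim_col A = dim_vec x" "dim_row A = dim_vec y"
  shows "(A\<^sup>T *\<^sub>v y) \<bullet> x = y \<bullet> (A *\<^sub>v x)"
  using assms by (intro transpose_vec_mult_scalar[of _ "dim_row A" "dim_col A"]) (auto intro: carrier_vecI)

lemma one_mult_vec: "dim_vec (v :: 'a :: semiring_1 vec) = n \<Longrightarrow> 1\<^sub>m n *\<^sub>v v = v"
  by (rule one_mult_mat_vec) (auto intro: carrier_vecI)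

lemma zero_mult_vec: "dim_vec (v :: 'a :: semiring_1 vec) = k \<Longrightarrow> 0\<^sub>m n k *\<^sub>v v = 0\<^sub>v n"
  by (intro eq_vecI) (auto simp: scalar_prod_def)

lemma mult_zero_vec: "dim_col (A :: 'a :: semiring_1 mat) = k \<Longrightarrow> A *\<^sub>v 0\<^sub>v k = 0\<^sub>v (dim_row A)"
  by (intro eq_vecI) (auto simp: scalar_prod_def)

lemma mat_mult_one:
  fixes A :: "'a :: semiring_1 mat"
  shows "dim_col A = n \<Longrightarrow> A * 1\<^sub>m n = A" "dim_row A = n \<Longrightarrow> 1\<^sub>m n * A = A"
  by (auto intro: right_mult_one_mat left_mult_one_mat)

lemma mat_mult_zero:
  fixes A :: "'a :: semiring_1 mat"
  shows "dim_col A = n \<Longrightarrow> A * 0\<^sub>m n k = 0\<^sub>m (dim_row A) k"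
    "dim_row A = n \<Longrightarrow> 0\<^sub>m k n * A = 0\<^sub>m k (dim_col A)"
  by (auto intro: right_mult_zero_mat left_mult_zero_mat)

lemma mat_add_zero:
  fixes A :: "'a :: monoid_add mat"
  shows "dim_row A = n \<Longrightarrow> dim_col A = k \<Longrightarrow> A + 0\<^sub>m n k = A"
    "dim_row A = n \<Longrightarrow> dim_col A = k \<Longrightarrow> 0\<^sub>m n k + A = A"
  by (auto intro!: eq_matI)

lemma vec_add_zero:
  fixes v :: "'a :: monoid_add vec"
  shows "dim_vec v = n \<Longrightarrow> v + 0\<^sub>v n = v" "dim_vec v = n \<Longrightarrow> 0\<^sub>v n + v = v"
  by (auto intro!: eq_vecI)

lemma mat_uminus_mult:
  fixes A :: "'a :: ring mat"
  assumes "dim_col A = dim_row B"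
  shows "- A * B = - (A * B)" "A * (- B) = - (A * B)"
  using assms by (auto intro!: eq_matI simp: scalar_prod_def sum_negf)

lemma uminus_zero_mat: "- 0\<^sub>m n k = (0\<^sub>m n k :: 'a :: ring mat)"
  by (intro eq_matI) auto

lemma mat_minus_add_cancel:
  fixes A :: "'a :: ring mat"
  assumes "dim_row A = n" "dim_col A = k"
  shows "- A + A = 0\<^sub>m n k" "A + - A = 0\<^sub>m n k"
  using assms by (auto intro!: eq_matI)

lemma four_block_mult:
  fixes A1 :: "'a :: semiring_0 mat"
  assumes "dim_row B1 = dim_row A1" "dim_col C1 = dim_col A1" "dim_row D1 = dim_row C1"
    "dim_col D1 = dim_col B1" "dim_row A2 = dim_col A1" "dim_row B2 = dim_col A1"
    "dim_row C2 = dim_col B1" "dim_col C2 = dim_col A2" "dim_row D2 = dim_col B1"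
    "dim_col D2 = dim_col B2"
  shows "four_block_mat A1 B1 C1 D1 * four_block_mat A2 B2 C2 D2
    = four_block_mat (A1 * A2 + B1 * C2) (A1 * B2 + B1 * D2) (C1 * A2 + D1 * C2) (C1 * B2 + D1 * D2)"
  by (rule mult_four_block_mat[of _ "dim_row A1" "dim_col A1" _ "dim_col B1" _ "dim_row C1" _ _ "dim_col A2" _ "dim_col B2"])
    (use assms in \<open>auto intro!: carrier_matI\<close>)

lemma four_block_mult_append:
  fixes A :: "'a :: semiring_0 mat"
  assumes "dim_row B = dim_row A" "dim_col C = dim_col A" "dim_row D = dim_row C"
    "dim_col D = dim_col B" "dim_vec x = dim_col A" "dim_vec y = dim_col B"
  shows "four_block_mat A B C D *\<^sub>v (x @\<^sub>v y) = (A *\<^sub>v x + B *\<^sub>v y) @\<^sub>v (C *\<^sub>v x + D *\<^sub>v y)"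
  by (rule four_block_mat_mult_vec[of _ "dim_row A" "dim_col A" _ "dim_col B" _ "dim_row C"])
    (use assms in \<open>auto intro!: carrier_matI carrier_vecI\<close>)

lemma four_block_transpose:
  assumes "dim_row B = dim_row A" "dim_col C = dim_col A" "dim_row D = dim_row C" "dim_col D = dim_col B"
  shows "(four_block_mat A B C D)\<^sup>T =
    four_block_mat (A\<^sup>T) (C\<^sup>T) (B\<^sup>T) (D\<^sup>T)"
  using assms by (intro transpose_four_block_mat) (auto intro!: carrier_matI)

lemmas mat_dim_simps = mat_assoc mat_vec_assoc mat_transpose_mult mat_mult_one mat_mult_zero
  mat_add_zero vec_add_zero one_mult_vec zero_mult_vec mult_zero_vec

lemma split_vec:
  assumes "dim_vec v = k + l"
  obtains x y where "v = x @\<^sub>v y" "dim_vec x = k" "dim_vec y = l"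
proof (rule that[of "vec_first v k" "vec_last v l"])
  show "v = vec_first v k @\<^sub>v vec_last v l"
    using vec_first_last_append[of v k l] carrier_vecI[OF assms] by simp
qed auto

lemma append_vec_zero: "0\<^sub>v (k + l) = 0\<^sub>v k @\<^sub>v 0\<^sub>v l"
  by (intro eq_vecI) auto

lemma append_vec_eq_iff:
  assumes "dim_vec x = dim_vec x'"
  shows "x @\<^sub>v y = x' @\<^sub>v y' \<longleftrightarrow> x = x' \<and> y = y'"
  using assms by (intro append_vec_eq[of _ "dim_vec x"]) (auto intro: carrier_vecI)

lemma append_scalar_prod:
  assumes "dim_vec x = dim_vec x'" "dim_vec y = dim_vec y'"
  shows "(x @\<^sub>v y) \<bullet> (x' @\<^sub>v y') = x \<bullet> x' + y \<bullet> y'"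
  using assms by (intro scalar_prod_append) (auto intro: carrier_vecI)

lemma split_four_block:
  assumes "dim_row M = a + b" "dim_col M = c + d"
  obtains M1 M2 M3 M4 where "M = four_block_mat M1 M2 M3 M4"
    "dim_row M1 = a" "dim_col M1 = c" "dim_row M2 = a" "dim_col M2 = d"
    "dim_row M3 = b" "dim_col M3 = c" "dim_row M4 = b" "dim_col M4 = d"
proof -
  obtain M1 M2 M3 M4 where s: "split_block M a c = (M1, M2, M3, M4)"
    using prod_cases4 by blast
  from split_block[OF s assms] show thesis using that by auto
qed

section \<open>Trivial kernels and inverses\<close>

definition trivial_kernel :: "'a :: semiring_0 mat \<Rightarrow> bool" where
  "trivial_kernel M \<longleftrightarrow>
     (\<forall>v. dim_vec v = dim_col M \<longrightarrow> M *\<^sub>v v = 0\<^sub>v (dim_row M) \<longrightarrow> v = 0\<^sub>v (dim_col M))"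

lemma trivial_kernelD:
  assumes "trivial_kernel M" "dim_vec v = dim_col M" "M *\<^sub>v v = 0\<^sub>v (dim_row M)"
  shows "v = 0\<^sub>v (dim_col M)"
  using assms unfolding trivial_kernel_def by blast

definition inverses :: "nat \<Rightarrow> 'a :: semiring_1 mat \<Rightarrow> 'a mat \<Rightarrow> bool" where
  "inverses n X Y \<longleftrightarrow> X \<in> carrier_mat n n \<and> Y \<in> carrier_mat n n \<and> X * Y = 1\<^sub>m n \<and> Y * X = 1\<^sub>m n"

lemma inverses_dim:
  assumes "inverses n X Y"
  shows "dim_row X = n" "dim_col X = n" "dim_row Y = n" "dim_col Y = n"
  using assms by (auto simp: inverses_def)

lemma inverses_sym: "inverses n X Y \<Longrightarrow> inverses n Y X"
  by (auto simp: inverses_def)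

lemma inverses_one: "inverses n (1\<^sub>m n) (1\<^sub>m n)"
  by (auto simp: inverses_def)

lemma inverses_cancel:
  assumes "inverses n X Y"
  shows "dim_row A = n \<Longrightarrow> X * (Y * A) = A" "dim_row A = n \<Longrightarrow> Y * (X * A) = A"
    "dim_vec v = n \<Longrightarrow> X *\<^sub>v (Y *\<^sub>v v) = v" "dim_vec v = n \<Longrightarrow> Y *\<^sub>v (X *\<^sub>v v) = v"
    "X * Y = 1\<^sub>m n" "Y * X = 1\<^sub>m n"
proof -
  have d: "dim_row X = n" "dim_col X = n" "dim_row Y = n" "dim_col Y = n"
    and e: "X * Y = 1\<^sub>m n" "Y * X = 1\<^sub>m n"
    using assms by (auto simp: inverses_def)
  show "X * (Y * A) = A" "Y * (X * A) = A" if "dim_row A = n"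
    using that d e mat_mult_one(2)[OF that] by (metis mat_assoc)+
  show "X *\<^sub>v (Y *\<^sub>v v) = v" "Y *\<^sub>v (X *\<^sub>v v) = v" if "dim_vec v = n"
    using that d e one_mult_vec[OF that] by (metis mat_vec_assoc)+
  show "X * Y = 1\<^sub>m n" "Y * X = 1\<^sub>m n" by (fact e)+
qed

lemma inverses_transpose:
  fixes X :: "'a :: comm_semiring_1 mat"
  assumes "inverses n X Y"
  shows "inverses n (X\<^sup>T) (Y\<^sup>T)"
proof -
  note d = inverses_dim[OF assms]
  have "X\<^sup>T * Y\<^sup>T = (Y * X)\<^sup>T"
    "Y\<^sup>T * X\<^sup>T = (X * Y)\<^sup>T"
    using mat_transpose_mult[of X Y] mat_transpose_mult[of Y X] d by simp_all
  thus ?thesis using inverses_cancel(5,6)[OF assms] assms by (simp add: inverses_def)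
qed

lemma inverses_mult:
  assumes "inverses n X Xi" "inverses n Y Yi"
  shows "inverses n (X * Y) (Yi * Xi)"
  unfolding inverses_def
  by (intro conjI carrier_matI)
    (simp_all add: inverses_dim[OF assms(1)] inverses_dim[OF assms(2)] mat_assoc
      inverses_cancel[OF assms(1)] inverses_cancel[OF assms(2)])

lemma inverses_diag:
  assumes "inverses k X Xi" "inverses l Y Yi"
  shows "inverses (k + l) (four_block_mat X (0\<^sub>m k l) (0\<^sub>m l k) Y) (four_block_mat Xi (0\<^sub>m k l) (0\<^sub>m l k) Yi)"
  unfolding inverses_def
  by (intro conjI carrier_matI)
    (simp_all add: inverses_dim[OF assms(1)] inverses_dim[OF assms(2)] mat_dim_simps four_block_mult
      inverses_cancel[OF assms(1)] inverses_cancel[OF assms(2)])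

lemma inverses_trivial_kernel:
  assumes "inverses n X Y"
  shows "trivial_kernel X"
  unfolding trivial_kernel_def using inverses_cancel(4)[OF assms] inverses_dim[OF assms]
  by (metis mult_zero_vec)

lemma trivial_kernel_imp_inverses:
  fixes M :: "'a :: field mat"
  assumes "dim_row M = n" "dim_col M = n" "trivial_kernel M"
  obtains N where "inverses n M N"
proof -
  have M: "M \<in> carrier_mat n n" using assms by auto
  have "det M \<noteq> 0"
    using assms det_0_iff_vec_prod_zero_field[OF M] unfolding trivial_kernel_def by (auto dest: carrier_vecD)
  from det_non_zero_imp_unit[OF M this, of "()"] obtain N where
    "N \<in> carrier_mat n n" "N * M = 1\<^sub>m n" "M * N = 1\<^sub>m n"
    unfolding Units_def ring_mat_def by auto
  thus thesis using that M unfolding inverses_def by blast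
qed

lemma inverses_invertible_mat: "inverses n X Y \<Longrightarrow> invertible_mat X"
  by (auto simp: inverses_def invertible_mat_def inverts_mat_def intro!: exI[of _ Y])

lemma invertible_mat_inverses:
  assumes "invertible_mat X" "dim_row X = n"
  obtains Y where "inverses n X Y"
proof -
  from assms obtain Y where Y: "X * Y = 1\<^sub>m n" "Y * X = 1\<^sub>m (dim_row Y)" and sq: "dim_col X = n"
    by (auto simp: invertible_mat_def inverts_mat_def)
  have "dim_col Y = n" using arg_cong[OF Y(1), of dim_col] by simp
  moreover have "dim_row Y = n" using arg_cong[OF Y(2), of dim_col] sq by simp
  ultimately have "inverses n X Y" using Y sq assms(2) by (auto simp: inverses_def intro!: carrier_matI)
  thus thesis by (rule that)
qed

lemma inverses_unique:
  assumes "inverses n X Y" "inverses n X Y'"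
  shows "Y = Y'"
proof -
  have "Y = Y * (X * Y')" using assms inverses_cancel(2)[OF assms(1)] by (auto simp: inverses_def)
  thus ?thesis using inverses_cancel(2)[OF assms(1)] inverses_dim[OF assms(2)] by simp
qed

lemma mat_inv_eq:
  fixes X :: "'a :: field mat"
  assumes "inverses n X Y"
  shows "mat_inv X = Y"
proof -
  have c: "X \<in> carrier_mat n n" using assms by (simp add: inverses_def)
  have "X \<in> Units (ring_mat TYPE('a) n ())"
    using assms unfolding Units_def ring_mat_def inverses_def by auto
  hence "mat_inverse X \<noteq> None" using mat_inverse(1)[OF c, where b = "()"] by blast
  then obtain N where N: "mat_inverse X = Some N" by blast
  from mat_inverse(2)[OF c N] have "inverses n X N" using c by (simp add: inverses_def)
  from inverses_unique[OF this assms] show ?thesis unfolding mat_inv_def N by simp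
qed

lemma trivial_kernel_mult:
  fixes A :: "'a :: semiring_1 mat"
  assumes "dim_col A = dim_row B" "trivial_kernel (A * B)"
  shows "trivial_kernel B"
  unfolding trivial_kernel_def
proof (intro allI impI)
  fix v assume v: "dim_vec v = dim_col B" "B *\<^sub>v v = 0\<^sub>v (dim_row B)"
  have "A * B *\<^sub>v v = 0\<^sub>v (dim_row (A * B))"
    using v assms(1) by (simp add: mat_vec_assoc mult_zero_vec)
  thus "v = 0\<^sub>v (dim_col B)" using assms(2) v(1) unfolding trivial_kernel_def by simp
qed

lemma trivial_kernel_comp:
  fixes A :: "'a :: semiring_1 mat"
  assumes "dim_col A = dim_row B" "trivial_kernel A" "trivial_kernel B"
  shows "trivial_kernel (A * B)"
  unfolding trivial_kernel_def
proof (intro allI impI)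
  fix v assume v: "dim_vec v = dim_col (A * B)" "A * B *\<^sub>v v = 0\<^sub>v (dim_row (A * B))"
  hence "A *\<^sub>v (B *\<^sub>v v) = 0\<^sub>v (dim_row A)"
    using assms(1) by (simp add: mat_vec_assoc)
  hence "B *\<^sub>v v = 0\<^sub>v (dim_row B)"
    using assms(1,2) unfolding trivial_kernel_def by simp
  thus "v = 0\<^sub>v (dim_col (A * B))" using assms(3) v(1) unfolding trivial_kernel_def by simp
qed

section \<open>Rank and the rank normal form\<close>

text \<open>
The rank is the dimension of the span of the \<^emph>\<open>set\<close> of columns, so a repeated column already lowers it
below the number of columns; this is why distinctness is settled before linear independence.
\<close>

lemma full_rank_iff_trivial_kernel:
  fixes M :: "'a :: field mat"
  shows "mrank M = dim_col M \<longleftrightarrow> trivial_kernel M"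
proof -
  define n where "n = dim_row M"
  define k where "k = dim_col M"
  interpret vec_space "TYPE('a)" n .
  have M: "M \<in> carrier_mat n k" by (auto simp: n_def k_def)
  have "distinct (cols M) \<and> lin_indpt (set (cols M))" if r: "rank M = k"
  proof -
    have "distinct (cols M)"
    proof (rule ccontr)
      assume nd: "\<not> distinct (cols M)"
      obtain S where S: "maximal S (\<lambda>T. T \<subseteq> set (cols M) \<and> lin_indpt T)"
        using maximal_exists[of "(\<lambda>T. T \<subseteq> set (cols M) \<and> lin_indpt T)" "card (set (cols M))" "{}"]
        by (meson List.finite_set card_mono empty_iff empty_subsetI finite_lin_indpt2 rev_finite_subset)
      then have "card S \<le> card (set (cols M))" by (simp add: card_mono maximal_def)
      also have "\<dots> < k" using nd card_distinct[of "cols M"] card_length[of "cols M"] M by fastforce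
      finally show False using rank_card_indpt[OF M S] r by simp
    qed
    with full_rank_lin_indpt[OF M r this] show ?thesis by simp
  qed
  moreover have "trivial_kernel M" if "distinct (cols M)" "lin_indpt (set (cols M))"
    unfolding trivial_kernel_def
  proof (intro allI impI)
    fix v assume v: "dim_vec v = dim_col M" "M *\<^sub>v v = 0\<^sub>v (dim_row M)"
    show "v = 0\<^sub>v (dim_col M)"
    proof (rule ccontr)
      assume "v \<noteq> 0\<^sub>v (dim_col M)"
      hence "lin_dep (set (cols M))"
        using lin_depI[OF M _ _ _ that(1), of v] v M by (auto intro: carrier_vecI)
      thus False using that(2) by simp
    qed
  qed
  moreover have "rank M = k" if tk: "trivial_kernel M"
  proof -
    have "distinct (cols M)"
    proof (rule ccontr)
      assume "\<not> distinct (cols M)"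
      then obtain i j where ij: "i < k" "j < k" "i \<noteq> j" "col M i = col M j"
        using M by (auto simp: distinct_conv_nth)
      define u where "u = unit_vec k i - (unit_vec k j :: 'a vec)"
      have "M *\<^sub>v u = M *\<^sub>v unit_vec k i - M *\<^sub>v unit_vec k j"
        unfolding u_def by (rule mult_minus_distrib_mat_vec[OF M]) auto
      also have "\<dots> = col M i - col M j"
        using M ij(1,2) by (intro eq_vecI) simp_all
      also have "\<dots> = 0\<^sub>v n" unfolding ij(4) using M by (intro eq_vecI) simp_all
      finally have "u = 0\<^sub>v k" using tk M unfolding trivial_kernel_def u_def by auto
      hence "u $ i = 0" using ij by simp
      thus False using ij by (simp add: u_def)
    qed
    moreover have "lin_indpt (set (cols M))"
    proof
      assume "lin_dep (set (cols M))"
      from lin_depE[OF M this \<open>distinct (cols M)\<close>] obtain v where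
        "v \<in> carrier_vec k" "v \<noteq> 0\<^sub>v k" "M *\<^sub>v v = 0\<^sub>v n" by blast
      thus False using tk M unfolding trivial_kernel_def by auto
    qed
    ultimately show ?thesis by (rule lin_indpt_full_rank[OF M])
  qed
  ultimately show ?thesis unfolding n_def k_def by blast
qed

lemma mem_col_space_iff:
  fixes A :: "'a :: field mat"
  shows "w \<in> vec_space.col_space (dim_row A) A \<longleftrightarrow> (\<exists>x. dim_vec x = dim_col A \<and> A *\<^sub>v x = w)"
proof -
  have "vec_space.col_space (dim_row A) A =
      {y \<in> carrier_vec (dim_row A). \<exists>x \<in> carrier_vec (dim_col A). A *\<^sub>v x = y}"
    by (rule vec_space.col_space_eq[of _ _ "dim_col A"]) simp
  thus ?thesis by (fastforce intro: carrier_vecI dest: carrier_vecD)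
qed

lemma rank_eq_if_col_space_eq:
  assumes "vec_space.col_space n A = vec_space.col_space n B"
  shows "vec_space.rank n A = vec_space.rank n B"
  using assms by (simp add: vec_space.rank_def vec_space.col_space_def)

lemma rank_mono_col_space:
  fixes A :: "'a :: field mat"
  assumes A: "A \<in> carrier_mat n a" and B: "B \<in> carrier_mat n b"
    and sub: "vec_space.col_space n A \<subseteq> vec_space.col_space n B"
  shows "vec_space.rank n A \<le> vec_space.rank n B"
proof -
  interpret vec_space "TYPE('a)" n .
  have cA: "set (cols A) \<subseteq> carrier_vec n" and cB: "set (cols B) \<subseteq> carrier_vec n"
    using cols_dim A B by blast+
  let ?W = "span (set (cols B))"
  have sB: "VectorSpace.subspace class_ring ?W V" and sA: "VectorSpace.subspace class_ring (span (set (cols A))) V"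
    using span_is_subspace cA cB by auto
  interpret W: vectorspace class_ring "vs ?W" by (rule subspace_is_vs[OF sB])
  have fin: "vectorspace.fin_dim class_ring (vs ?W)" "vectorspace.fin_dim class_ring (vs (span (set (cols A))))"
    using cA cB fin_dim_span by auto
  have "VectorSpace.subspace class_ring (span (set (cols A))) (vs ?W)"
    using nested_subspaces[OF sB sA] sub by (simp add: col_space_def)
  from W.subspace_dim[OF this fin(1)] fin(2) show ?thesis
    by (simp add: rank_def)
qed

lemma rank_mult_le:
  fixes A :: "'a :: field mat"
  assumes d: "dim_col A = dim_row B"
  shows "mrank (A * B) \<le> mrank A"
proof -
  have "vec_space.col_space (dim_row A) (A * B) \<subseteq> vec_space.col_space (dim_row A) A"
  proof
    fix w assume "w \<in> vec_space.col_space (dim_row A) (A * B)"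
    hence "w \<in> vec_space.col_space (dim_row (A * B)) (A * B)" by simp
    from iffD1[OF mem_col_space_iff this] obtain x where "dim_vec x = dim_col (A * B)" "A * B *\<^sub>v x = w"
      by blast
    hence "dim_vec (B *\<^sub>v x) = dim_col A \<and> A *\<^sub>v (B *\<^sub>v x) = w"
      by (simp add: mat_vec_assoc d)
    hence "\<exists>y. dim_vec y = dim_col A \<and> A *\<^sub>v y = w" by (rule exI)
    thus "w \<in> vec_space.col_space (dim_row A) A" by (rule iffD2[OF mem_col_space_iff])
  qed
  moreover have "A * B \<in> carrier_mat (dim_row A) (dim_col B)" "A \<in> carrier_mat (dim_row A) (dim_col A)"
    by auto
  ultimately have "vec_space.rank (dim_row A) (A * B) \<le> vec_space.rank (dim_row A) A"
    using rank_mono_col_space by blast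
  thus ?thesis unfolding index_mult_mat(2) .
qed

lemma rank_factorization_le:
  fixes U :: "'a :: field mat"
  assumes "dim_col U = dim_row V"
  shows "mrank (U * V) \<le> dim_col U"
proof -
  have "vec_space.rank (dim_row U) U \<le> dim_col U" by (rule vec_space.rank_le_nc) auto
  with rank_mult_le[OF assms] show ?thesis by linarith
qed

definition partial_identity :: "nat \<Rightarrow> nat \<Rightarrow> nat \<Rightarrow> 'a :: semiring_1 mat" where
  "partial_identity a b q = mat a b (\<lambda>(i, j). if i = j \<and> i < q then 1 else 0)"

lemma partial_identity_dim [simp]:
  "dim_row (partial_identity a b q) = a" "dim_col (partial_identity a b q) = b"
  by (auto simp: partial_identity_def)

lemma partial_identity_mult:
  assumes "q \<le> b"
  shows "partial_identity a b q * partial_identity b c q = (partial_identity a c q :: 'a :: semiring_1 mat)"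
proof (rule eq_matI)
  fix i j assume "i < dim_row (partial_identity a c q :: 'a mat)" "j < dim_col (partial_identity a c q :: 'a mat)"
  hence ij: "i < a" "j < c" by auto
  have "(partial_identity a b q * partial_identity b c q :: 'a mat) $$ (i, j)
      = (\<Sum>t = 0..<b. (if i = t \<and> i < q then 1 else 0) * (if t = j \<and> t < q then 1 else 0))"
    using ij by (simp add: partial_identity_def scalar_prod_def)
  also have "\<dots> = (\<Sum>t = 0..<b. if t = i then (if i = j \<and> i < q then 1 else 0) else 0)"
    by (rule sum.cong) auto
  also have "\<dots> = partial_identity a c q $$ (i, j)"
    using ij assms by (auto simp: partial_identity_def)
  finally show "(partial_identity a b q * partial_identity b c q :: 'a mat) $$ (i, j)
      = partial_identity a c q $$ (i, j)" .
qed auto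

lemma partial_identity_mult_vec:
  assumes "dim_vec v = b" "i < a" "q \<le> b"
  shows "(partial_identity a b q *\<^sub>v v) $ i = (if i < q then v $ i else (0 :: 'a :: semiring_1))"
proof -
  have "(partial_identity a b q *\<^sub>v v) $ i = (\<Sum>t = 0..<b. (if i = t \<and> i < q then 1 else 0) * v $ t)"
    using assms by (simp add: partial_identity_def scalar_prod_def)
  also have "\<dots> = (\<Sum>t = 0..<b. if t = i then (if i < q then v $ i else 0) else 0)"
    by (rule sum.cong) auto
  also have "\<dots> = (if i < q then v $ i else 0)" using assms by auto
  finally show ?thesis .
qed

lemma trivial_kernel_partial_identity:
  assumes "q \<le> a"
  shows "trivial_kernel (partial_identity a q q :: 'a :: semiring_1 mat)"
  unfolding trivial_kernel_def
proof (intro allI impI)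
  fix v :: "'a vec"
  assume "dim_vec v = dim_col (partial_identity a q q :: 'a mat)"
    "partial_identity a q q *\<^sub>v v = 0\<^sub>v (dim_row (partial_identity a q q :: 'a mat))"
  hence v: "dim_vec v = q" "partial_identity a q q *\<^sub>v v = 0\<^sub>v a" by simp_all
  have "v $ i = 0" if "i < q" for i
    using partial_identity_mult_vec[OF v(1), of i a q] that assms by (simp add: v(2))
  thus "v = 0\<^sub>v (dim_col (partial_identity a q q :: 'a mat))" using v(1) by auto
qed

definition equivalent_mats :: "'a :: semiring_1 mat \<Rightarrow> 'a mat \<Rightarrow> bool" where
  "equivalent_mats M N \<longleftrightarrow>
     (\<exists>X X' Y Y'. inverses (dim_row M) X X' \<and> inverses (dim_col M) Y Y' \<and> N = X * M * Y)"

lemma equivalent_mats_refl: "equivalent_mats M M"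
  unfolding equivalent_mats_def
  using inverses_one[of "dim_row M"] inverses_one[of "dim_col M"]
  by (intro exI[of _ "1\<^sub>m (dim_row M)"] exI[of _ "1\<^sub>m (dim_col M)"]) (simp add: mat_mult_one)

lemma equivalent_mats_dim:
  assumes "equivalent_mats M N"
  shows "dim_row N = dim_row M" "dim_col N = dim_col M"
  using assms by (auto simp: equivalent_mats_def inverses_def)

lemma equivalent_mats_trans:
  assumes "equivalent_mats M N" "equivalent_mats N P"
  shows "equivalent_mats M P"
proof -
  obtain X X' Y Y' where 1: "inverses (dim_row M) X X'" "inverses (dim_col M) Y Y'" "N = X * M * Y"
    using assms(1) unfolding equivalent_mats_def by blast
  obtain U U' V V' where 2: "inverses (dim_row M) U U'" "inverses (dim_col M) V V'" "P = U * N * V"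
    using assms(2) equivalent_mats_dim[OF assms(1)] unfolding equivalent_mats_def by auto
  have "P = (U * X) * M * (Y * V)"
    using inverses_dim[OF 1(1)] inverses_dim[OF 1(2)] inverses_dim[OF 2(1)] inverses_dim[OF 2(2)]
    unfolding 2(3) 1(3) by (simp add: mat_assoc)
  thus ?thesis
    using inverses_mult[OF 2(1) 1(1)] inverses_mult[OF 1(2) 2(2)] unfolding equivalent_mats_def by blast
qed

lemma equivalent_mats_swap:
  fixes M :: "'a :: comm_ring_1 mat"
  assumes "i < dim_row M" "j < dim_col M"
  obtains N where "equivalent_mats M N" "N $$ (0, 0) = M $$ (i, j)"
proof -
  define S where "S = swaprows_mat (dim_row M) 0 i * M * swaprows_mat (dim_col M) 0 j"
  have pos: "0 < dim_row M" "0 < dim_col M" using assms by auto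
  have "inverses n (swaprows_mat n 0 k) (swaprows_mat n 0 k :: 'a mat)" if "k < n" for n k
    using that swaprows_mat_inv[of 0 n k] by (auto simp: inverses_def)
  hence "equivalent_mats M S" unfolding equivalent_mats_def S_def using assms by blast
  moreover have "S $$ (0, 0) = M $$ (i, j)"
  proof -
    have M: "M \<in> carrier_mat (dim_row M) (dim_col M)" by auto
    have c: "col (swaprows_mat (dim_col M) 0 j) 0 = (unit_vec (dim_col M) j :: 'a vec)"
      using assms pos by (intro eq_vecI) auto
    have "S = swaprows 0 i M * swaprows_mat (dim_col M) 0 j"
      unfolding S_def swaprows_mat[OF M pos(1) assms(1)] ..
    hence "S $$ (0, 0) = row (swaprows 0 i M) 0 \<bullet> unit_vec (dim_col M) j"
      using pos c by simp
    also have "\<dots> = row (swaprows 0 i M) 0 $ j"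
      using assms by (intro scalar_prod_right_unit) auto
    also have "\<dots> = M $$ (i, j)" using assms pos by auto
    finally show ?thesis .
  qed
  ultimately show thesis by (rule that)
qed

text \<open>
Block elimination: an invertible pivot block is split off, and its Schur complement remains.
\<close>

lemma equivalent_mats_schur:
  fixes P :: "'a :: field mat"
  assumes P: "inverses s P P'"
    and d: "dim_row c = s" "dim_col b = s" "dim_row D = dim_row b" "dim_col D = dim_col c"
  shows "equivalent_mats (four_block_mat P c b D)
    (four_block_mat (1\<^sub>m s) (0\<^sub>m s (dim_col c)) (0\<^sub>m (dim_row b) s) (D + - (b * P' * c)))"
proof -
  let ?k = "dim_row b" and ?l = "dim_col c"
  note Pd = inverses_dim[OF P]
  define X where "X = four_block_mat P' (0\<^sub>m s ?k) (- (b * P')) (1\<^sub>m ?k)"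
  define X' where "X' = four_block_mat P (0\<^sub>m s ?k) b (1\<^sub>m ?k)"
  define Y where "Y = four_block_mat (1\<^sub>m s) (- (P' * c)) (0\<^sub>m ?l s) (1\<^sub>m ?l)"
  define Y' where "Y' = four_block_mat (1\<^sub>m s) (P' * c) (0\<^sub>m ?l s) (1\<^sub>m ?l)"
  note simps = four_block_mult mat_dim_simps mat_uminus_mult mat_minus_add_cancel uminus_zero_mat inverses_cancel[OF P] Pd d
  have "inverses (s + ?k) X X'"
    unfolding inverses_def X_def X'_def
    by (intro conjI carrier_matI) (simp_all add: simps)
  moreover have "inverses (s + ?l) Y Y'"
    unfolding inverses_def Y_def Y'_def
    by (intro conjI carrier_matI) (simp_all add: simps)
  moreover have "X * four_block_mat P c b D * Y =
      four_block_mat (1\<^sub>m s) (0\<^sub>m s ?l) (0\<^sub>m ?k s) (D + - (b * P' * c))"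
  proof -
    have "X * four_block_mat P c b D = four_block_mat (1\<^sub>m s) (P' * c) (0\<^sub>m ?k s) (- (b * P' * c) + D)"
      unfolding X_def by (simp add: simps)
    moreover have "- (b * P' * c) + D = D + - (b * P' * c)"
      by (intro comm_add_mat[of _ ?k ?l]) (auto intro!: carrier_matI simp: d Pd)
    ultimately show ?thesis unfolding Y_def by (simp add: simps)
  qed
  ultimately show ?thesis
    unfolding equivalent_mats_def using Pd d by (metis index_mat_four_block(2,3))
qed

lemma equivalent_mats_diag:
  fixes M :: "'a :: field mat"
  assumes "equivalent_mats M N"
  shows "equivalent_mats (four_block_mat (1\<^sub>m s) (0\<^sub>m s (dim_col M)) (0\<^sub>m (dim_row M) s) M)
    (four_block_mat (1\<^sub>m s) (0\<^sub>m s (dim_col M)) (0\<^sub>m (dim_row M) s) N)"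
proof -
  let ?k = "dim_row M" and ?l = "dim_col M"
  obtain X X' Y Y' where *: "inverses ?k X X'" "inverses ?l Y Y'" "N = X * M * Y"
    using assms unfolding equivalent_mats_def by blast
  note d = inverses_dim[OF *(1)] inverses_dim[OF *(2)]
  have "four_block_mat (1\<^sub>m s) (0\<^sub>m s ?l) (0\<^sub>m ?k s) N =
      four_block_mat (1\<^sub>m s) (0\<^sub>m s ?k) (0\<^sub>m ?k s) X * four_block_mat (1\<^sub>m s) (0\<^sub>m s ?l) (0\<^sub>m ?k s) M *
      four_block_mat (1\<^sub>m s) (0\<^sub>m s ?l) (0\<^sub>m ?l s) Y"
    unfolding *(3) by (simp add: four_block_mult mat_dim_simps d)
  thus ?thesis
    using inverses_diag[OF inverses_one[of s] *(1)] inverses_diag[OF inverses_one[of s] *(2)]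
    unfolding equivalent_mats_def by auto
qed

text \<open>
Gaussian elimination with both row and column operations. It is the source of all rank formulas used later, since
the normal form shows the null space, the range and the rank of a matrix at once.
\<close>

lemma rank_normal_form_exists:
  fixes M :: "'a :: field mat"
  shows "\<exists>q. q \<le> dim_row M \<and> q \<le> dim_col M \<and>
    equivalent_mats M (partial_identity (dim_row M) (dim_col M) q)"
proof (induction "dim_row M" arbitrary: M)
  case 0
  have "M = partial_identity (dim_row M) (dim_col M) 0" by (intro eq_matI) (use 0 in auto)
  thus ?case using equivalent_mats_refl[of M] by auto
next
  case (Suc a)
  show ?case
  proof (cases "M = 0\<^sub>m (dim_row M) (dim_col M)")
    case True
    have "M = partial_identity (dim_row M) (dim_col M) 0"
      by (subst True) (intro eq_matI, auto simp: partial_identity_def)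
    thus ?thesis using equivalent_mats_refl[of M] by auto
  next
    case False
    then obtain i j where ij: "i < dim_row M" "j < dim_col M" "M $$ (i, j) \<noteq> 0"
      by (metis eq_matI index_zero_mat(1) index_zero_mat(2) index_zero_mat(3))
    obtain N where N: "equivalent_mats M N" "N $$ (0, 0) \<noteq> 0"
      using equivalent_mats_swap[OF ij(1,2)] ij(3) by metis
    define b where "b = dim_col M - 1"
    have dM: "dim_row M = 1 + a" "dim_col M = 1 + b" using Suc(2) ij by (auto simp: b_def)
    have "dim_row N = 1 + a" "dim_col N = 1 + b" using equivalent_mats_dim[OF N(1)] dM by auto
    then obtain P c d D where blk: "N = four_block_mat P c d D"
      and dims: "dim_row P = 1" "dim_col P = 1" "dim_row c = 1" "dim_col c = b"
        "dim_row d = a" "dim_col d = 1" "dim_row D = a" "dim_col D = b"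
      by (rule split_four_block)
    have "P $$ (0, 0) \<noteq> 0" using N(2) unfolding blk by (simp add: dims)
    hence "inverses 1 P (mat 1 1 (\<lambda>_. inverse (P $$ (0, 0))))"
      unfolding inverses_def by (auto intro!: carrier_matI eq_matI simp: dims scalar_prod_def)
    from equivalent_mats_schur[OF this, of c d D] dims obtain D' where
      D': "equivalent_mats N (four_block_mat (1\<^sub>m 1) (0\<^sub>m 1 b) (0\<^sub>m a 1) D')" "dim_row D' = a" "dim_col D' = b"
      unfolding blk by fastforce
    obtain q where q: "q \<le> a" "q \<le> b" "equivalent_mats D' (partial_identity a b q)"
      using Suc(1)[of D'] D'(2,3) by auto
    have "four_block_mat (1\<^sub>m 1) (0\<^sub>m 1 b) (0\<^sub>m a 1) (partial_identity a b q)
        = (partial_identity (dim_row M) (dim_col M) (Suc q) :: 'a mat)"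
      unfolding dM by (intro eq_matI) (auto simp: partial_identity_def)
    hence "equivalent_mats M (partial_identity (dim_row M) (dim_col M) (Suc q))"
      using equivalent_mats_trans[OF equivalent_mats_trans[OF N(1) D'(1)]]
        equivalent_mats_diag[OF q(3), of 1] D'(2,3) by simp
    thus ?thesis using q dM by (intro exI[of _ "Suc q"]) auto
  qed
qed

lemma partial_identity_factorization:
  fixes M :: "'a :: field mat"
  assumes "equivalent_mats M (partial_identity (dim_row M) (dim_col M) q)"
    and "q \<le> dim_row M" "q \<le> dim_col M"
  obtains U V where "M = U * V" "dim_row U = dim_row M" "dim_col U = q" "dim_row V = q" "dim_col V = dim_col M"
proof -
  let ?a = "dim_row M" and ?b = "dim_col M"
  obtain X X' Y Y' where *: "inverses ?a X X'" "inverses ?b Y Y'" "partial_identity ?a ?b q = X * M * Y"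
    using assms(1) unfolding equivalent_mats_def by blast
  note d = inverses_dim[OF *(1)] inverses_dim[OF *(2)]
  have "M = X' * (X * M * Y) * Y'"
    by (simp add: mat_assoc d inverses_cancel[OF *(1)] inverses_cancel[OF *(2)] mat_mult_one)
  also have "\<dots> = X' * (partial_identity ?a q q * partial_identity q ?b q) * Y'"
    unfolding *(3)[symmetric] by (simp add: partial_identity_mult)
  also have "\<dots> = (X' * partial_identity ?a q q) * (partial_identity q ?b q * Y')"
    by (simp add: mat_assoc d)
  finally show thesis by (rule that) (simp_all add: d)
qed

text \<open>
The normal form gives a factorization through dimension \<open>q\<close>, which bounds the rank from above, and it exhibits
\<open>q\<close> combinations of the columns without linear relations, which bounds it from below.
\<close>

lemma rank_of_equivalent_partial_identity:
  fixes M :: "'a :: field mat"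
  assumes q: "q \<le> dim_row M" "q \<le> dim_col M"
    and e: "equivalent_mats M (partial_identity (dim_row M) (dim_col M) q)"
  shows "mrank M = q"
proof (rule antisym)
  let ?a = "dim_row M" and ?b = "dim_col M"
  obtain X X' Y Y' where *: "inverses ?a X X'" "inverses ?b Y Y'" "partial_identity ?a ?b q = X * M * Y"
    using e unfolding equivalent_mats_def by blast
  note d = inverses_dim[OF *(1)] inverses_dim[OF *(2)]
  obtain U V where UV: "M = U * V" "dim_col U = q" "dim_row V = q"
    by (rule partial_identity_factorization[OF e q])
  have "mrank (U * V) \<le> dim_col U" by (rule rank_factorization_le) (simp add: UV)
  thus "mrank M \<le> q" unfolding UV(1)[symmetric] UV(2) .
  have "X * (M * (Y * partial_identity ?b q q)) = partial_identity ?a ?b q * partial_identity ?b q q"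
    unfolding *(3) by (simp add: mat_assoc d)
  also have "\<dots> = partial_identity ?a q q" using q by (simp add: partial_identity_mult)
  finally have "trivial_kernel (X * (M * (Y * partial_identity ?b q q)))"
    using trivial_kernel_partial_identity[OF q(1)] by simp
  hence "trivial_kernel (M * (Y * partial_identity ?b q q))"
    by (rule trivial_kernel_mult[rotated]) (simp add: d)
  hence "mrank (M * (Y * partial_identity ?b q q)) = q"
    using full_rank_iff_trivial_kernel[of "M * (Y * partial_identity ?b q q)"] by simp
  moreover have "mrank (M * (Y * partial_identity ?b q q)) \<le> mrank M"
    by (rule rank_mult_le) (simp add: d)
  ultimately show "q \<le> mrank M" by simp
qed

lemma rank_normal_form:
  fixes M :: "'a :: field mat"
  obtains X X' Y Y' where "inverses (dim_row M) X X'" "inverses (dim_col M) Y Y'"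
    "X * M * Y = partial_identity (dim_row M) (dim_col M) (mrank M)"
    "mrank M \<le> dim_row M" "mrank M \<le> dim_col M"
proof -
  obtain q where q: "q \<le> dim_row M" "q \<le> dim_col M"
    "equivalent_mats M (partial_identity (dim_row M) (dim_col M) q)"
    using rank_normal_form_exists by blast
  from rank_of_equivalent_partial_identity[OF this] have "mrank M = q" .
  with q show thesis using that unfolding equivalent_mats_def by metis
qed

lemma equivalent_mats_rank:
  fixes M :: "'a :: field mat"
  assumes "equivalent_mats M N"
  shows "mrank N = mrank M"
proof -
  note d = equivalent_mats_dim[OF assms]
  obtain q where q: "q \<le> dim_row N" "q \<le> dim_col N"
    "equivalent_mats N (partial_identity (dim_row N) (dim_col N) q)"
    using rank_normal_form_exists by blast
  show ?thesis
    using rank_of_equivalent_partial_identity[OF q] q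
      rank_of_equivalent_partial_identity[of q M] equivalent_mats_trans[OF assms q(3)] d by simp
qed

lemma rank_inverses_mult:
  fixes M :: "'a :: field mat"
  assumes "inverses (dim_row M) X X'" "inverses (dim_col M) Y Y'"
  shows "mrank (X * M * Y) = mrank M"
  by (rule equivalent_mats_rank) (use assms in \<open>auto simp: equivalent_mats_def\<close>)

lemma rank_le_dims:
  fixes M :: "'a :: field mat"
  shows "mrank M \<le> dim_row M" "mrank M \<le> dim_col M"
  by (rule rank_normal_form[of M], assumption)+

text \<open>
Column spaces only compare \<open>A B\<close> with \<open>A\<close>. For the comparison with \<open>B\<close>, a factorization of \<open>B\<close> through
dimension \<open>rank B\<close> is multiplied by \<open>A\<close>.
\<close>

lemma rank_mult_le_right:
  fixes A :: "'a :: field mat"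
  assumes "dim_col A = dim_row B"
  shows "mrank (A * B) \<le> mrank B"
proof -
  obtain q where q: "q \<le> dim_row B" "q \<le> dim_col B"
    "equivalent_mats B (partial_identity (dim_row B) (dim_col B) q)"
    using rank_normal_form_exists by blast
  obtain U V where UV: "B = U * V" "dim_row U = dim_row B" "dim_col U = q" "dim_row V = q"
    by (rule partial_identity_factorization[OF q(3,1,2)])
  have e: "A * U * V = A * B" unfolding UV(1) by (rule mat_assoc) (simp_all add: UV(2-4) assms)
  have "mrank (A * U * V) \<le> dim_col (A * U)" by (rule rank_factorization_le) (simp add: UV(3,4))
  thus ?thesis unfolding e rank_of_equivalent_partial_identity[OF q] using UV(3) by simp
qed

lemma rank_transpose:
  fixes M :: "'a :: field mat"
  shows "mrank (M\<^sup>T) = mrank M"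
proof -
  define q where "q = mrank M"
  obtain X X' Y Y' where X: "inverses (dim_row M) X X'" and Y: "inverses (dim_col M) Y Y'"
    and e: "X * M * Y = partial_identity (dim_row M) (dim_col M) q"
    and q: "q \<le> dim_row M" "q \<le> dim_col M"
    unfolding q_def by (rule rank_normal_form[of M])
  note d = inverses_dim[OF X] inverses_dim[OF Y]
  have "Y\<^sup>T * M\<^sup>T * X\<^sup>T = (X * M * Y)\<^sup>T"
    using d by (simp add: mat_transpose_mult mat_assoc)
  also have "\<dots> = partial_identity (dim_col M) (dim_row M) q"
    unfolding e by (intro eq_matI) (auto simp: partial_identity_def)
  finally have "equivalent_mats (M\<^sup>T) (partial_identity (dim_col M) (dim_row M) q)"
    unfolding equivalent_mats_def using inverses_transpose[OF X] inverses_transpose[OF Y] by fastforce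
  thus ?thesis
    using rank_of_equivalent_partial_identity[of q "M\<^sup>T"] q unfolding q_def by simp
qed

lemma rank_diag_one:
  fixes L :: "'a :: field mat"
  shows "mrank (four_block_mat (1\<^sub>m k) (0\<^sub>m k (dim_col L)) (0\<^sub>m (dim_row L) k) L) = k + mrank L"
proof -
  let ?a = "dim_row L" and ?b = "dim_col L"
  let ?D = "\<lambda>M. four_block_mat (1\<^sub>m k) (0\<^sub>m k ?b) (0\<^sub>m ?a k) M"
  define q where "q = mrank L"
  obtain X X' Y Y' where *: "inverses ?a X X'" "inverses ?b Y Y'" "X * L * Y = partial_identity ?a ?b q"
    and q: "q \<le> ?a" "q \<le> ?b"
    unfolding q_def by (rule rank_normal_form[of L])
  have "equivalent_mats L (partial_identity ?a ?b q)"
    unfolding equivalent_mats_def *(3)[symmetric] using *(1,2) by blast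
  from equivalent_mats_diag[OF this, of k]
  have "equivalent_mats (?D L) (?D (partial_identity ?a ?b q))" .
  also have "?D (partial_identity ?a ?b q) = partial_identity (k + ?a) (k + ?b) (k + q)"
    by (intro eq_matI) (auto simp: partial_identity_def)
  finally show ?thesis
    using rank_of_equivalent_partial_identity[of "k + q" "?D L"] q unfolding q_def by simp
qed

section \<open>Column concatenation and bases of null spaces\<close>

definition hcat :: "'a :: zero mat \<Rightarrow> 'a mat \<Rightarrow> 'a mat" where
  "hcat A B = four_block_mat A B (0\<^sub>m 0 (dim_col A)) (0\<^sub>m 0 (dim_col B))"

lemma hcat_dim [simp]:
  "dim_row (hcat A B) = dim_row A" "dim_col (hcat A B) = dim_col A + dim_col B"
  by (simp_all add: hcat_def)

lemma hcat_mult_vec: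
  fixes A :: "'a :: semiring_1 mat"
  assumes "dim_row B = dim_row A" "dim_vec x = dim_col A" "dim_vec y = dim_col B"
  shows "hcat A B *\<^sub>v (x @\<^sub>v y) = A *\<^sub>v x + B *\<^sub>v y"
proof -
  have "hcat A B *\<^sub>v (x @\<^sub>v y) =
      (A *\<^sub>v x + B *\<^sub>v y) @\<^sub>v (0\<^sub>m 0 (dim_col A) *\<^sub>v x + 0\<^sub>m 0 (dim_col B) *\<^sub>v y)"
    unfolding hcat_def using assms by (intro four_block_mult_append) auto
  also have "\<dots> = A *\<^sub>v x + B *\<^sub>v y" using assms by (intro eq_vecI) auto
  finally show ?thesis .
qed

lemma hcat_trivial_kernel_left:
  fixes A :: "'a :: semiring_1 mat"
  assumes d: "dim_row B = dim_row A" and tk: "trivial_kernel (hcat A B)"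
  shows "trivial_kernel A"
  unfolding trivial_kernel_def
proof (intro allI impI)
  fix x assume x: "dim_vec x = dim_col A" "A *\<^sub>v x = 0\<^sub>v (dim_row A)"
  let ?z = "0\<^sub>v (dim_col B) :: 'a vec"
  have "hcat A B *\<^sub>v (x @\<^sub>v ?z) = A *\<^sub>v x + B *\<^sub>v ?z"
    by (rule hcat_mult_vec) (simp_all add: d x(1))
  also have "\<dots> = 0\<^sub>v (dim_row (hcat A B))"
    unfolding x(2) using d by (simp add: mult_zero_vec vec_add_zero)
  finally have "x @\<^sub>v ?z = 0\<^sub>v (dim_col (hcat A B))"
    using trivial_kernelD[OF tk] x(1) by simp
  hence "x @\<^sub>v ?z = 0\<^sub>v (dim_col A) @\<^sub>v ?z" unfolding hcat_dim append_vec_zero .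
  thus "x = 0\<^sub>v (dim_col A)" using append_vec_eq_iff[of x "0\<^sub>v (dim_col A)"] x(1) by simp
qed

lemma hcat_mult_diag:
  fixes A :: "'a :: semiring_1 mat"
  assumes "dim_row B = dim_row A" "dim_row X = dim_col A" "dim_row Y = dim_col B"
  shows "hcat A B * four_block_mat X (0\<^sub>m (dim_row X) (dim_col Y)) (0\<^sub>m (dim_row Y) (dim_col X)) Y
    = hcat (A * X) (B * Y)"
  unfolding hcat_def using assms by (simp add: four_block_mult mat_dim_simps)

lemma mult_hcat:
  fixes A :: "'a :: semiring_1 mat"
  assumes "dim_col M = dim_row A" "dim_row B = dim_row A"
  shows "M * hcat A B = hcat (M * A) (M * B)"
proof -
  have "col (hcat A B) j = (if j < dim_col A then col A j else col B (j - dim_col A))"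
    if "j < dim_col A + dim_col B" for j
    using that assms by (intro eq_vecI) (auto simp: hcat_def)
  thus ?thesis
    using assms by (intro eq_matI) (auto simp: hcat_def)
qed

lemma transpose_hcat_mult:
  fixes A :: "'a :: semiring_0 mat"
  assumes "dim_row B = dim_row A" "dim_row C = dim_row A" "dim_row D = dim_row A"
  shows "(hcat A B)\<^sup>T * hcat C D = four_block_mat (A\<^sup>T * C) (A\<^sup>T * D)
    (B\<^sup>T * C) (B\<^sup>T * D)"
proof -
  have col: "col (hcat M N) j = (if j < dim_col M then col M j else col N (j - dim_col M))"
    if "j < dim_col M + dim_col N" "dim_row N = dim_row M" for M N :: "'a mat" and j
    using that by (intro eq_vecI) (auto simp: hcat_def)
  show ?thesis (is "?L = ?R")
  proof (rule eq_matI)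
    fix i j
    assume "i < dim_row ?R" "j < dim_col ?R"
    hence ij: "i < dim_col A + dim_col B" "j < dim_col C + dim_col D" by simp_all
    have "?L $$ (i, j) = col (hcat A B) i \<bullet> col (hcat C D) j"
      using ij by simp
    also have "\<dots> = ?R $$ (i, j)"
      using ij assms by (simp add: col)
    finally show "?L $$ (i, j) = ?R $$ (i, j)" .
  qed simp_all
qed

lemma hcat_congruence:
  fixes M :: "'a :: semiring_1 mat"
  assumes "dim_row M = m" "dim_col M = m" "dim_row A = m" "dim_row B = m"
  shows "(hcat A B)\<^sup>T * M * hcat A B =
    four_block_mat (A\<^sup>T * M * A) (A\<^sup>T * M * B)
      (B\<^sup>T * M * A) (B\<^sup>T * M * B)"
proof -
  have "(hcat A B)\<^sup>T * M * hcat A B = (hcat A B)\<^sup>T * (M * hcat A B)"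
    by (rule mat_assoc) (simp_all add: assms)
  also have "M * hcat A B = hcat (M * A) (M * B)" by (rule mult_hcat) (simp_all add: assms)
  also have "(hcat A B)\<^sup>T * hcat (M * A) (M * B) =
    four_block_mat (A\<^sup>T * (M * A)) (A\<^sup>T * (M * B))
      (B\<^sup>T * (M * A)) (B\<^sup>T * (M * B))"
    by (rule transpose_hcat_mult) (simp_all add: assms)
  finally show ?thesis using assms by (simp add: mat_assoc)
qed

definition lower_identity :: "nat \<Rightarrow> nat \<Rightarrow> 'a :: semiring_1 mat" where
  "lower_identity q l = mat (q + l) l (\<lambda>(i, j). if i = q + j then 1 else 0)"

lemma lower_identity_dim [simp]:
  "dim_row (lower_identity q l) = q + l" "dim_col (lower_identity q l) = l"
  by (auto simp: lower_identity_def)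

lemma lower_identity_four_block:
  "lower_identity k m = four_block_mat (0\<^sub>m k m) (0\<^sub>m k 0) (1\<^sub>m m) (0\<^sub>m m 0)"
  "(lower_identity k m)\<^sup>T = four_block_mat (0\<^sub>m m k) (1\<^sub>m m) (0\<^sub>m 0 k) (0\<^sub>m 0 m)"
proof -
  show E: "lower_identity k m = four_block_mat (0\<^sub>m k m) (0\<^sub>m k 0) (1\<^sub>m m) (0\<^sub>m m 0)" for k m
    by (intro eq_matI) (auto simp: lower_identity_def)
  show "(lower_identity k m)\<^sup>T = four_block_mat (0\<^sub>m m k) (1\<^sub>m m) (0\<^sub>m 0 k) (0\<^sub>m 0 m)"
    unfolding E by (subst four_block_transpose) simp_all
qed

lemma lower_identity_mult_vec:
  assumes "dim_vec y = l"
  shows "lower_identity q l *\<^sub>v y = 0\<^sub>v q @\<^sub>v (y :: 'a :: semiring_1 vec)"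
proof (rule eq_vecI)
  fix i assume i: "i < dim_vec (0\<^sub>v q @\<^sub>v y)"
  hence "(lower_identity q l *\<^sub>v y) $ i = (\<Sum>t = 0..<l. (if i = q + t then 1 else 0) * y $ t)"
    using assms by (simp add: lower_identity_def scalar_prod_def)
  also have "\<dots> = (\<Sum>t = 0..<l. if t = i - q then (if q \<le> i then y $ (i - q) else 0) else 0)"
    by (rule sum.cong) auto
  also have "\<dots> = (0\<^sub>v q @\<^sub>v y) $ i" using i assms by auto
  finally show "(lower_identity q l *\<^sub>v y) $ i = (0\<^sub>v q @\<^sub>v y) $ i" .
qed (use assms in auto)

lemma trivial_kernel_lower_identity: "trivial_kernel (lower_identity q l)"
  unfolding trivial_kernel_def
  by (auto simp: lower_identity_mult_vec append_vec_zero append_vec_eq_iff)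

lemma hcat_lower_identity:
  fixes A :: "'a :: semiring_1 mat"
  assumes "dim_row B = dim_row A"
  shows "hcat A B * lower_identity (dim_col A) (dim_col B) = B"
proof -
  let ?k = "dim_col A" and ?m = "dim_col B"
  have "hcat A B * lower_identity ?k ?m = four_block_mat B (0\<^sub>m (dim_row A) 0) (0\<^sub>m 0 ?m) (0\<^sub>m 0 0)"
    unfolding hcat_def lower_identity_four_block using assms by (simp add: four_block_mult mat_dim_simps)
  also have "\<dots> = B" using assms by (intro eq_matI) auto
  finally show ?thesis .
qed

lemma lower_right_compression:
  fixes P :: "'a :: semiring_1 mat"
  assumes "dim_row P = s" "dim_col P = s" "dim_row c = s" "dim_col c = k" "dim_row b = k" "dim_col b = s"
    "dim_row D = k" "dim_col D = k"
  shows "(lower_identity s k)\<^sup>T * four_block_mat P c b D * lower_identity s k = D"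
proof -
  have "(lower_identity s k)\<^sup>T * four_block_mat P c b D * lower_identity s k
    = four_block_mat D (0\<^sub>m k 0) (0\<^sub>m 0 k) (0\<^sub>m 0 0)"
    unfolding lower_identity_four_block(2) unfolding lower_identity_four_block(1) using assms by (simp add: four_block_mult mat_dim_simps)
  also have "\<dots> = D" using assms by (intro eq_matI) auto
  finally show ?thesis .
qed

lemma rank_diag_zero:
  fixes L :: "real mat"
  assumes d: "dim_row L = k" "dim_col L = k"
  shows "mrank (four_block_mat (0\<^sub>m s s) (0\<^sub>m s k) (0\<^sub>m k s) L) = mrank L" (is "mrank ?D = _")
proof (rule antisym)
  let ?E = "lower_identity s k :: real mat"
  have L: "L = four_block_mat L (0\<^sub>m k 0) (0\<^sub>m 0 k) (0\<^sub>m 0 0)"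
    using d by (intro eq_matI) auto
  have D: "?D = ?E * L * ?E\<^sup>T"
    unfolding lower_identity_four_block(2) unfolding lower_identity_four_block(1) by (subst (2) L) (use d in \<open>simp add: four_block_mult mat_dim_simps\<close>)
  have "mrank (?E * L * ?E\<^sup>T) \<le> mrank (?E * L)" by (rule rank_mult_le) (use d in simp)
  also have "\<dots> \<le> mrank L" by (rule rank_mult_le_right) (use d in simp)
  finally show "mrank ?D \<le> mrank L" unfolding D .
  have "mrank (?E\<^sup>T * ?D * ?E) \<le> mrank (?E\<^sup>T * ?D)"
    by (rule rank_mult_le) (use d in simp)
  also have "\<dots> \<le> mrank ?D" by (rule rank_mult_le_right) (use d in simp)
  also have "?E\<^sup>T * ?D * ?E = L"
    by (rule lower_right_compression) (use d in simp_all)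
  finally show "mrank L \<le> mrank ?D" .
qed

lemma partial_identity_append:
  fixes x :: "'a :: semiring_1 vec"
  assumes "dim_vec x = q" "dim_vec y = l" "q \<le> a"
  shows "partial_identity a (q + l) q *\<^sub>v (x @\<^sub>v y) = x @\<^sub>v 0\<^sub>v (a - q)"
proof (rule eq_vecI)
  fix i assume "i < dim_vec (x @\<^sub>v (0\<^sub>v (a - q) :: 'a vec))"
  hence i: "i < a" using assms by simp
  show "(partial_identity a (q + l) q *\<^sub>v (x @\<^sub>v y)) $ i = (x @\<^sub>v 0\<^sub>v (a - q)) $ i"
    using partial_identity_mult_vec[of "x @\<^sub>v y" "q + l" i a q] i assms by simp
qed (use assms in auto)

lemma partial_identity_lower_identity_split:
  fixes H :: "'a :: semiring_1 mat"
  assumes d: "dim_row H = k + m" and z: "partial_identity k (k + m) k * H = 0\<^sub>m k (dim_col H)"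
  shows "H = lower_identity k m * ((lower_identity k m)\<^sup>T * H)"
proof -
  define H1 where "H1 = mat k (dim_col H) (\<lambda>(i, j). H $$ (i, j))"
  define H2 where "H2 = mat m (dim_col H) (\<lambda>(i, j). H $$ (k + i, j))"
  have H: "H = four_block_mat H1 (0\<^sub>m k 0) H2 (0\<^sub>m m 0)"
    using d by (intro eq_matI) (auto simp: H1_def H2_def)
  have dH: "dim_row H1 = k" "dim_row H2 = m" "dim_col H1 = dim_col H" "dim_col H2 = dim_col H"
    by (simp_all add: H1_def H2_def)
  have PI: "partial_identity k (k + m) k = four_block_mat (1\<^sub>m k) (0\<^sub>m k m) (0\<^sub>m 0 k) (0\<^sub>m 0 m)"
    by (intro eq_matI) (auto simp: partial_identity_def)
  have b0: "four_block_mat X (0\<^sub>m a 0) (0\<^sub>m 0 b) (0\<^sub>m 0 0) = X" if "dim_row X = a" "dim_col X = b"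
    for X :: "'a mat" and a b
    using that by (intro eq_matI) auto
  have "four_block_mat (1\<^sub>m k) (0\<^sub>m k m) (0\<^sub>m 0 k) (0\<^sub>m 0 m) * four_block_mat H1 (0\<^sub>m k 0) H2 (0\<^sub>m m 0)
      = four_block_mat H1 (0\<^sub>m k 0) (0\<^sub>m 0 (dim_col H)) (0\<^sub>m 0 0)"
    using dH by (simp add: four_block_mult mat_dim_simps)
  also have "\<dots> = H1" by (rule b0) (simp_all add: dH)
  finally have H1: "H1 = 0\<^sub>m k (dim_col H)" using z unfolding PI[symmetric] H[symmetric] by simp
  have "four_block_mat (0\<^sub>m m k) (1\<^sub>m m) (0\<^sub>m 0 k) (0\<^sub>m 0 m) * four_block_mat H1 (0\<^sub>m k 0) H2 (0\<^sub>m m 0)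
      = four_block_mat H2 (0\<^sub>m m 0) (0\<^sub>m 0 (dim_col H)) (0\<^sub>m 0 0)"
    using dH by (simp add: four_block_mult mat_dim_simps)
  also have "four_block_mat (0\<^sub>m k m) (0\<^sub>m k 0) (1\<^sub>m m) (0\<^sub>m m 0) * \<dots> =
      four_block_mat (0\<^sub>m k (dim_col H)) (0\<^sub>m k 0) H2 (0\<^sub>m m 0)"
    using dH by (simp add: four_block_mult mat_dim_simps)
  finally show ?thesis unfolding lower_identity_four_block[symmetric] H1[symmetric] H[symmetric] by simp
qed

text \<open>
The content of \<open>is_S_infty\<close> in terms of vectors, over any field and with the number of columns made explicit.
\<close>

definition kernel_basis :: "'a :: field mat \<Rightarrow> 'a mat \<Rightarrow> bool" where
  "kernel_basis M V \<longleftrightarrow> dim_row V = dim_col M \<and> dim_col V = dim_col M - mrank M \<and> trivial_kernel V \<and>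
     (\<forall>v. dim_vec v = dim_col M \<longrightarrow>
        (M *\<^sub>v v = 0\<^sub>v (dim_row M) \<longleftrightarrow> (\<exists>x. dim_vec x = dim_col V \<and> v = V *\<^sub>v x)))"

lemma kernel_basis_ex:
  fixes M :: "'a :: field mat"
  obtains V where "kernel_basis M V"
proof -
  let ?a = "dim_row M" and ?b = "dim_col M"
  define q where "q = mrank M"
  obtain X X' Y Y' where *: "inverses ?a X X'" "inverses ?b Y Y'"
    "X * M * Y = partial_identity ?a ?b q" and q: "q \<le> ?a" "q \<le> ?b"
    unfolding q_def by (rule rank_normal_form[of M])
  note d = inverses_dim[OF *(1)] inverses_dim[OF *(2)]
  define l where "l = ?b - q"
  have b: "?b = q + l" using q by (simp add: l_def)
  define V where "V = Y * lower_identity q l"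
  have dV: "dim_row V = ?b" "dim_col V = l" by (auto simp: V_def d)
  have "trivial_kernel V"
    unfolding V_def using d b inverses_trivial_kernel[OF *(2)]
    by (intro trivial_kernel_comp trivial_kernel_lower_identity) auto
  moreover have "M *\<^sub>v v = 0\<^sub>v ?a \<longleftrightarrow> (\<exists>x. dim_vec x = l \<and> v = V *\<^sub>v x)" if v: "dim_vec v = ?b" for v
  proof -
    have "dim_vec (Y' *\<^sub>v v) = q + l" using d b by simp
    then obtain x y where xy: "Y' *\<^sub>v v = x @\<^sub>v y" "dim_vec x = q" "dim_vec y = l" by (rule split_vec)
    have vY: "v = Y *\<^sub>v (x @\<^sub>v y)" using inverses_cancel(3)[OF *(2) v] xy(1) by simp
    have "M *\<^sub>v v = 0\<^sub>v ?a \<longleftrightarrow> X *\<^sub>v (M *\<^sub>v v) = 0\<^sub>v ?a"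
      using inverses_trivial_kernel[OF *(1)] d unfolding trivial_kernel_def
      by (metis dim_mult_mat_vec mult_zero_vec)
    also have "X *\<^sub>v (M *\<^sub>v v) = partial_identity ?a ?b q *\<^sub>v (x @\<^sub>v y)"
      unfolding *(3)[symmetric] vY using d b xy by (simp add: mat_vec_assoc mat_assoc)
    also have "\<dots> = x @\<^sub>v 0\<^sub>v (?a - q)"
      unfolding b by (rule partial_identity_append[OF xy(2,3) q(1)])
    also have "(\<dots> = 0\<^sub>v ?a) \<longleftrightarrow> x = 0\<^sub>v q"
    proof -
      have "0\<^sub>v ?a = (0\<^sub>v q @\<^sub>v 0\<^sub>v (?a - q) :: 'a vec)"
        using append_vec_zero[of q "?a - q"] q(1) by (metis le_add_diff_inverse)
      thus ?thesis using append_vec_eq_iff[of x "0\<^sub>v q"] xy(2) by (metis index_zero_vec(2))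
    qed
    also have "\<dots> \<longleftrightarrow> (\<exists>z. dim_vec z = l \<and> v = V *\<^sub>v z)"
    proof
      assume "x = 0\<^sub>v q"
      hence "v = V *\<^sub>v y"
        unfolding vY V_def using xy d b by (simp add: mat_vec_assoc lower_identity_mult_vec)
      thus "\<exists>z. dim_vec z = l \<and> v = V *\<^sub>v z" using xy by blast
    next
      assume "\<exists>z. dim_vec z = l \<and> v = V *\<^sub>v z"
      then obtain z where z: "dim_vec z = l" "v = V *\<^sub>v z" by blast
      have "Y' *\<^sub>v v = lower_identity q l *\<^sub>v z"
        unfolding z(2) V_def using z(1) d b
        by (simp add: mat_vec_assoc inverses_cancel[OF *(2)])
      hence "x @\<^sub>v y = 0\<^sub>v q @\<^sub>v z" using xy(1) z(1) by (simp add: lower_identity_mult_vec)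
      thus "x = 0\<^sub>v q" using xy(2) append_vec_eq_iff[of x "0\<^sub>v q" y z] by simp
    qed
    finally show ?thesis .
  qed
  ultimately have "kernel_basis M V" unfolding kernel_basis_def q_def[symmetric] using dV l_def by auto
  thus thesis by (rule that)
qed

text \<open>
The number of columns is forced: an admissible choice has the same column space, hence the same rank, as the
basis read off from the normal form, and both have full column rank.
\<close>

lemma S_infty_kernel_basis:
  assumes "is_S_infty M S"
  shows "kernel_basis M S"
proof -
  let ?n = "dim_col M"
  have dS: "dim_row S = ?n" and rk: "mrank S = dim_col S"
    and cs: "vec_space.col_space (dim_row S) S = mat_kernel M"
    using assms unfolding is_S_infty_def by blast+
  have tk: "trivial_kernel S" using rk full_rank_iff_trivial_kernel[of S] by blast
  have mem: "M *\<^sub>v v = 0\<^sub>v (dim_row M) \<longleftrightarrow> (\<exists>x. dim_vec x = dim_col S \<and> v = S *\<^sub>v x)"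
    if "dim_vec v = ?n" for v
  proof -
    have "M *\<^sub>v v = 0\<^sub>v (dim_row M) \<longleftrightarrow> v \<in> mat_kernel M"
      unfolding mat_kernel_def mem_Collect_eq using that carrier_vecI by blast
    also have "\<dots> \<longleftrightarrow> (\<exists>x. dim_vec x = dim_col S \<and> S *\<^sub>v x = v)"
      unfolding cs[symmetric] by (rule mem_col_space_iff)
    also have "\<dots> \<longleftrightarrow> (\<exists>x. dim_vec x = dim_col S \<and> v = S *\<^sub>v x)" by (simp only: eq_commute)
    finally show ?thesis .
  qed
  obtain V where V: "kernel_basis M V" by (rule kernel_basis_ex)
  have dV: "dim_row V = ?n" using V by (simp add: kernel_basis_def)
  have memV: "M *\<^sub>v v = 0\<^sub>v (dim_row M) \<longleftrightarrow> (\<exists>x. dim_vec x = dim_col V \<and> v = V *\<^sub>v x)"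
    if "dim_vec v = ?n" for v
    using V that unfolding kernel_basis_def by blast
  have cs': "w \<in> vec_space.col_space ?n W \<longleftrightarrow> dim_vec w = ?n \<and> (\<exists>x. dim_vec x = dim_col W \<and> w = W *\<^sub>v x)"
    if "dim_row W = ?n" for w and W :: "real mat"
  proof -
    have "w \<in> vec_space.col_space ?n W \<longleftrightarrow> (\<exists>x. dim_vec x = dim_col W \<and> W *\<^sub>v x = w)"
      using mem_col_space_iff[of w W] unfolding that .
    thus ?thesis using that by auto
  qed
  have "vec_space.col_space ?n V = vec_space.col_space ?n S"
  proof (rule Set.set_eqI)
    fix v
    show "v \<in> vec_space.col_space ?n V \<longleftrightarrow> v \<in> vec_space.col_space ?n S"
      unfolding cs'[OF dV] cs'[OF dS] using memV mem by blast
  qed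
  from rank_eq_if_col_space_eq[OF this] have "mrank V = mrank S" unfolding dV dS .
  moreover have "mrank V = dim_col V"
    using full_rank_iff_trivial_kernel[of V] V unfolding kernel_basis_def by blast
  moreover have "dim_col V = ?n - mrank M" using V unfolding kernel_basis_def by blast
  ultimately have "dim_col S = ?n - mrank M" using rk by linarith
  thus ?thesis unfolding kernel_basis_def using dS tk mem by blast
qed

lemma kernel_basisD:
  assumes "kernel_basis M V"
  shows "dim_row V = dim_col M" "dim_col V = dim_col M - mrank M" "trivial_kernel V"
    and "M * V = 0\<^sub>m (dim_row M) (dim_col V)"
    and "dim_vec v = dim_col M \<Longrightarrow> M *\<^sub>v v = 0\<^sub>v (dim_row M) \<Longrightarrow> \<exists>x. dim_vec x = dim_col V \<and> v = V *\<^sub>v x"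
proof -
  show d: "dim_row V = dim_col M" "dim_col V = dim_col M - mrank M" "trivial_kernel V"
    using assms by (auto simp: kernel_basis_def)
  show "dim_vec v = dim_col M \<Longrightarrow> M *\<^sub>v v = 0\<^sub>v (dim_row M) \<Longrightarrow> \<exists>x. dim_vec x = dim_col V \<and> v = V *\<^sub>v x"
    using assms by (auto simp: kernel_basis_def)
  show "M * V = 0\<^sub>m (dim_row M) (dim_col V)"
  proof (rule eq_matI)
    fix i j assume "i < dim_row (0\<^sub>m (dim_row M) (dim_col V) :: 'a mat)"
      "j < dim_col (0\<^sub>m (dim_row M) (dim_col V) :: 'a mat)"
    hence ij: "i < dim_row M" "j < dim_col V" by auto
    have "col V j = V *\<^sub>v unit_vec (dim_col V) j"
      using ij by (intro eq_vecI) simp_all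
    hence "M *\<^sub>v col V j = 0\<^sub>v (dim_row M)"
      using assms d unfolding kernel_basis_def by (metis dim_col index_unit_vec(3))
    hence "(M *\<^sub>v col V j) $ i = 0" using ij by simp
    thus "(M * V) $$ (i, j) = 0\<^sub>m (dim_row M) (dim_col V) $$ (i, j)" using ij by simp
  qed auto
qed

lemma basis_completion:
  fixes V :: "'a :: field mat"
  assumes "trivial_kernel V"
  obtains W T' where "dim_row W = dim_row V" "dim_col V + dim_col W = dim_row V"
    "inverses (dim_row V) (hcat V W) T'"
proof -
  let ?m = "dim_row V" and ?s = "dim_col V"
  have r: "mrank V = ?s" using full_rank_iff_trivial_kernel assms by blast
  obtain X X' Y Y' where *: "inverses ?m X X'" "inverses ?s Y Y'"
    "X * V * Y = partial_identity ?m ?s ?s" and s: "?s \<le> ?m"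
    using rank_normal_form[of V] unfolding r by metis
  note d = inverses_dim[OF *(1)] inverses_dim[OF *(2)]
  define l where "l = ?m - ?s"
  have m: "?m = ?s + l" using s by (simp add: l_def)
  define W where "W = X' * lower_identity ?s l"
  have one: "hcat (partial_identity ?m ?s ?s) (lower_identity ?s l) = (1\<^sub>m ?m :: 'a mat)"
    unfolding m by (intro eq_matI) (auto simp: hcat_def partial_identity_def lower_identity_def)
  have "V = X' * (X * V * Y) * Y'"
    by (simp add: mat_assoc d inverses_cancel[OF *(1)] inverses_cancel[OF *(2)] mat_mult_one)
  hence V: "V = X' * partial_identity ?m ?s ?s * Y'" unfolding *(3) .
  have "X' * four_block_mat Y' (0\<^sub>m ?s l) (0\<^sub>m l ?s) (1\<^sub>m l) =
      X' * (hcat (partial_identity ?m ?s ?s) (lower_identity ?s l) * four_block_mat Y' (0\<^sub>m ?s l) (0\<^sub>m l ?s) (1\<^sub>m l))"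
    unfolding one using d m by (simp add: mat_mult_one)
  also have "hcat (partial_identity ?m ?s ?s) (lower_identity ?s l) * four_block_mat Y' (0\<^sub>m ?s l) (0\<^sub>m l ?s) (1\<^sub>m l)
      = hcat (partial_identity ?m ?s ?s * Y') (lower_identity ?s l)"
    using hcat_mult_diag[of "lower_identity ?s l" "partial_identity ?m ?s ?s" Y' "1\<^sub>m l"] d m
    by (simp add: mat_mult_one)
  also have "X' * \<dots> = hcat (X' * (partial_identity ?m ?s ?s * Y')) W"
    unfolding W_def using d m by (intro mult_hcat) auto
  also have "X' * (partial_identity ?m ?s ?s * Y') = V"
  proof -
    have "X' * partial_identity ?m ?s ?s * Y' = X' * (partial_identity ?m ?s ?s * Y')"
      by (rule mat_assoc) (simp_all add: d)
    thus ?thesis using V by (rule trans[OF sym sym])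
  qed
  finally have "X' * four_block_mat Y' (0\<^sub>m ?s l) (0\<^sub>m l ?s) (1\<^sub>m l) = hcat V W" .
  moreover have "inverses ?m (four_block_mat Y' (0\<^sub>m ?s l) (0\<^sub>m l ?s) (1\<^sub>m l))
      (four_block_mat Y (0\<^sub>m ?s l) (0\<^sub>m l ?s) (1\<^sub>m l))"
    using inverses_diag[OF inverses_sym[OF *(2)] inverses_one[of l]] m by simp
  ultimately have "inverses ?m (hcat V W) (four_block_mat Y (0\<^sub>m ?s l) (0\<^sub>m l ?s) (1\<^sub>m l) * X)"
    using inverses_mult[OF inverses_sym[OF *(1)]] by metis
  moreover have "dim_row W = ?m" "?s + dim_col W = ?m" using d m by (auto simp: W_def)
  ultimately show thesis using that by blast
qed

section \<open>Regular pencils of index at most one\<close>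

text \<open>
There is no chain of length two at the eigenvalue infinity. Such a chain would be a vector \<open>x \<noteq> 0\<close> with \<open>E x = 0\<close> and
\<open>A x = E z\<close>. For square matrices the absence of such vectors also excludes singular pencils, so that this single condition
expresses regularity together with index at most one, without reference to a canonical form.
\<close>

definition impulse_free :: "'a :: semiring_0 mat \<Rightarrow> 'a mat \<Rightarrow> bool" where
  "impulse_free E A \<longleftrightarrow>
     (\<forall>x z. dim_vec x = dim_col E \<longrightarrow> dim_vec z = dim_col E \<longrightarrow>
        E *\<^sub>v x = 0\<^sub>v (dim_row E) \<longrightarrow> A *\<^sub>v x = E *\<^sub>v z \<longrightarrow> x = 0\<^sub>v (dim_col E))"

lemma impulse_freeI:
  assumes "\<And>x z. dim_vec x = dim_col E \<Longrightarrow> dim_vec z = dim_col E \<Longrightarrow>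
    E *\<^sub>v x = 0\<^sub>v (dim_row E) \<Longrightarrow> A *\<^sub>v x = E *\<^sub>v z \<Longrightarrow> x = 0\<^sub>v (dim_col E)"
  shows "impulse_free E A"
  using assms unfolding impulse_free_def by blast

lemma impulse_freeD:
  assumes "impulse_free E A" "dim_vec x = dim_col E" "dim_vec z = dim_col E"
    "E *\<^sub>v x = 0\<^sub>v (dim_row E)" "A *\<^sub>v x = E *\<^sub>v z"
  shows "x = 0\<^sub>v (dim_col E)"
  using assms unfolding impulse_free_def by blast

lemma impulse_free_equivalence:
  fixes E A :: "'a :: semiring_1 mat"
  assumes X: "inverses n X X'" and Y: "inverses n Y Y'"
    and d: "dim_row E = n" "dim_col E = n" "dim_row A = n" "dim_col A = n"
    and i: "impulse_free E A"
  shows "impulse_free (X * E * Y) (X * A * Y)"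
proof (rule impulse_freeI)
  note dd = inverses_dim[OF X] inverses_dim[OF Y] d
  fix x z assume dx: "dim_vec x = dim_col (X * E * Y)" "dim_vec z = dim_col (X * E * Y)"
    and 1: "X * E * Y *\<^sub>v x = 0\<^sub>v (dim_row (X * E * Y))" and 2: "X * A * Y *\<^sub>v x = X * E * Y *\<^sub>v z"
  have cancel: "X' *\<^sub>v (X * M * Y *\<^sub>v u) = M *\<^sub>v (Y *\<^sub>v u)"
    if "dim_vec u = n" "dim_row M = n" "dim_col M = n" for M u
    using that by (simp add: mat_vec_assoc dd inverses_cancel(4)[OF X])
  have n: "dim_vec x = n" "dim_vec z = n" using dx dd by simp_all
  have "E *\<^sub>v (Y *\<^sub>v x) = X' *\<^sub>v (X * E * Y *\<^sub>v x)" by (rule cancel[OF n(1) d(1,2), symmetric])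
  also have "\<dots> = 0\<^sub>v n" unfolding 1 using dd by (simp add: mult_zero_vec)
  finally have "E *\<^sub>v (Y *\<^sub>v x) = 0\<^sub>v n" .
  moreover have "A *\<^sub>v (Y *\<^sub>v x) = E *\<^sub>v (Y *\<^sub>v z)"
    using cancel[OF n(1) d(3,4)] unfolding 2 cancel[OF n(2) d(1,2)] by (rule sym)
  ultimately have "Y *\<^sub>v x = 0\<^sub>v n"
    using impulse_freeD[OF i, of "Y *\<^sub>v x" "Y *\<^sub>v z"] dd by simp
  hence "x = Y' *\<^sub>v 0\<^sub>v n" using inverses_cancel(4)[OF Y n(1)] by metis
  thus "x = 0\<^sub>v (dim_col (X * E * Y))" using dd by (simp add: mult_zero_vec)
qed

lemma impulse_free_equivalence_iff:
  fixes E A :: "'a :: semiring_1 mat"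
  assumes X: "inverses n X X'" and Y: "inverses n Y Y'"
    and d: "dim_row E = n" "dim_col E = n" "dim_row A = n" "dim_col A = n"
  shows "impulse_free (X * E * Y) (X * A * Y) \<longleftrightarrow> impulse_free E A"
proof
  note dd = inverses_dim[OF X] inverses_dim[OF Y] d
  have undo: "X' * (X * M * Y) * Y' = M" if "dim_row M = n" "dim_col M = n" for M
    using that by (simp add: mat_assoc dd inverses_cancel[OF X] inverses_cancel[OF Y] mat_mult_one)
  assume "impulse_free (X * E * Y) (X * A * Y)"
  from impulse_free_equivalence[OF inverses_sym[OF X] inverses_sym[OF Y] _ _ _ _ this]
  show "impulse_free E A" unfolding undo[OF d(1,2)] undo[OF d(3,4)] by (simp add: dd)
next
  assume "impulse_free E A"
  from impulse_free_equivalence[OF X Y d this] show "impulse_free (X * E * Y) (X * A * Y)" .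
qed

text \<open>
A vector in the null space of \<open>diag(I, L)\<close> lives in the second component, and the identity block can match
any first component, so only the lower right block of \<open>A\<close> matters.
\<close>

lemma impulse_free_diag_one:
  fixes L :: "'a :: semiring_1 mat"
  assumes d: "dim_row L = m" "dim_col L = m" "dim_row A1 = k" "dim_col A1 = k" "dim_row A2 = k" "dim_col A2 = m"
    "dim_row A3 = m" "dim_col A3 = k" "dim_row A4 = m" "dim_col A4 = m"
  shows "impulse_free (four_block_mat (1\<^sub>m k) (0\<^sub>m k m) (0\<^sub>m m k) L) (four_block_mat A1 A2 A3 A4)
    \<longleftrightarrow> impulse_free L A4" (is "impulse_free ?L ?A \<longleftrightarrow> _")
proof -
  have Lx: "?L *\<^sub>v (u @\<^sub>v w) = u @\<^sub>v (L *\<^sub>v w)" if "dim_vec u = k" "dim_vec w = m" for u w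
    using that d by (simp add: four_block_mult_append mat_dim_simps)
  have Ax: "?A *\<^sub>v (u @\<^sub>v w) = (A1 *\<^sub>v u + A2 *\<^sub>v w) @\<^sub>v (A3 *\<^sub>v u + A4 *\<^sub>v w)"
    if "dim_vec u = k" "dim_vec w = m" for u w
    using that d by (simp add: four_block_mult_append)
  have dL: "dim_row ?L = k + m" "dim_col ?L = k + m" using d by simp_all
  show ?thesis
  proof
    assume i: "impulse_free ?L ?A"
    show "impulse_free L A4"
    proof (rule impulse_freeI)
      fix y z assume dy: "dim_vec y = dim_col L" "dim_vec z = dim_col L"
        and 1: "L *\<^sub>v y = 0\<^sub>v (dim_row L)" and 2: "A4 *\<^sub>v y = L *\<^sub>v z"
      have y: "dim_vec y = m" "dim_vec z = m" using dy d by simp_all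
      have "0\<^sub>v k @\<^sub>v y = 0\<^sub>v (dim_col ?L)"
      proof (rule impulse_freeD[OF i, of _ "A2 *\<^sub>v y @\<^sub>v z"])
        show "?L *\<^sub>v (0\<^sub>v k @\<^sub>v y) = 0\<^sub>v (dim_row ?L)"
          using Lx[of "0\<^sub>v k" y] y 1 d by (simp add: append_vec_zero)
        have "?A *\<^sub>v (0\<^sub>v k @\<^sub>v y) = (A2 *\<^sub>v y) @\<^sub>v (A4 *\<^sub>v y)"
          using Ax[of "0\<^sub>v k" y] y d by (simp add: mult_zero_vec vec_add_zero)
        thus "?A *\<^sub>v (0\<^sub>v k @\<^sub>v y) = ?L *\<^sub>v (A2 *\<^sub>v y @\<^sub>v z)"
          using Lx[of "A2 *\<^sub>v y" z] y d 2 by simp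
      qed (use y d in simp_all)
      hence "0\<^sub>v k @\<^sub>v y = 0\<^sub>v k @\<^sub>v 0\<^sub>v m" unfolding dL append_vec_zero .
      thus "y = 0\<^sub>v (dim_col L)" using append_vec_eq_iff[of "0\<^sub>v k" "0\<^sub>v k" y "0\<^sub>v m"] d by simp
    qed
  next
    assume i: "impulse_free L A4"
    show "impulse_free ?L ?A"
    proof (rule impulse_freeI)
      fix x z assume "dim_vec x = dim_col ?L" "dim_vec z = dim_col ?L"
        and 1: "?L *\<^sub>v x = 0\<^sub>v (dim_row ?L)" and 2: "?A *\<^sub>v x = ?L *\<^sub>v z"
      hence dx: "dim_vec x = k + m" "dim_vec z = k + m" unfolding dL by auto
      obtain x1 x2 where x: "x = x1 @\<^sub>v x2" "dim_vec x1 = k" "dim_vec x2 = m" by (rule split_vec[OF dx(1)])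
      obtain z1 z2 where z: "z = z1 @\<^sub>v z2" "dim_vec z1 = k" "dim_vec z2 = m" by (rule split_vec[OF dx(2)])
      have "x1 @\<^sub>v (L *\<^sub>v x2) = 0\<^sub>v k @\<^sub>v 0\<^sub>v m"
        using 1 unfolding x(1) Lx[OF x(2,3)] dL append_vec_zero .
      moreover have "dim_vec x1 = dim_vec (0\<^sub>v k)" using x by simp
      ultimately have x1: "x1 = 0\<^sub>v k" and Lx2: "L *\<^sub>v x2 = 0\<^sub>v m" using append_vec_eq_iff by blast+
      have "(A1 *\<^sub>v x1 + A2 *\<^sub>v x2) @\<^sub>v (A3 *\<^sub>v x1 + A4 *\<^sub>v x2) = z1 @\<^sub>v (L *\<^sub>v z2)"
        using 2 unfolding x(1) z(1) Lx[OF z(2,3)] Ax[OF x(2,3)] .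
      moreover have "dim_vec (A1 *\<^sub>v x1 + A2 *\<^sub>v x2) = dim_vec z1" using z d by simp
      ultimately have "A3 *\<^sub>v x1 + A4 *\<^sub>v x2 = L *\<^sub>v z2" using append_vec_eq_iff by blast
      hence "A4 *\<^sub>v x2 = L *\<^sub>v z2" unfolding x1 using d by (simp add: mult_zero_vec vec_add_zero)
      hence "x2 = 0\<^sub>v m" using impulse_freeD[OF i, of x2 z2] Lx2 x(3) z(3) d by simp
      thus "x = 0\<^sub>v (dim_col ?L)" unfolding dL append_vec_zero x(1) x1 by simp
    qed
  qed
qed

lemma impulse_free_zero:
  fixes A :: "'a :: semiring_1 mat"
  assumes "dim_row A = l" "dim_col A = l"
  shows "impulse_free (0\<^sub>m l l) A \<longleftrightarrow> trivial_kernel A"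
proof -
  have z: "0\<^sub>m l l *\<^sub>v v = 0\<^sub>v l" if "dim_vec v = l" for v :: "'a vec"
    using that by (rule zero_mult_vec)
  have "dim_vec (0\<^sub>v l :: 'a vec) = l" by simp
  thus ?thesis unfolding impulse_free_def trivial_kernel_def using assms z by (metis index_zero_mat(2,3))
qed

lemma pencil_mult:
  fixes E A :: "'a :: comm_ring_1 mat"
  assumes "dim_row E = n" "dim_col E = n" "dim_row A = n" "dim_col A = n"
    "dim_col X = n" "dim_row Y = n"
  shows "X * (s \<cdot>\<^sub>m E - A) * Y = s \<cdot>\<^sub>m (X * E * Y) - X * A * Y"
proof -
  have 1: "X * (s \<cdot>\<^sub>m E - A) = X * (s \<cdot>\<^sub>m E) - X * A"
    by (rule mult_minus_distrib_mat[of _ "dim_row X" n _ n]; rule carrier_matI; simp add: assms)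
  have 2: "X * (s \<cdot>\<^sub>m E) = s \<cdot>\<^sub>m (X * E)"
    by (rule mult_smult_distrib[of _ "dim_row X" n _ n]; rule carrier_matI; simp add: assms)
  have 3: "(s \<cdot>\<^sub>m (X * E) - X * A) * Y = s \<cdot>\<^sub>m (X * E) * Y - X * A * Y"
    by (rule minus_mult_distrib_mat[of _ "dim_row X" n _ _ "dim_col Y"]; rule carrier_matI; simp add: assms)
  have 4: "s \<cdot>\<^sub>m (X * E) * Y = s \<cdot>\<^sub>m (X * E * Y)"
    by (rule mult_smult_assoc_mat[of _ "dim_row X" n _ "dim_col Y"]; rule carrier_matI; simp add: assms)
  show ?thesis unfolding 1 2 3 4 ..
qed

text \<open>
With \<open>E\<close> brought to \<open>diag(I, 0)\<close>, the hypothesis says that the lower right block of \<open>A\<close> is injective, hence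
invertible. Eliminating the off-diagonal blocks of \<open>A\<close> with this pivot leaves \<open>diag(I, 0)\<close> untouched and
yields a Weierstrass form whose nilpotent part is zero.
\<close>

lemma impulse_free_imp_regular_index:
  fixes E A :: "real mat"
  assumes d: "dim_row E = n" "dim_col E = n" "dim_row A = n" "dim_col A = n"
    and i: "impulse_free E A"
  shows "regular_pencil E A" "\<exists>\<nu> \<le> 1. has_index E A \<nu>"
proof -
  define q where "q = mrank E"
  obtain X X' Y Y' where XY: "inverses (dim_row E) X X'" "inverses (dim_col E) Y Y'"
    "X * E * Y = partial_identity (dim_row E) (dim_col E) q" "q \<le> dim_row E" "q \<le> dim_col E"
    unfolding q_def by (rule rank_normal_form[of E])
  note X = XY(1)[unfolded d] and Y = XY(2)[unfolded d] and E0 = XY(3)[unfolded d] and q = XY(4)[unfolded d]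
  note dd = inverses_dim[OF X] inverses_dim[OF Y] d
  define l where "l = n - q"
  have n: "n = q + l" using q by (simp add: l_def)
  let ?E = "four_block_mat (1\<^sub>m q) (0\<^sub>m q l) (0\<^sub>m l q) (0\<^sub>m l l) :: real mat"
  have E: "X * E * Y = ?E"
    unfolding E0 n by (intro eq_matI) (auto simp: partial_identity_def)
  have "dim_row (X * A * Y) = q + l" "dim_col (X * A * Y) = q + l" using dd n by auto
  then obtain A1 A2 A3 A4 where A: "X * A * Y = four_block_mat A1 A2 A3 A4"
    and dA: "dim_row A1 = q" "dim_col A1 = q" "dim_row A2 = q" "dim_col A2 = l"
      "dim_row A3 = l" "dim_col A3 = q" "dim_row A4 = l" "dim_col A4 = l"
    by (rule split_four_block)
  have i': "impulse_free ?E (four_block_mat A1 A2 A3 A4)"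
    using impulse_free_equivalence[OF X Y d i] unfolding E A .
  have "impulse_free (0\<^sub>m l l) A4"
    by (rule iffD1[OF impulse_free_diag_one i']) (simp_all add: dA)
  hence "trivial_kernel A4" unfolding impulse_free_zero[OF dA(7,8)] .
  then obtain A4' where A4: "inverses l A4 A4'"
    using trivial_kernel_imp_inverses dA by blast
  note d4 = inverses_dim[OF A4]
  define U where "U = four_block_mat (1\<^sub>m q) (- (A2 * A4')) (0\<^sub>m l q) A4'"
  define U' where "U' = four_block_mat (1\<^sub>m q) A2 (0\<^sub>m l q) A4"
  define V where "V = four_block_mat (1\<^sub>m q) (0\<^sub>m q l) (- (A4' * A3)) (1\<^sub>m l)"
  define V' where "V' = four_block_mat (1\<^sub>m q) (0\<^sub>m q l) (A4' * A3) (1\<^sub>m l)"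
  define Jh where "Jh = A1 + - (A2 * (A4' * A3))"
  have dJ: "dim_row Jh = q" "dim_col Jh = q" by (auto simp: Jh_def dA d4)
  note simps = four_block_mult mat_dim_simps mat_uminus_mult mat_minus_add_cancel uminus_zero_mat
    inverses_cancel[OF A4] d4 dA
  have U: "inverses n U U'" and V: "inverses n V V'"
    unfolding inverses_def U_def U'_def V_def V'_def n
    by (intro conjI carrier_matI, simp_all add: simps)+
  have dU: "dim_row U = n" "dim_col U = n" "dim_row V = n" "dim_col V = n"
    using inverses_dim[OF U] inverses_dim[OF V] by auto
  define X1 where "X1 = U * X"
  define Y1 where "Y1 = Y * V"
  have X1: "inverses n X1 (X' * U')" and Y1: "inverses n Y1 (V' * Y')"
    unfolding X1_def Y1_def by (rule inverses_mult[OF U X], rule inverses_mult[OF Y V])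
  note d1 = inverses_dim[OF X1] inverses_dim[OF Y1]
  have "X1 * M * Y1 = U * (X * M * Y) * V" if "dim_row M = n" "dim_col M = n" for M
    unfolding X1_def Y1_def using that dd dU by (simp add: mat_assoc)
  hence XE: "X1 * E * Y1 = U * ?E * V" and XA: "X1 * A * Y1 = U * four_block_mat A1 A2 A3 A4 * V"
    using d E A by simp_all
  have E1: "X1 * E * Y1 = ?E"
    unfolding XE unfolding U_def V_def by (simp add: simps)
  have A1: "X1 * A * Y1 = four_block_mat Jh (0\<^sub>m q l) (0\<^sub>m l q) (1\<^sub>m l)"
    unfolding XA unfolding U_def V_def Jh_def by (simp add: simps)
  have pencil: "X1 * (s \<cdot>\<^sub>m E - A) * Y1 =
      four_block_mat (s \<cdot>\<^sub>m 1\<^sub>m q - Jh) (0\<^sub>m q l) (0\<^sub>m l q) (s \<cdot>\<^sub>m 0\<^sub>m l l - 1\<^sub>m l)" for s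
    unfolding pencil_mult[OF d d1(2) d1(5)] E1 A1
    by (intro eq_matI) (auto simp: dJ)
  have "\<exists>s. \<not> eigenvalue Jh s"
  proof (rule ccontr)
    assume "\<not> ?thesis"
    have cJ: "Jh \<in> carrier_mat q q" by (rule carrier_matI[OF dJ])
    have "poly (char_poly Jh) s = 0" for s
      using \<open>\<not> (\<exists>s. \<not> eigenvalue Jh s)\<close> eigenvalue_root_char_poly[OF cJ] by blast
    hence "{s. poly (char_poly Jh) s = 0} = UNIV" by blast
    moreover have "char_poly Jh \<noteq> 0"
      using degree_monic_char_poly[OF cJ] by (metis coeff_0 zero_neq_one)
    ultimately show False using poly_roots_finite[of "char_poly Jh"] infinite_UNIV_char_0 by metis
  qed
  \<comment> \<open>A real number outside the finite spectrum of the block \<open>Jh\<close> witnesses regularity.\<close>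
  then obtain s where s: "\<not> eigenvalue Jh s" by blast
  have "trivial_kernel (X1 * (s \<cdot>\<^sub>m E - A) * Y1)"
    unfolding trivial_kernel_def pencil
  proof (intro allI impI)
    let ?D = "four_block_mat (s \<cdot>\<^sub>m 1\<^sub>m q - Jh) (0\<^sub>m q l) (0\<^sub>m l q) (s \<cdot>\<^sub>m 0\<^sub>m l l - 1\<^sub>m l)"
    fix v assume v: "dim_vec v = dim_col ?D" "?D *\<^sub>v v = 0\<^sub>v (dim_row ?D)"
    hence "dim_vec v = q + l" by (simp add: dJ)
    then obtain x y where xy: "v = x @\<^sub>v y" "dim_vec x = q" "dim_vec y = l" by (rule split_vec)
    have cx: "x \<in> carrier_vec q" using xy by (auto intro: carrier_vecI)
    have "?D *\<^sub>v v = ((s \<cdot>\<^sub>m 1\<^sub>m q - Jh) *\<^sub>v x) @\<^sub>v ((s \<cdot>\<^sub>m 0\<^sub>m l l - 1\<^sub>m l) *\<^sub>v y)"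
      unfolding xy(1) using xy(2,3) dJ by (subst four_block_mult_append) (simp_all add: mat_dim_simps)
    moreover have "0\<^sub>v (dim_row ?D) = (0\<^sub>v q @\<^sub>v 0\<^sub>v l :: real vec)"
      using dJ by (simp add: append_vec_zero)
    ultimately have e: "((s \<cdot>\<^sub>m 1\<^sub>m q - Jh) *\<^sub>v x) @\<^sub>v ((s \<cdot>\<^sub>m 0\<^sub>m l l - 1\<^sub>m l) *\<^sub>v y) = 0\<^sub>v q @\<^sub>v 0\<^sub>v l"
      using v(2) by simp
    have "dim_vec ((s \<cdot>\<^sub>m 1\<^sub>m q - Jh) *\<^sub>v x) = dim_vec (0\<^sub>v q :: real vec)" using dJ by simp
    from e[unfolded append_vec_eq_iff[OF this]]
    have ex: "(s \<cdot>\<^sub>m 1\<^sub>m q - Jh) *\<^sub>v x = 0\<^sub>v q" and ey: "(s \<cdot>\<^sub>m 0\<^sub>m l l - 1\<^sub>m l) *\<^sub>v y = 0\<^sub>v l" by auto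
    have "(s \<cdot>\<^sub>m 1\<^sub>m q - Jh) *\<^sub>v x = s \<cdot>\<^sub>v x - Jh *\<^sub>v x"
      using xy(2) dJ cx by (subst minus_mult_distrib_mat_vec[of _ q q]) (auto intro!: carrier_matI eq_vecI)
    hence "Jh *\<^sub>v x = s \<cdot>\<^sub>v x"
      using ex xy(2) dJ by (auto intro!: eq_vecI dest!: vec_eq_iff[THEN iffD1])
    hence x0: "x = 0\<^sub>v q"
      using s cx dJ unfolding eigenvalue_def eigenvector_def by auto
    have "(s \<cdot>\<^sub>m 0\<^sub>m l l - 1\<^sub>m l) = - (1\<^sub>m l :: real mat)" by (intro eq_matI) auto
    hence my: "- y = 0\<^sub>v l"
      using ey xy(3) one_mult_vec[OF xy(3)] uminus_mult_mat_vec[of y "1\<^sub>m l"] by simp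
    have "y $ i = 0" if "i < l" for i
      using arg_cong[OF my, of "\<lambda>v. v $ i"] that xy(3) by simp
    hence "y = 0\<^sub>v l" using xy(3) by (intro eq_vecI) simp_all
    thus "v = 0\<^sub>v (dim_col ?D)" using xy(1) x0 dJ by (simp add: append_vec_zero)
  qed
  hence "trivial_kernel (X1 * ((s \<cdot>\<^sub>m E - A) * Y1))"
    using d1 d by (simp add: mat_assoc)
  hence 1: "trivial_kernel ((s \<cdot>\<^sub>m E - A) * Y1)"
    by (rule trivial_kernel_mult[rotated]) (simp add: d1 d)
  have 2: "trivial_kernel (V' * Y')" by (rule inverses_trivial_kernel[OF inverses_sym[OF Y1]])
  have "trivial_kernel ((s \<cdot>\<^sub>m E - A) * Y1 * (V' * Y'))"
    by (rule trivial_kernel_comp[OF _ 1 2]) (simp add: inverses_dim[OF Y1] inverses_dim[OF V])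
  moreover have "(s \<cdot>\<^sub>m E - A) * Y1 * (V' * Y') = (s \<cdot>\<^sub>m E - A) * (Y1 * (V' * Y'))"
    by (rule mat_assoc) (use d d1 in simp_all)
  moreover have "\<dots> = s \<cdot>\<^sub>m E - A"
    unfolding inverses_cancel(5)[OF Y1] by (rule mat_mult_one) (use d in simp)
  ultimately have tk: "trivial_kernel (s \<cdot>\<^sub>m E - A)" by simp
  have c: "s \<cdot>\<^sub>m E - A \<in> carrier_mat n n" using d by auto
  have "det (s \<cdot>\<^sub>m E - A) \<noteq> 0"
    using det_0_iff_vec_prod_zero_field[OF c] tk c d unfolding trivial_kernel_def by (auto dest: carrier_vecD)
  moreover have "complex_of_real s \<cdot>\<^sub>m cmat E - 1 \<cdot>\<^sub>m cmat A = cmat (s \<cdot>\<^sub>m E - A)"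
    using d by (intro eq_matI) auto
  ultimately have "det (complex_of_real s \<cdot>\<^sub>m cmat E - 1 \<cdot>\<^sub>m cmat A) \<noteq> 0"
    by (simp add: of_real_hom.hom_det)
  thus "regular_pencil E A" unfolding regular_pencil_def by blast
  have nil: "(0\<^sub>m l l :: real mat) ^\<^sub>m Suc 0 = 0\<^sub>m l l" by simp
  have "weierstrass_form E A X1 Y1 Jh (0\<^sub>m l l)"
    unfolding weierstrass_form_def Let_def using d d1 dJ n nil pencil
      inverses_invertible_mat[OF X1] inverses_invertible_mat[OF Y1]
    by (auto intro!: carrier_matI exI[of _ "Suc 0"])
  moreover have "nilpotency_degree (0\<^sub>m l l :: real mat) \<le> 1"
    unfolding nilpotency_degree_def by (rule Least_le) simp
  ultimately show "\<exists>\<nu> \<le> 1. has_index E A \<nu>" unfolding has_index_def by blast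
qed

lemma pencil_eq_imp_eq:
  fixes P R :: "real mat"
  assumes "dim_row P = n" "dim_col P = n" "dim_row R = n" "dim_col R = n"
    "dim_row P' = n" "dim_col P' = n" "dim_row R' = n" "dim_col R' = n"
    and e: "\<And>s. s \<cdot>\<^sub>m P - R = s \<cdot>\<^sub>m P' - R'"
  shows "P = P'" "R = R'"
proof -
  have ent: "s * P $$ (i, j) - R $$ (i, j) = s * P' $$ (i, j) - R' $$ (i, j)" if "i < n" "j < n" for i j s
    using arg_cong[OF e[of s], of "\<lambda>M. M $$ (i, j)"] that assms(1-8) by simp
  have R: "R $$ (i, j) = R' $$ (i, j)" if "i < n" "j < n" for i j
    using ent[OF that, of 0] by simp
  show "R = R'" by (rule eq_matI) (use R assms(1-8) in simp_all)
  show "P = P'" by (rule eq_matI) (use ent[of _ _ 1] R assms(1-8) in simp_all)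
qed

text \<open>
Index at most one means that the nilpotent block of the Weierstrass form is zero or empty, and then the claim
is read off from \<open>diag(I, 0)\<close> and \<open>diag(J, I)\<close>.
\<close>

lemma index_le_one_imp_impulse_free:
  assumes "has_index E A \<nu>" "\<nu> \<le> 1"
  shows "impulse_free E A"
proof -
  obtain X Y Jh N where w: "weierstrass_form E A X Y Jh N" and \<nu>: "\<nu> = nilpotency_degree N"
    using assms(1) unfolding has_index_def by blast
  define n where "n = dim_row E"
  define p where "p = dim_row Jh"
  define q where "q = dim_row N"
  note w' = w[unfolded weierstrass_form_def Let_def, folded n_def p_def q_def]
  have n: "n = p + q" and inv: "invertible_mat X" "invertible_mat Y"
    and nil: "\<exists>i. N ^\<^sub>m i = 0\<^sub>m q q"
    and c: "E \<in> carrier_mat n n" "A \<in> carrier_mat n n" "X \<in> carrier_mat n n" "Y \<in> carrier_mat n n"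
      "Jh \<in> carrier_mat p p" "N \<in> carrier_mat q q"
    and pencil: "\<forall>s. X * (s \<cdot>\<^sub>m E - A) * Y =
      four_block_mat (s \<cdot>\<^sub>m 1\<^sub>m p - Jh) (0\<^sub>m p q) (0\<^sub>m q p) (s \<cdot>\<^sub>m N - 1\<^sub>m q)"
    using w' by blast+
  note d = carrier_matD[OF c(1)] carrier_matD[OF c(2)] and dX = carrier_matD[OF c(3)] carrier_matD[OF c(4)]
    and dJ = carrier_matD[OF c(5)] and dN = carrier_matD[OF c(6)]
  obtain X' where X: "inverses n X X'" by (rule invertible_mat_inverses[OF inv(1) dX(1)])
  obtain Y' where Y: "inverses n Y Y'" by (rule invertible_mat_inverses[OF inv(2) dX(3)])
  have "N ^\<^sub>m \<nu> = 0\<^sub>m q q"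
    unfolding \<nu> nilpotency_degree_def using LeastI_ex[OF nil] dN by simp
  hence N0: "N = 0\<^sub>m q q"
  proof (cases "\<nu> = 0")
    case True
    hence e: "1\<^sub>m q = (0\<^sub>m q q :: real mat)" using \<open>N ^\<^sub>m \<nu> = 0\<^sub>m q q\<close> dN by simp
    have "q = 0"
    proof (rule ccontr)
      assume "q \<noteq> 0"
      thus False using arg_cong[OF e, of "\<lambda>M. M $$ (0, 0)"] by simp
    qed
    thus ?thesis using dN by (intro eq_matI) auto
  next
    case False
    hence "\<nu> = Suc 0" using assms(2) by simp
    thus ?thesis using \<open>N ^\<^sub>m \<nu> = 0\<^sub>m q q\<close> dN by (simp add: mat_mult_one)
  qed
  let ?P = "X * E * Y" and ?R = "X * A * Y"
  let ?E = "four_block_mat (1\<^sub>m p) (0\<^sub>m p q) (0\<^sub>m q p) (0\<^sub>m q q) :: real mat"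
  let ?A = "four_block_mat Jh (0\<^sub>m p q) (0\<^sub>m q p) (1\<^sub>m q)"
  have pen: "s \<cdot>\<^sub>m ?P - ?R =
      four_block_mat (s \<cdot>\<^sub>m 1\<^sub>m p - Jh) (0\<^sub>m p q) (0\<^sub>m q p) (s \<cdot>\<^sub>m 0\<^sub>m q q - 1\<^sub>m q)" for s
    using pencil[rule_format, of s] unfolding pencil_mult[OF d dX(2,3), of s] N0 .
  have "s \<cdot>\<^sub>m ?P - ?R = s \<cdot>\<^sub>m ?E - ?A" for s
    unfolding pen by (intro eq_matI) (auto simp: dJ)
  from pencil_eq_imp_eq[OF _ _ _ _ _ _ _ _ this, of n] have P: "?P = ?E" and R: "?R = ?A"
    using d dX dJ n by simp_all
  have "trivial_kernel (1\<^sub>m q :: real mat)" by (rule inverses_trivial_kernel[OF inverses_one])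
  hence "impulse_free (0\<^sub>m q q) (1\<^sub>m q :: real mat)"
    using impulse_free_zero[of "1\<^sub>m q :: real mat" q] by simp
  hence "impulse_free ?E ?A"
    by (rule iffD2[OF impulse_free_diag_one, rotated -1]) (simp_all add: dJ)
  hence "impulse_free ?P ?R" unfolding P R .
  thus ?thesis by (rule iffD1[OF impulse_free_equivalence_iff[OF X Y d]])
qed

section \<open>Semidefinite, dissipative and skew-symmetric forms\<close>

definition dissipative :: "real mat \<Rightarrow> bool" where
  "dissipative M \<longleftrightarrow> (\<forall>v. dim_vec v = dim_col M \<longrightarrow> v \<bullet> (M *\<^sub>v v) \<le> 0)"

lemma dissipative_nonpos:
  assumes "dissipative M" "dim_vec v = dim_col M"
  shows "v \<bullet> (M *\<^sub>v v) \<le> 0"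
  using assms unfolding dissipative_def by blast

lemma scalar_prod_self_nonneg: "0 \<le> v \<bullet> (v :: real vec)"
  unfolding scalar_prod_def by (rule sum_nonneg) simp

lemma scalar_prod_self_zero:
  fixes v :: "real vec"
  assumes "v \<bullet> v \<le> 0" "dim_vec v = n"
  shows "v = 0\<^sub>v n"
proof (rule eq_vecI)
  have s: "(\<Sum>i = 0..<n. v $ i * v $ i) = 0"
    using assms scalar_prod_self_nonneg[of v] by (simp add: scalar_prod_def)
  have "v $ i * v $ i = 0" if "i < n" for i
    using sum_nonneg_eq_0_iff[of "{0..<n}" "\<lambda>i. v $ i * v $ i"] s that by simp
  thus "\<And>i. i < dim_vec (0\<^sub>v n) \<Longrightarrow> v $ i = 0\<^sub>v n $ i" by simp
qed (use assms in simp)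

lemma psd_nonneg:
  assumes "psd L" "dim_vec v = dim_row L"
  shows "0 \<le> v \<bullet> (L *\<^sub>v v)"
  using assms carrier_vecI[of v "dim_row L"] unfolding psd_def by blast

lemma psd_one: "psd (1\<^sub>m m)"
  unfolding psd_def using scalar_prod_self_nonneg one_mult_vec by (auto dest: carrier_vecD)

lemma psd_zero: "psd (0\<^sub>m m m)"
  unfolding psd_def by (auto simp: zero_mult_vec dest: carrier_vecD)

lemma psd_block_diag:
  assumes dJ: "dim_row J = s" and J: "psd J" and d: "dim_row L = k" and L: "psd L"
  shows "psd (four_block_mat J (0\<^sub>m s k) (0\<^sub>m k s) L)" (is "psd ?D")
proof -
  have sJ: "J\<^sup>T = J" and sL: "L\<^sup>T = L" using J L by (simp_all add: psd_def)
  have dims: "dim_row J = s" "dim_col J = s" "dim_row L = k" "dim_col L = k"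
    using arg_cong[OF sJ, of dim_row] arg_cong[OF sL, of dim_row] dJ d by simp_all
  have "?D\<^sup>T = ?D"
    using dims by (subst four_block_transpose) (simp_all add: sJ sL)
  moreover have "0 \<le> v \<bullet> (?D *\<^sub>v v)" if v: "dim_vec v = s + k" for v
  proof -
    obtain x y where xy: "v = x @\<^sub>v y" "dim_vec x = s" "dim_vec y = k" by (rule split_vec[OF v])
    have "?D *\<^sub>v v = (J *\<^sub>v x) @\<^sub>v (L *\<^sub>v y)"
      unfolding xy(1) using xy(2,3) dims by (simp add: four_block_mult_append mat_dim_simps)
    hence "v \<bullet> (?D *\<^sub>v v) = x \<bullet> (J *\<^sub>v x) + y \<bullet> (L *\<^sub>v y)"
      unfolding xy(1) using append_scalar_prod[of x "J *\<^sub>v x" y "L *\<^sub>v y"] xy(2,3) dims by simp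
    thus ?thesis using psd_nonneg[OF J, of x] psd_nonneg[OF L, of y] xy(2,3) dims by simp
  qed
  ultimately show ?thesis unfolding psd_def using dims by (auto dest: carrier_vecD)
qed

lemma form_transpose_mult:
  fixes N :: "real mat"
  assumes "dim_row N = n" "dim_col N = n" "dim_row Q = n" "dim_vec v = dim_col Q"
  shows "v \<bullet> (Q\<^sup>T * N * Q *\<^sub>v v) = (Q *\<^sub>v v) \<bullet> (N *\<^sub>v (Q *\<^sub>v v))"
proof -
  have "Q\<^sup>T * N * Q *\<^sub>v v = Q\<^sup>T *\<^sub>v (N *\<^sub>v (Q *\<^sub>v v))"
    using assms by (simp add: mat_vec_assoc)
  thus ?thesis
    using transpose_scalar_prod[of "Q\<^sup>T" "N *\<^sub>v (Q *\<^sub>v v)" v] assms by simp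
qed

lemma form_minus:
  fixes J :: "real mat"
  assumes "J \<in> carrier_mat n n" "R \<in> carrier_mat n n" "dim_vec u = n"
  shows "u \<bullet> ((J - R) *\<^sub>v u) = u \<bullet> (J *\<^sub>v u) - u \<bullet> (R *\<^sub>v u)"
proof -
  have c: "u \<in> carrier_vec n" using assms(3) by (rule carrier_vecI)
  have "(J - R) *\<^sub>v u = J *\<^sub>v u - R *\<^sub>v u" by (rule minus_mult_distrib_mat_vec[OF assms(1,2) c])
  thus ?thesis
    using scalar_prod_minus_distrib[OF c, of "J *\<^sub>v u" "R *\<^sub>v u"] assms c by (simp add: mult_mat_vec_carrier[of _ n n])
qed

lemma psd_congruence:
  assumes "dim_row L = m" "dim_row V = m" "psd L"
  shows "psd (V\<^sup>T * L * V)"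
proof -
  have sym: "L\<^sup>T = L" using assms(3) by (simp add: psd_def)
  have dL: "dim_col L = m" using arg_cong[OF sym, of dim_row] assms(1) by simp
  have "(V\<^sup>T * L * V)\<^sup>T = V\<^sup>T * L * V"
    using assms(1,2) dL by (simp add: mat_transpose_mult mat_assoc sym)
  moreover have "0 \<le> v \<bullet> (V\<^sup>T * L * V *\<^sub>v v)" if v: "dim_vec v = dim_col V" for v
  proof -
    have "v \<bullet> (V\<^sup>T * L * V *\<^sub>v v) = v \<bullet> (V\<^sup>T *\<^sub>v (L *\<^sub>v (V *\<^sub>v v)))"
      using v assms(1,2) dL by (simp add: mat_vec_assoc)
    also have "\<dots> = (V *\<^sub>v v) \<bullet> (L *\<^sub>v (V *\<^sub>v v))"
      using transpose_scalar_prod[of "V\<^sup>T" "L *\<^sub>v (V *\<^sub>v v)" v] v assms(1,2) by simp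
    also have "\<dots> \<ge> 0"
    proof -
      have "V *\<^sub>v v \<in> carrier_vec (dim_row L)" using assms(1,2) by (auto intro: carrier_vecI)
      thus ?thesis using assms(3) unfolding psd_def by blast
    qed
    finally show ?thesis .
  qed
  ultimately show ?thesis unfolding psd_def by (auto dest: carrier_vecD)
qed

lemma dissipative_congruence:
  assumes "dim_row M = m" "dim_col M = m" "dim_row V = m" "dissipative M"
  shows "dissipative (V\<^sup>T * M * V)"
  unfolding dissipative_def
proof (intro allI impI)
  fix v :: "real vec" assume v: "dim_vec v = dim_col (V\<^sup>T * M * V)"
  have "v \<bullet> (V\<^sup>T * M * V *\<^sub>v v) = v \<bullet> (V\<^sup>T *\<^sub>v (M *\<^sub>v (V *\<^sub>v v)))"
    using v assms(1-3) by (simp add: mat_vec_assoc)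
  also have "\<dots> = (V *\<^sub>v v) \<bullet> (M *\<^sub>v (V *\<^sub>v v))"
    using transpose_scalar_prod[of "V\<^sup>T" "M *\<^sub>v (V *\<^sub>v v)" v] v assms(1-3) by simp
  also have "\<dots> \<le> 0" using assms unfolding dissipative_def by simp
  finally show "v \<bullet> (V\<^sup>T * M * V *\<^sub>v v) \<le> 0" .
qed

lemma skew_congruence:
  assumes "dim_row M = m" "dim_col M = m" "dim_row V = m" "skew_symmetric M"
  shows "skew_symmetric (V\<^sup>T * M * V)"
proof -
  have "(V\<^sup>T * M * V)\<^sup>T = V\<^sup>T * M\<^sup>T * V"
    using assms(1-3) by (simp add: mat_transpose_mult mat_assoc)
  also have "\<dots> = - (V\<^sup>T * M * V)"
    using assms unfolding skew_symmetric_def by (simp add: mat_uminus_mult)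
  finally show ?thesis unfolding skew_symmetric_def .
qed

text \<open>
If a semidefinite form vanishes at \<open>u\<close> then \<open>u\<close> minimizes it, so the derivative in the direction \<open>w = N u\<close> is zero;
this derivative is \<open>2 (w \<bullet> w)\<close>.
\<close>

lemma psd_zero_form:
  assumes N: "psd N" "dim_row N = n" and u: "dim_vec u = n" and z: "u \<bullet> (N *\<^sub>v u) = 0"
  shows "N *\<^sub>v u = 0\<^sub>v n"
proof -
  have sym: "N\<^sup>T = N" using N(1) by (simp add: psd_def)
  have dN: "dim_col N = n" using arg_cong[OF sym, of dim_row] N(2) by simp
  define w where "w = N *\<^sub>v u"
  define a where "a = w \<bullet> w"
  define b where "b = w \<bullet> (N *\<^sub>v w)"
  have dw: "dim_vec w = n" using N(2) by (simp add: w_def)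
  have c: "u \<in> carrier_vec n" "w \<in> carrier_vec n" "N *\<^sub>v w \<in> carrier_vec n"
    using u dw N(2) by (auto intro: carrier_vecI)
  have b: "0 \<le> b" unfolding b_def by (rule psd_nonneg[OF N(1)]) (use dw N(2) in simp)
  have uw: "u \<bullet> (N *\<^sub>v w) = a"
    using transpose_scalar_prod[of N w u] N(2) dN u dw sym by (simp add: a_def w_def)
  have ineq: "0 \<le> 2 * t * a + t * t * b" for t
  proof -
    have "N *\<^sub>v (u + t \<cdot>\<^sub>v w) = w + t \<cdot>\<^sub>v (N *\<^sub>v w)"
    proof -
      have "N *\<^sub>v (u + t \<cdot>\<^sub>v w) = N *\<^sub>v u + N *\<^sub>v (t \<cdot>\<^sub>v w)"
        by (rule mat_vec_add) (use dN u dw in simp_all)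
      also have "N *\<^sub>v (t \<cdot>\<^sub>v w) = t \<cdot>\<^sub>v (N *\<^sub>v w)"
        by (rule mult_mat_vec[OF carrier_matI[OF N(2) dN] c(2)])
      finally show ?thesis unfolding w_def .
    qed
    moreover have "(u + t \<cdot>\<^sub>v w) \<bullet> (w + t \<cdot>\<^sub>v (N *\<^sub>v w)) =
        u \<bullet> w + t * (u \<bullet> (N *\<^sub>v w)) + (t * (w \<bullet> w) + t * (t * (w \<bullet> (N *\<^sub>v w))))"
    proof -
      have "(u + t \<cdot>\<^sub>v w) \<bullet> (w + t \<cdot>\<^sub>v (N *\<^sub>v w)) =
          u \<bullet> (w + t \<cdot>\<^sub>v (N *\<^sub>v w)) + (t \<cdot>\<^sub>v w) \<bullet> (w + t \<cdot>\<^sub>v (N *\<^sub>v w))"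
        by (rule add_scalar_prod_distrib[of _ n]) (use c in auto)
      moreover have "u \<bullet> (w + t \<cdot>\<^sub>v (N *\<^sub>v w)) = u \<bullet> w + u \<bullet> (t \<cdot>\<^sub>v (N *\<^sub>v w))"
        by (rule scalar_prod_add_distrib[of _ n]) (use c in auto)
      moreover have "(t \<cdot>\<^sub>v w) \<bullet> (w + t \<cdot>\<^sub>v (N *\<^sub>v w)) = (t \<cdot>\<^sub>v w) \<bullet> w + (t \<cdot>\<^sub>v w) \<bullet> (t \<cdot>\<^sub>v (N *\<^sub>v w))"
        by (rule scalar_prod_add_distrib[of _ n]) (use c in auto)
      ultimately show ?thesis using u dw N(2) by simp
    qed
    moreover have "0 \<le> (u + t \<cdot>\<^sub>v w) \<bullet> (N *\<^sub>v (u + t \<cdot>\<^sub>v w))"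
      by (rule psd_nonneg[OF N(1)]) (use u dw N(2) in simp)
    moreover have "u \<bullet> w = 0" using z by (simp add: w_def)
    ultimately show ?thesis by (simp add: uw a_def[symmetric] b_def[symmetric] algebra_simps)
  qed
  have "a \<le> 0"
  proof (rule ccontr)
    assume "\<not> a \<le> 0"
    hence a: "0 < a" by simp
    \<comment> \<open>The minimizer would be \<open>- a / b\<close>; the summand \<open>1\<close> avoids the case \<open>b = 0\<close>.\<close>
    define t where "t = - a / (b + 1)"
    have t: "t * (b + 1) = - a" using b by (simp add: t_def)
    have "2 * t * a + t * t * b = t * (2 * a + (t * (b + 1) - t))" by (simp add: algebra_simps)
    also have "\<dots> = t * (a - t)" unfolding t by (simp add: algebra_simps)
    also have "\<dots> < 0"
    proof (rule mult_neg_pos)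
      show "t < 0" using a b by (simp add: t_def divide_neg_pos)
      thus "0 < a - t" using a by simp
    qed
    finally show False using ineq[of t] by simp
  qed
  from scalar_prod_self_zero[OF this[unfolded a_def] dw] show ?thesis unfolding w_def .
qed

lemma skew_form_zero:
  fixes M :: "real mat"
  assumes d: "dim_row M = m" "dim_col M = m" and s: "skew_symmetric M" and x: "dim_vec x = m"
  shows "x \<bullet> (M *\<^sub>v x) = 0"
proof -
  have c: "M *\<^sub>v x \<in> carrier_vec m" "x \<in> carrier_vec m" using d x by (auto intro: carrier_vecI)
  have "x \<bullet> (M *\<^sub>v x) = (M\<^sup>T *\<^sub>v x) \<bullet> x"
    by (rule transpose_scalar_prod[symmetric]) (use d x in simp_all)
  also have "M\<^sup>T *\<^sub>v x = - (M *\<^sub>v x)"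
    unfolding s[unfolded skew_symmetric_def] by (rule uminus_mult_mat_vec) (use d x in simp)
  also have "- (M *\<^sub>v x) \<bullet> x = - ((M *\<^sub>v x) \<bullet> x)"
    by (rule scalar_prod_uminus_left) (use d x in simp)
  also have "(M *\<^sub>v x) \<bullet> x = x \<bullet> (M *\<^sub>v x)" by (rule comm_scalar_prod[OF c])
  finally show ?thesis by simp
qed

lemma compression_entry:
  fixes M :: "real mat"
  assumes "dim_row M = m" "dim_col M = m" "\<And>x. x \<in> set xs \<Longrightarrow> dim_vec x = m" "i < length xs" "j < length xs"
  shows "((mat_of_cols m xs)\<^sup>T * M * mat_of_cols m xs) $$ (i, j) = xs ! i \<bullet> (M *\<^sub>v xs ! j)"
proof -
  let ?V = "mat_of_cols m xs"
  have col: "col ?V l = xs ! l" if "l < length xs" for l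
    using that assms(3)[of "xs ! l"] by (intro col_mat_of_cols) (auto intro: carrier_vecI)
  have "?V\<^sup>T * M * ?V = ?V\<^sup>T * (M * ?V)"
    by (rule mat_assoc) (use assms in simp_all)
  hence "(?V\<^sup>T * M * ?V) $$ (i, j) = row (?V\<^sup>T) i \<bullet> col (M * ?V) j"
    using assms by simp
  also have "row (?V\<^sup>T) i = xs ! i" using assms col by simp
  also have "col (M * ?V) j = M *\<^sub>v col ?V j"
    by (rule col_mult2[of _ m m _ "length xs"]) (use assms in \<open>auto intro!: carrier_matI\<close>)
  also have "col ?V j = xs ! j" using assms col by simp
  finally show ?thesis .
qed

lemma unit_vec_form:
  fixes M :: "real mat"
  assumes "dim_row M = m" "dim_col M = m" "i < m" "j < m"
  shows "unit_vec m i \<bullet> (M *\<^sub>v unit_vec m j) = M $$ (i, j)"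
proof -
  have "M *\<^sub>v unit_vec m j = col M j" using assms by (intro eq_vecI) simp_all
  moreover have "unit_vec m i \<bullet> col M j = col M j $ i"
    by (rule scalar_prod_left_unit) (use assms in \<open>auto intro: carrier_vecI\<close>)
  ultimately show ?thesis using assms by simp
qed

text \<open>
Polarization at pairs of unit vectors.
\<close>

lemma zero_form_imp_skew:
  fixes M :: "real mat"
  assumes d: "dim_row M = m" "dim_col M = m" and z: "\<And>x. dim_vec x = m \<Longrightarrow> x \<bullet> (M *\<^sub>v x) = 0"
  shows "skew_symmetric M"
  unfolding skew_symmetric_def
proof (rule eq_matI)
  fix i j assume "i < dim_row (- M)" "j < dim_col (- M)"
  hence ij: "i < m" "j < m" using d by simp_all
  let ?u = "unit_vec m i :: real vec" and ?v = "unit_vec m j :: real vec"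
  have c: "?u \<in> carrier_vec m" "?v \<in> carrier_vec m" "M *\<^sub>v ?u \<in> carrier_vec m" "M *\<^sub>v ?v \<in> carrier_vec m"
    using d by (auto intro: carrier_vecI)
  have "(?u + ?v) \<bullet> (M *\<^sub>v (?u + ?v)) = (?u + ?v) \<bullet> (M *\<^sub>v ?u + M *\<^sub>v ?v)"
    using d by (simp add: mat_vec_add)
  also have "\<dots> = ?u \<bullet> (M *\<^sub>v ?u + M *\<^sub>v ?v) + ?v \<bullet> (M *\<^sub>v ?u + M *\<^sub>v ?v)"
    by (rule add_scalar_prod_distrib[of _ m]) (use c in auto)
  also have "?u \<bullet> (M *\<^sub>v ?u + M *\<^sub>v ?v) = ?u \<bullet> (M *\<^sub>v ?u) + ?u \<bullet> (M *\<^sub>v ?v)"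
    by (rule scalar_prod_add_distrib[of _ m]) (use c in auto)
  also have "?v \<bullet> (M *\<^sub>v ?u + M *\<^sub>v ?v) = ?v \<bullet> (M *\<^sub>v ?u) + ?v \<bullet> (M *\<^sub>v ?v)"
    by (rule scalar_prod_add_distrib[of _ m]) (use c in auto)
  finally have "?u \<bullet> (M *\<^sub>v ?v) + ?v \<bullet> (M *\<^sub>v ?u) = 0"
    using z[of ?u] z[of ?v] z[of "?u + ?v"] by simp
  hence "M $$ (i, j) + M $$ (j, i) = 0" unfolding unit_vec_form[OF d ij] unit_vec_form[OF d ij(2,1)] .
  thus "M\<^sup>T $$ (i, j) = (- M) $$ (i, j)" using ij d by simp
qed (use d in simp_all)

section \<open>Impulse-free pencils with a symmetric leading matrix\<close>

lemma trivial_kernel_gram: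
  fixes V :: "real mat"
  assumes "trivial_kernel V" "dim_vec y = dim_col V" "V\<^sup>T *\<^sub>v (V *\<^sub>v y) = 0\<^sub>v (dim_col V)"
  shows "y = 0\<^sub>v (dim_col V)"
proof -
  have "(V *\<^sub>v y) \<bullet> (V *\<^sub>v y) = (V\<^sup>T *\<^sub>v (V *\<^sub>v y)) \<bullet> y"
    by (rule transpose_scalar_prod[symmetric]) (use assms in simp_all)
  also have "\<dots> = 0" unfolding assms(3) using assms(2) by (simp add: scalar_prod_def)
  finally have "V *\<^sub>v y = 0\<^sub>v (dim_row V)" by (intro scalar_prod_self_zero) simp_all
  thus ?thesis using assms(1,2) unfolding trivial_kernel_def by blast
qed

text \<open>
The range of a symmetric matrix is the orthogonal complement of its null space. The matrix \<open>L + V V\<^sup>T\<close> is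
injective, hence surjective, and if \<open>w\<close> is orthogonal to the null space then \<open>V V\<^sup>T\<close> annihilates its preimage.
\<close>

lemma symmetric_range:
  fixes L :: "real mat"
  assumes d: "dim_row L = m" "dim_col L = m" and sym: "L\<^sup>T = L"
    and V: "kernel_basis L V" and w: "dim_vec w = m" "V\<^sup>T *\<^sub>v w = 0\<^sub>v (dim_col V)"
  shows "\<exists>x. dim_vec x = m \<and> w = L *\<^sub>v x"
proof -
  note dV = kernel_basisD(1)[OF V, unfolded d] and tV = kernel_basisD(3)[OF V]
  have LV: "V\<^sup>T *\<^sub>v (L *\<^sub>v x) = 0\<^sub>v (dim_col V)" if "dim_vec x = m" for x
  proof -
    have "V\<^sup>T * L = (L * V)\<^sup>T"
      using dV d by (simp add: mat_transpose_mult sym)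
    also have "\<dots> = 0\<^sub>m (dim_col V) m" unfolding kernel_basisD(4)[OF V] d by simp
    finally have "V\<^sup>T * L *\<^sub>v x = 0\<^sub>v (dim_col V)" using that by (simp add: zero_mult_vec)
    thus ?thesis using mat_vec_assoc[of "V\<^sup>T" L x] dV d that by simp
  qed
  define G where "G = L + V * V\<^sup>T"
  have dG: "dim_row G = m" "dim_col G = m" using dV d by (simp_all add: G_def)
  have G: "G *\<^sub>v x = L *\<^sub>v x + V *\<^sub>v (V\<^sup>T *\<^sub>v x)" if "dim_vec x = m" for x
    unfolding G_def using that dV d by (simp add: mat_add_vec mat_vec_assoc)
  have key: "V\<^sup>T *\<^sub>v x = 0\<^sub>v (dim_col V)"
    if x: "dim_vec x = m" and 0: "V\<^sup>T *\<^sub>v (G *\<^sub>v x) = 0\<^sub>v (dim_col V)" for x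
  proof (rule trivial_kernel_gram[OF tV])
    show "dim_vec (V\<^sup>T *\<^sub>v x) = dim_col V" by simp
    have "V\<^sup>T *\<^sub>v (G *\<^sub>v x) = V\<^sup>T *\<^sub>v (L *\<^sub>v x) +
        V\<^sup>T *\<^sub>v (V *\<^sub>v (V\<^sup>T *\<^sub>v x))"
      unfolding G[OF x] by (rule mat_vec_add) (use dV d in simp_all)
    thus "V\<^sup>T *\<^sub>v (V *\<^sub>v (V\<^sup>T *\<^sub>v x)) = 0\<^sub>v (dim_col V)"
      unfolding 0 LV[OF x] using vec_add_zero(2)[of "V\<^sup>T *\<^sub>v (V *\<^sub>v (V\<^sup>T *\<^sub>v x))" "dim_col V"]
      by simp
  qed
  have red: "G *\<^sub>v x = L *\<^sub>v x"
    if x: "dim_vec x = m" and 0: "V\<^sup>T *\<^sub>v (G *\<^sub>v x) = 0\<^sub>v (dim_col V)" for x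
    unfolding G[OF x] key[OF x 0] using dV d by (simp add: mult_zero_vec vec_add_zero)
  have "trivial_kernel G"
    unfolding trivial_kernel_def dG
  proof (intro allI impI)
    fix x assume x: "dim_vec x = m" "G *\<^sub>v x = 0\<^sub>v m"
    have 0: "V\<^sup>T *\<^sub>v (G *\<^sub>v x) = 0\<^sub>v (dim_col V)"
      unfolding x(2) using dV by (simp add: mult_zero_vec)
    have "L *\<^sub>v x = 0\<^sub>v (dim_row L)" using red[OF x(1) 0] x(2) d by simp
    then obtain y where y: "dim_vec y = dim_col V" "x = V *\<^sub>v y"
      using kernel_basisD(5)[OF V, of x] x(1) d by auto
    have "y = 0\<^sub>v (dim_col V)"
      by (rule trivial_kernel_gram[OF tV y(1)]) (use key[OF x(1) 0] in \<open>simp add: y(2)\<close>)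
    thus "x = 0\<^sub>v m" unfolding y(2) using dV by (simp add: mult_zero_vec)
  qed
  then obtain G' where G': "inverses m G G'" using trivial_kernel_imp_inverses dG by blast
  define x where "x = G' *\<^sub>v w"
  have x: "dim_vec x = m" "G *\<^sub>v x = w"
    using inverses_cancel(3)[OF G' w(1)] inverses_dim[OF G'] by (simp_all add: x_def)
  have "w = L *\<^sub>v x" using red[OF x(1)] w(2) x(2) by simp
  thus ?thesis using x(1) by blast
qed

text \<open>
If \<open>V\<^sup>T M V x = 0\<close> then \<open>M V x\<close> is orthogonal to the null space of \<open>L\<close> and therefore lies in the range of \<open>L\<close>, while
\<open>L V x = 0\<close>; impulse-freeness leaves only \<open>V x = 0\<close>.
\<close>

lemma impulse_free_kernel_compression:
  fixes L M :: "real mat"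
  assumes d: "dim_row L = m" "dim_col L = m" "dim_row M = m" "dim_col M = m"
    and sym: "L\<^sup>T = L" and i: "impulse_free L M" and V: "kernel_basis L V"
  shows "trivial_kernel (V\<^sup>T * M * V)"
  unfolding trivial_kernel_def
proof (intro allI impI)
  note dV = kernel_basisD(1)[OF V, unfolded d] and tV = kernel_basisD(3)[OF V]
  fix x assume x: "dim_vec x = dim_col (V\<^sup>T * M * V)"
    and 0: "V\<^sup>T * M * V *\<^sub>v x = 0\<^sub>v (dim_row (V\<^sup>T * M * V))"
  have dx: "dim_vec x = dim_col V" using x by simp
  have "V\<^sup>T *\<^sub>v (M *\<^sub>v (V *\<^sub>v x)) = 0\<^sub>v (dim_col V)"
    using 0 dx dV d by (simp add: mat_vec_assoc)
  then obtain z where z: "dim_vec z = m" "M *\<^sub>v (V *\<^sub>v x) = L *\<^sub>v z"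
    using symmetric_range[OF d(1,2) sym V, of "M *\<^sub>v (V *\<^sub>v x)"] d by auto
  have "L *\<^sub>v (V *\<^sub>v x) = 0\<^sub>v m"
    using mat_vec_assoc[of L V x] kernel_basisD(4)[OF V] dx dV d by (simp add: zero_mult_vec)
  hence "V *\<^sub>v x = 0\<^sub>v m"
    using impulse_freeD[OF i, of "V *\<^sub>v x" z] z d dV by simp
  thus "x = 0\<^sub>v (dim_col (V\<^sup>T * M * V))"
    using tV dx dV unfolding trivial_kernel_def by simp
qed

text \<open>
\<open>det N = det N\<^sup>T = det (- N) = (-1)\<^sup>k det N\<close>, so that \<open>det N = 0\<close> for odd \<open>k\<close>.
\<close>

lemma skew_trivial_kernel_even:
  fixes N :: "real mat"
  assumes d: "dim_row N = k" "dim_col N = k" and skew: "skew_symmetric N" and tk: "trivial_kernel N"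
  shows "even k"
proof (rule ccontr)
  assume "odd k"
  have c: "N \<in> carrier_mat k k" using d by (rule carrier_matI)
  have "- N = (-1) \<cdot>\<^sub>m N" by (intro eq_matI) auto
  hence "det (N\<^sup>T) = (-1) ^ k * det N"
    using skew d unfolding skew_symmetric_def by (simp add: det_smult)
  hence "det N = 0" using det_transpose[OF c] \<open>odd k\<close> by simp
  thus False using det_0_iff_vec_prod_zero_field[OF c] tk d unfolding trivial_kernel_def
    by (auto dest: carrier_vecD)
qed

lemma impulse_free_kernel_dim:
  fixes L M :: "real mat"
  assumes d: "dim_row L = m" "dim_col L = m" "dim_row M = m" "dim_col M = m"
    and sym: "L\<^sup>T = L" and i: "impulse_free L M"
  shows "m - mrank L \<le> mrank M" "skew_symmetric M \<Longrightarrow> even (m - mrank L)"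
proof -
  obtain V where V: "kernel_basis L V" by (rule kernel_basis_ex)
  note dV = kernel_basisD(1,2)[OF V, unfolded d]
  let ?N = "V\<^sup>T * M * V"
  have tk: "trivial_kernel ?N" by (rule impulse_free_kernel_compression[OF d sym i V])
  hence "m - mrank L = mrank ?N" using full_rank_iff_trivial_kernel[of ?N] dV(2) d by simp
  also have "\<dots> \<le> mrank (V\<^sup>T * M)" by (rule rank_mult_le) (use dV d in simp)
  also have "\<dots> \<le> mrank M" by (rule rank_mult_le_right) (use dV d in simp)
  finally show "m - mrank L \<le> mrank M" .
  assume "skew_symmetric M"
  from skew_congruence[OF d(3,4) dV(1) this] have "skew_symmetric ?N" .
  from skew_trivial_kernel_even[OF _ _ this tk, of "m - mrank L"]
  show "even (m - mrank L)" using dV d by simp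
qed

text \<open>
For a null-space basis \<open>V\<close> of \<open>M\<close>, the matrix \<open>V V\<^sup>T\<close> has rank \<open>m - rank M\<close>. Its range is the null space of
\<open>M\<close>, which is orthogonal to the range of the skew-symmetric matrix \<open>M\<close>; so it forms an impulse-free pencil with
\<open>M\<close>, and the parity statement on null-space dimensions applies.
\<close>

lemma rank_skew_even:
  fixes M :: "real mat"
  assumes d: "dim_row M = m" "dim_col M = m" and skew: "skew_symmetric M"
  shows "even (mrank M)"
proof -
  obtain V where V: "kernel_basis M V" by (rule kernel_basis_ex)
  note dV = kernel_basisD(1,2)[OF V, unfolded d] and tV = kernel_basisD(3)[OF V]
  let ?L = "V * V\<^sup>T"
  have rM: "mrank M \<le> m" using rank_le_dims(1)[of M] d by simp
  have MT: "V\<^sup>T * M = 0\<^sub>m (dim_col V) m"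
  proof -
    have "V\<^sup>T * M = - (V\<^sup>T * M\<^sup>T)"
      unfolding skew[unfolded skew_symmetric_def] using dV d by (simp add: mat_uminus_mult)
    also have "V\<^sup>T * M\<^sup>T = (M * V)\<^sup>T"
      using dV d by (simp add: mat_transpose_mult)
    also have "\<dots> = 0\<^sub>m (dim_col V) m" unfolding kernel_basisD(4)[OF V] d by simp
    finally show ?thesis by (simp add: uminus_zero_mat)
  qed
  have gram: "trivial_kernel (V\<^sup>T * V)"
    unfolding trivial_kernel_def
  proof (intro allI impI)
    fix y assume y: "dim_vec y = dim_col (V\<^sup>T * V)"
      "V\<^sup>T * V *\<^sub>v y = 0\<^sub>v (dim_row (V\<^sup>T * V))"
    hence "V\<^sup>T *\<^sub>v (V *\<^sub>v y) = 0\<^sub>v (dim_col V)"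
      using mat_vec_assoc[of "V\<^sup>T" V y] by simp
    with y(1) show "y = 0\<^sub>v (dim_col (V\<^sup>T * V))"
      using trivial_kernel_gram[OF tV] by simp
  qed
  \<comment> \<open>The Gram matrix is invertible, and its square is a compression of \<open>V V\<^sup>T\<close>; this bounds the rank from below.\<close>
  have "trivial_kernel ((V\<^sup>T * V) * (V\<^sup>T * V))"
    by (rule trivial_kernel_comp[OF _ gram gram]) simp
  from iffD2[OF full_rank_iff_trivial_kernel this]
  have "dim_col V = mrank ((V\<^sup>T * V) * (V\<^sup>T * V))" by simp
  also have "(V\<^sup>T * V) * (V\<^sup>T * V) = (V\<^sup>T * ?L) * V"
    by (simp add: mat_assoc)
  also have "mrank \<dots> \<le> mrank (V\<^sup>T * ?L)" by (rule rank_mult_le) simp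
  also have "\<dots> \<le> mrank ?L" by (rule rank_mult_le_right) simp
  finally have "dim_col V \<le> mrank ?L" .
  moreover have "mrank ?L \<le> dim_col V" by (rule rank_factorization_le) simp
  ultimately have rL: "mrank ?L = m - mrank M" using dV d by simp
  have "impulse_free ?L M"
  proof (rule impulse_freeI)
    fix x z assume dx: "dim_vec x = dim_col ?L" "dim_vec z = dim_col ?L"
      and 1: "?L *\<^sub>v x = 0\<^sub>v (dim_row ?L)" and 2: "M *\<^sub>v x = ?L *\<^sub>v z"
    have x: "dim_vec x = m" "dim_vec z = m" using dx dV by simp_all
    have "V *\<^sub>v (V\<^sup>T *\<^sub>v x) = 0\<^sub>v (dim_row V)"
      using 1 x dV by (simp add: mat_vec_assoc)
    from trivial_kernelD[OF tV _ this] have VTx: "V\<^sup>T *\<^sub>v x = 0\<^sub>v (dim_col V)"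
      by simp
    have "V\<^sup>T *\<^sub>v (V *\<^sub>v (V\<^sup>T *\<^sub>v z)) = V\<^sup>T *\<^sub>v (?L *\<^sub>v z)"
      using x dV by (simp add: mat_vec_assoc)
    also have "\<dots> = V\<^sup>T *\<^sub>v (M *\<^sub>v x)" unfolding 2 ..
    also have "\<dots> = V\<^sup>T * M *\<^sub>v x"
      by (rule mat_vec_assoc[symmetric]) (use x dV d in simp_all)
    also have "\<dots> = 0\<^sub>v (dim_col V)" unfolding MT using x by (simp add: zero_mult_vec)
    finally have "V\<^sup>T *\<^sub>v (V *\<^sub>v (V\<^sup>T *\<^sub>v z)) = 0\<^sub>v (dim_col V)" .
    from trivial_kernel_gram[OF tV _ this] have "V\<^sup>T *\<^sub>v z = 0\<^sub>v (dim_col V)" by simp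
    hence "?L *\<^sub>v z = 0\<^sub>v m" using x dV by (simp add: mat_vec_assoc mult_zero_vec)
    hence "M *\<^sub>v x = 0\<^sub>v (dim_row M)" using 2 d by simp
    from kernel_basisD(5)[OF V _ this] obtain u where u: "dim_vec u = dim_col V" "x = V *\<^sub>v u"
      unfolding d using x(1) by blast
    have "u = 0\<^sub>v (dim_col V)"
      by (rule trivial_kernel_gram[OF tV u(1)]) (use VTx in \<open>simp add: u(2)\<close>)
    thus "x = 0\<^sub>v (dim_col ?L)" unfolding u(2) using dV by (simp add: mult_zero_vec)
  qed
  from impulse_free_kernel_dim(2)[OF _ _ d _ this skew] have "even (m - mrank ?L)"
    using dV by (simp add: mat_transpose_mult)
  thus ?thesis unfolding rL using rM by simp
qed

text \<open>
If \<open>L x = 0\<close> and \<open>N x = L z\<close> then \<open>x \<bullet> N x = L x \<bullet> z = 0\<close>.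
\<close>

lemma strictly_dissipative_impulse_free:
  fixes L N :: "real mat"
  assumes d: "dim_row L = m" "dim_col L = m" "dim_row N = m" "dim_col N = m"
    and sym: "L\<^sup>T = L" and neg: "\<And>x. dim_vec x = m \<Longrightarrow> x \<noteq> 0\<^sub>v m \<Longrightarrow> x \<bullet> (N *\<^sub>v x) < 0"
  shows "impulse_free L N"
proof (rule impulse_freeI)
  fix x z assume dx: "dim_vec x = dim_col L" "dim_vec z = dim_col L"
    and 1: "L *\<^sub>v x = 0\<^sub>v (dim_row L)" and 2: "N *\<^sub>v x = L *\<^sub>v z"
  have "x \<bullet> (N *\<^sub>v x) = (L\<^sup>T *\<^sub>v x) \<bullet> z"
    unfolding 2 by (rule transpose_scalar_prod[symmetric]) (use dx d in simp_all)
  also have "\<dots> = 0" unfolding sym 1 using dx d by (simp add: scalar_prod_def)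
  finally show "x = 0\<^sub>v (dim_col L)" using neg[of x] dx d by fastforce
qed

section \<open>Semidefinite leading matrices of prescribed rank\<close>

text \<open>
An invertible compression of \<open>M\<close> to the columns of \<open>V\<close> is split off by a congruence. Complete \<open>V\<close> to a basis and clear
the upper right block; the lower left block \<open>b\<close> cannot be cleared by the same congruence unless \<open>M\<close> has some
symmetry, and it is harmless below. The remaining block \<open>D\<close> is a compression of \<open>M\<close>, so it inherits dissipativity and
skew-symmetry.
\<close>

lemma pivot_congruence:
  fixes M :: "real mat"
  assumes d: "dim_row M = m" "dim_col M = m" and dV: "dim_row V = m" "dim_col V = s"
    and P: "inverses s (V\<^sup>T * M * V) P'"
  obtains T T' b D where "inverses m T T'" "s \<le> m"
    "T\<^sup>T * M * T = four_block_mat (V\<^sup>T * M * V) (0\<^sub>m s (m - s)) b D"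
    "dim_row b = m - s" "dim_col b = s" "dim_row D = m - s" "dim_col D = m - s"
    "mrank M = s + mrank D"
    "dissipative M \<Longrightarrow> dissipative D" "skew_symmetric M \<Longrightarrow> skew_symmetric D"
proof -
  define P where "P = V\<^sup>T * M * V"
  note P = P[folded P_def] and Pd = inverses_dim[OF P[folded P_def]]
  have "trivial_kernel (V\<^sup>T * M * V)"
    using inverses_trivial_kernel[OF P] unfolding P_def .
  hence tV: "trivial_kernel V" by (rule trivial_kernel_mult[rotated]) (use d dV in simp)
  obtain W T0' where "dim_row W = dim_row V" "dim_col V + dim_col W = dim_row V"
    "inverses (dim_row V) (hcat V W) T0'"
    by (rule basis_completion[OF tV])
  note W = this(1,2)[unfolded dV] and T0 = this(3)[unfolded dV]
  define k where "k = m - s"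
  have m: "m = s + k" and dW: "dim_row W = m" "dim_col W = k" using W by (auto simp: k_def)
  define c where "c = V\<^sup>T * M * W"
  define b0 where "b0 = W\<^sup>T * M * V"
  define D0 where "D0 = W\<^sup>T * M * W"
  have dims: "dim_row c = s" "dim_col c = k" "dim_row b0 = k" "dim_col b0 = s" "dim_row D0 = k" "dim_col D0 = k"
    using dV dW by (simp_all add: c_def b0_def D0_def)
  have M0: "(hcat V W)\<^sup>T * M * hcat V W = four_block_mat P c b0 D0"
    unfolding P_def c_def b0_def D0_def by (rule hcat_congruence) (use d dV dW in simp_all)
  define T1 where "T1 = four_block_mat (1\<^sub>m s) (- (P' * c)) (0\<^sub>m k s) (1\<^sub>m k)"
  define T1' where "T1' = four_block_mat (1\<^sub>m s) (P' * c) (0\<^sub>m k s) (1\<^sub>m k)"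
  note simps = four_block_mult mat_dim_simps mat_uminus_mult mat_minus_add_cancel uminus_zero_mat
    inverses_cancel[OF P] Pd dims
  have T1: "inverses m T1 T1'"
    unfolding inverses_def T1_def T1'_def m
    by (intro conjI carrier_matI) (simp_all add: simps)
  have dT1: "dim_row T1 = m" "dim_col T1 = m" using inverses_dim[OF T1] by auto
  have T1t: "T1\<^sup>T = four_block_mat (1\<^sub>m s) (0\<^sub>m s k) (- (P' * c)\<^sup>T) (1\<^sub>m k)"
    unfolding T1_def by (subst four_block_transpose) (simp_all add: dims Pd transpose_uminus)
  define b where "b = - (P' * c)\<^sup>T * P + b0"
  define D where "D = - (b0 * (P' * c)) + D0"
  have db: "dim_row b = k" "dim_col b = s" "dim_row D = k" "dim_col D = k"
    by (simp_all add: b_def D_def dims Pd)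
  define T where "T = hcat V W * T1"
  have T: "inverses m T (T1' * T0')" unfolding T_def by (rule inverses_mult[OF T0 T1])
  have "four_block_mat P c b0 D0 * T1 = four_block_mat P (0\<^sub>m s k) b0 D"
    unfolding T1_def D_def by (simp add: simps)
  moreover have "T1\<^sup>T * four_block_mat P (0\<^sub>m s k) b0 D = four_block_mat P (0\<^sub>m s k) b D"
    unfolding T1t b_def by (simp add: simps db)
  moreover have "T\<^sup>T * M * T =
      T1\<^sup>T * ((hcat V W)\<^sup>T * M * hcat V W * T1)"
    unfolding T_def using d dV dW dT1 m by (simp add: mat_assoc mat_transpose_mult)
  ultimately have TMT: "T\<^sup>T * M * T = four_block_mat P (0\<^sub>m s k) b D"
    unfolding M0 by simp
  have rank: "mrank M = s + mrank D"
  proof -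
    have 1: "equivalent_mats M (four_block_mat P (0\<^sub>m s k) b D)"
      unfolding equivalent_mats_def TMT[symmetric] d
      using inverses_transpose[OF T] T by blast
    have "D + - (b * P' * 0\<^sub>m s k) = D" by (simp add: simps db)
    hence 2: "equivalent_mats (four_block_mat P (0\<^sub>m s k) b D)
        (four_block_mat (1\<^sub>m s) (0\<^sub>m s k) (0\<^sub>m k s) D)"
      using equivalent_mats_schur[OF P, of "0\<^sub>m s k" b D] db by simp
    from equivalent_mats_trans[OF 1 2]
    have "equivalent_mats M (four_block_mat (1\<^sub>m s) (0\<^sub>m s k) (0\<^sub>m k s) D)" .
    from equivalent_mats_rank[OF this] show ?thesis using rank_diag_one[of s D] db by simp
  qed
  define G where "G = T * lower_identity s k"
  have dT: "dim_row T = m" "dim_col T = m" using inverses_dim[OF T] by auto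
  have dG: "dim_row G = m" using dT by (simp add: G_def)
  have "G\<^sup>T * M * G = (lower_identity s k)\<^sup>T * (T\<^sup>T * M * T) * lower_identity s k"
    unfolding G_def using d dT m by (simp add: mat_assoc mat_transpose_mult)
  also have "\<dots> = D"
    unfolding TMT by (rule lower_right_compression) (simp_all add: db Pd)
  finally have G: "G\<^sup>T * M * G = D" .
  show thesis
  proof (rule that[of T "T1' * T0'" b D])
    show "T\<^sup>T * M * T = four_block_mat (V\<^sup>T * M * V) (0\<^sub>m s (m - s)) b D"
      using TMT unfolding P_def k_def .
    show "dissipative M \<Longrightarrow> dissipative D"
      using dissipative_congruence[OF d dG] unfolding G .
    show "skew_symmetric M \<Longrightarrow> skew_symmetric D"
      using skew_congruence[OF d dG] unfolding G .
  qed (use T rank db m in simp_all)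
qed

text \<open>
The pivot may be put into the null space of the leading matrix (\<open>J = 0\<close>), where its invertibility is used, or outside
of it (\<open>J = I\<close>).
\<close>

lemma impulse_free_pivot:
  fixes P :: "real mat"
  assumes P: "inverses s P P'" and d: "dim_row L = k" "dim_col L = k" "dim_row b = k" "dim_col b = s"
      "dim_row D = k" "dim_col D = k"
    and J: "J = 1\<^sub>m s \<or> J = 0\<^sub>m s s" and i: "impulse_free L D"
  shows "impulse_free (four_block_mat J (0\<^sub>m s k) (0\<^sub>m k s) L) (four_block_mat P (0\<^sub>m s k) b D)"
    (is "impulse_free ?L ?M")
proof (rule impulse_freeI)
  note Pd = inverses_dim[OF P]
  have dJ: "dim_row J = s" "dim_col J = s" using J by auto
  fix x z assume "dim_vec x = dim_col ?L" "dim_vec z = dim_col ?L"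
    and 1: "?L *\<^sub>v x = 0\<^sub>v (dim_row ?L)" and 2: "?M *\<^sub>v x = ?L *\<^sub>v z"
  hence dx: "dim_vec x = s + k" "dim_vec z = s + k" using d dJ by auto
  obtain x1 x2 where x: "x = x1 @\<^sub>v x2" "dim_vec x1 = s" "dim_vec x2 = k" by (rule split_vec[OF dx(1)])
  obtain z1 z2 where z: "z = z1 @\<^sub>v z2" "dim_vec z1 = s" "dim_vec z2 = k" by (rule split_vec[OF dx(2)])
  have Lx: "?L *\<^sub>v (u @\<^sub>v w) = (J *\<^sub>v u) @\<^sub>v (L *\<^sub>v w)" if "dim_vec u = s" "dim_vec w = k" for u w
    using that d dJ by (simp add: four_block_mult_append mat_dim_simps)
  have Mx: "?M *\<^sub>v (u @\<^sub>v w) = (P *\<^sub>v u) @\<^sub>v (b *\<^sub>v u + D *\<^sub>v w)" if "dim_vec u = s" "dim_vec w = k" for u w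
    using that d Pd by (simp add: four_block_mult_append mat_dim_simps)
  have dd: "dim_vec (J *\<^sub>v x1) = dim_vec (0\<^sub>v s :: real vec)" "dim_vec (P *\<^sub>v x1) = dim_vec (J *\<^sub>v z1)"
    using dJ Pd by simp_all
  have "(J *\<^sub>v x1) @\<^sub>v (L *\<^sub>v x2) = 0\<^sub>v s @\<^sub>v 0\<^sub>v k"
    using 1 unfolding x(1) Lx[OF x(2,3)] using d dJ by (simp add: append_vec_zero)
  from this[unfolded append_vec_eq_iff[OF dd(1)]]
  have J1: "J *\<^sub>v x1 = 0\<^sub>v s" and L2: "L *\<^sub>v x2 = 0\<^sub>v k" by auto
  have "(P *\<^sub>v x1) @\<^sub>v (b *\<^sub>v x1 + D *\<^sub>v x2) = (J *\<^sub>v z1) @\<^sub>v (L *\<^sub>v z2)"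
    using 2 unfolding x(1) z(1) Lx[OF z(2,3)] Mx[OF x(2,3)] .
  from this[unfolded append_vec_eq_iff[OF dd(2)]]
  have P1: "P *\<^sub>v x1 = J *\<^sub>v z1" and D2: "b *\<^sub>v x1 + D *\<^sub>v x2 = L *\<^sub>v z2" by auto
  from J have x1: "x1 = 0\<^sub>v s"
  proof
    assume "J = 1\<^sub>m s"
    thus ?thesis using J1 x(2) one_mult_vec[of x1 s] by simp
  next
    assume "J = 0\<^sub>m s s"
    hence "P *\<^sub>v x1 = 0\<^sub>v (dim_row P)" using P1 z(2) Pd by (simp add: zero_mult_vec)
    from trivial_kernelD[OF inverses_trivial_kernel[OF P] _ this] show ?thesis using x(2) Pd by simp
  qed
  have "D *\<^sub>v x2 = L *\<^sub>v z2" using D2 unfolding x1 using d by (simp add: mult_zero_vec vec_add_zero)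
  hence "x2 = 0\<^sub>v k" using impulse_freeD[OF i, of x2 z2] L2 x(3) z(3) d by simp
  thus "x = 0\<^sub>v (dim_col ?L)" using x(1) x1 d dJ by (simp add: append_vec_zero)
qed

text \<open>
The flag \<open>c\<close> selects whether the pivot block contributes its size \<open>s\<close> to the rank of the leading matrix.
\<close>

lemma pivot_lift:
  fixes M :: "real mat"
  assumes d: "dim_row M = m" "dim_col M = m" and T: "inverses m T T'" and m: "m = s + k"
    and TMT: "T\<^sup>T * M * T = four_block_mat P (0\<^sub>m s k) b D"
    and P: "inverses s P P'" and dims: "dim_row b = k" "dim_col b = s" "dim_row D = k" "dim_col D = k"
    and L: "dim_row L = k" "dim_col L = k" "psd L" "impulse_free L D"
  shows "\<exists>L'. dim_row L' = m \<and> dim_col L' = m \<and> psd L' \<and> impulse_free L' M \<and>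
    mrank L' = (if c then s else 0) + mrank L"
proof -
  define H where "H = four_block_mat (if c then 1\<^sub>m s else 0\<^sub>m s s) (0\<^sub>m s k) (0\<^sub>m k s) L"
  note dT = inverses_dim[OF T]
  have dH: "dim_row H = m" "dim_col H = m" using L by (simp_all add: H_def m)
  have rH: "mrank H = (if c then s else 0) + mrank L"
    using rank_diag_one[of s L] rank_diag_zero[of L k s] L(1,2) by (simp add: H_def)
  have psdH: "psd H" unfolding H_def
    by (rule psd_block_diag[OF _ _ L(1,3)]) (simp_all add: psd_one psd_zero)
  have iH: "impulse_free H (T\<^sup>T * M * T)"
    unfolding H_def TMT by (rule impulse_free_pivot[OF P L(1,2) dims _ L(4)]) simp
  define L' where "L' = T'\<^sup>T * H * T'"
  have dL': "dim_row L' = m" "dim_col L' = m" using dT by (simp_all add: L'_def)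
  have "T\<^sup>T * L' * T = T\<^sup>T * (T'\<^sup>T * (H * (T' * T)))"
    unfolding L'_def using dT dH by (simp add: mat_assoc)
  also have "\<dots> = H"
    using inverses_cancel(1)[OF inverses_transpose[OF T], of H] inverses_cancel(6)[OF T] dH
    by (simp add: mat_mult_one)
  finally have undo: "T\<^sup>T * L' * T = H" .
  have "impulse_free L' M"
    using iH impulse_free_equivalence_iff[OF inverses_transpose[OF T] T dL' d] unfolding undo by blast
  moreover have "psd L'"
    unfolding L'_def by (rule psd_congruence[OF dH(1) _ psdH]) (rule dT)
  moreover have "mrank L' = mrank H"
    unfolding L'_def
    by (rule rank_inverses_mult[where X' = "T\<^sup>T" and Y' = T])
      (use inverses_sym[OF inverses_transpose[OF T]] inverses_sym[OF T] dH in simp_all)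
  ultimately show ?thesis using dL' rH by auto
qed

lemma rank_one_mat: "mrank (1\<^sub>m m :: real mat) = m"
  using iffD2[OF full_rank_iff_trivial_kernel inverses_trivial_kernel[OF inverses_one[of m]]] by simp

lemma impulse_free_one: "dim_col M = m \<Longrightarrow> impulse_free (1\<^sub>m m) (M :: real mat)"
  by (rule impulse_freeI) (simp add: one_mult_vec)

text \<open>
Induction on the size, with \<open>j\<close> the dimension of the null space of \<open>L\<close>. If the form of \<open>M\<close> does not vanish
identically, there is a \<open>1 \<times> 1\<close> pivot, otherwise \<open>M\<close> is skew-symmetric and there is a \<open>2 \<times> 2\<close> pivot built on a
nonzero entry. The pivot is placed in the null space of \<open>L\<close>, with one exception: if the remaining block is
skew-symmetric and \<open>j\<close> is even, then \<open>j - 1\<close> would be odd and out of reach for that block.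
\<close>

lemma psd_impulse_free_exists:
  fixes M :: "real mat"
  assumes "dim_row M = m" "dim_col M = m" "dissipative M" "j \<le> mrank M" "skew_symmetric M \<Longrightarrow> even j"
  shows "\<exists>L. dim_row L = m \<and> dim_col L = m \<and> psd L \<and> impulse_free L M \<and> mrank L = m - j"
  using assms
proof (induction m arbitrary: M j rule: less_induct)
  case (less m)
  note d = less.prems(1,2)
  show ?case
  proof (cases "j = 0")
    case True
    thus ?thesis using psd_one[of m] rank_one_mat[of m] impulse_free_one[OF d(2)]
      by (intro exI[of _ "1\<^sub>m m"]) simp
  next
    case False
    show ?thesis
    proof (cases "skew_symmetric M")
      case nonskew: False
      then obtain x where x: "dim_vec x = m" "x \<bullet> (M *\<^sub>v x) \<noteq> 0"
        using zero_form_imp_skew[OF d] by blast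
      define V where "V = mat_of_cols m [x]"
      define P where "P = V\<^sup>T * M * V"
      have dV: "dim_row V = m" "dim_col V = 1" by (simp_all add: V_def)
      have "P $$ (0, 0) \<noteq> 0"
        unfolding P_def V_def using compression_entry[OF d, of "[x]" 0 0] x by simp
      hence P: "inverses 1 P (mat 1 1 (\<lambda>_. inverse (P $$ (0, 0))))"
        unfolding inverses_def by (auto intro!: carrier_matI eq_matI simp: P_def dV scalar_prod_def)
      obtain T T' b D where T: "inverses m T T'" "1 \<le> m"
        and TMT: "T\<^sup>T * M * T = four_block_mat (V\<^sup>T * M * V) (0\<^sub>m 1 (m - 1)) b D"
        and dims: "dim_row b = m - 1" "dim_col b = 1" "dim_row D = m - 1" "dim_col D = m - 1"
        and r: "mrank M = 1 + mrank D" and D: "dissipative M \<Longrightarrow> dissipative D"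
        by (rule pivot_congruence[OF d dV P[unfolded P_def]]) blast
      have rD: "mrank D \<le> m - 1" using rank_le_dims(1)[of D] dims by simp
      define c where "c \<longleftrightarrow> skew_symmetric D \<and> even j"
      define j' where "j' = (if c then j else j - 1)"
      have j': "j' \<le> mrank D \<and> (skew_symmetric D \<longrightarrow> even j')"
      proof (cases c)
        case True
        hence "even (mrank D)" using rank_skew_even[OF dims(3,4)] by (simp add: c_def)
        \<comment> \<open>The exceptional case loses nothing: the rank of the skew-symmetric \<open>D\<close> is even, so an even
          \<open>j \<le> 1 + rank D\<close> satisfies \<open>j \<le> rank D\<close>.\<close>
        hence "j \<noteq> 1 + mrank D" using True by (auto simp: c_def)
        thus ?thesis using True less.prems(4) r by (auto simp: j'_def c_def)
      next
        case False
        thus ?thesis using \<open>j \<noteq> 0\<close> less.prems(4) r by (auto simp: j'_def c_def)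
      qed
      have "\<exists>L. dim_row L = m - 1 \<and> dim_col L = m - 1 \<and> psd L \<and> impulse_free L D \<and> mrank L = m - 1 - j'"
        by (rule less.IH) (use T(2) dims D less.prems(3) j' in auto)
      then obtain L where L: "dim_row L = m - 1" "dim_col L = m - 1" "psd L" "impulse_free L D"
        "mrank L = m - 1 - j'" by blast
      have m: "m = 1 + (m - 1)" using T(2) by simp
      obtain L' where "dim_row L' = m" "dim_col L' = m" "psd L'" "impulse_free L' M"
        "mrank L' = (if c then 1 else 0) + mrank L"
        using pivot_lift[OF d T(1) m TMT[folded P_def] P dims L(1-4), of c] by blast
      moreover have "(if c then 1 else 0) + (m - 1 - j') = m - j"
        using j' rD T(2) \<open>j \<noteq> 0\<close> by (auto simp: j'_def)
      ultimately show ?thesis using L(5) by auto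
    next
      case skew: True
      hence "even j" using less.prems(5) by simp
      have "M \<noteq> 0\<^sub>m m m"
      proof
        assume M: "M = 0\<^sub>m m m"
        have "mrank (0\<^sub>m m m :: real mat) = 0" using vec_space.rank_0I[of m m] by simp
        thus False using less.prems(4) \<open>j \<noteq> 0\<close> unfolding M by simp
      qed
      then obtain p q where pq: "p < m" "q < m" "M $$ (p, q) \<noteq> 0"
        using eq_matI[of "0\<^sub>m m m" M] d by auto
      define V :: "real mat" where "V = mat_of_cols m [unit_vec m p, unit_vec m q]"
      define P where "P = V\<^sup>T * M * V"
      have dV: "dim_row V = m" "dim_col V = 2" by (simp_all add: V_def)
      have dP: "dim_row P = 2" "dim_col P = 2" by (simp_all add: P_def dV)
      define a where "a = M $$ (p, q)"
      have a: "a \<noteq> 0" using pq by (simp add: a_def)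
      have sk: "M $$ (s, t) = - M $$ (t, s)" if "s < m" "t < m" for s t
        using arg_cong[OF skew[unfolded skew_symmetric_def], of "\<lambda>N. N $$ (t, s)"] that d by simp
      have Pe: "P $$ (s, t) = M $$ ([p, q] ! s, [p, q] ! t)" if "s < 2" "t < 2" for s t
      proof -
        have "P $$ (s, t) = [unit_vec m p, unit_vec m q] ! s \<bullet> (M *\<^sub>v [unit_vec m p, unit_vec m q] ! t)"
          unfolding P_def V_def by (rule compression_entry[OF d]) (use that in auto)
        also have "\<dots> = unit_vec m ([p, q] ! s) \<bullet> (M *\<^sub>v unit_vec m ([p, q] ! t))"
          using that by (auto simp: less_2_cases_iff)
        also have "\<dots> = M $$ ([p, q] ! s, [p, q] ! t)"
          by (rule unit_vec_form[OF d]) (use that pq in \<open>auto simp: less_2_cases_iff\<close>)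
        finally show ?thesis .
      qed
      have P4: "P $$ (0, 0) = 0" "P $$ (0, 1) = a" "P $$ (1, 0) = - a" "P $$ (1, 1) = 0"
        using Pe[of 0 0] Pe[of 0 1] Pe[of 1 0] Pe[of 1 1] sk[of p p] sk[of q q] sk[of q p] pq
        by (simp_all add: a_def)
      \<comment> \<open>A skew-symmetric \<open>2 \<times> 2\<close> matrix \<open>P\<close> with off-diagonal entry \<open>a\<close> satisfies \<open>P\<^sup>2 = - a\<^sup>2 I\<close>.\<close>
      define P' where "P' = mat 2 2 (\<lambda>(s, t). - P $$ (s, t) / (a * a))"
      have P: "inverses 2 P P'"
        unfolding inverses_def P'_def
        by (intro conjI carrier_matI eq_matI)
          (auto simp: dP scalar_prod_def numeral_2_eq_2 less_Suc_eq P4[unfolded One_nat_def] a)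
      obtain T T' b D where T: "inverses m T T'" "2 \<le> m"
        and TMT: "T\<^sup>T * M * T = four_block_mat (V\<^sup>T * M * V) (0\<^sub>m 2 (m - 2)) b D"
        and dims: "dim_row b = m - 2" "dim_col b = 2" "dim_row D = m - 2" "dim_col D = m - 2"
        and r: "mrank M = 2 + mrank D" and D: "dissipative M \<Longrightarrow> dissipative D"
        by (rule pivot_congruence[OF d dV P[unfolded P_def]]) blast
      have "2 \<le> j" using \<open>even j\<close> \<open>j \<noteq> 0\<close> by (auto elim!: evenE)
      have "\<exists>L. dim_row L = m - 2 \<and> dim_col L = m - 2 \<and> psd L \<and> impulse_free L D \<and> mrank L = m - 2 - (j - 2)"
        by (rule less.IH) (use T(2) dims D less.prems(3,4) r \<open>even j\<close> \<open>2 \<le> j\<close> in auto)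
      then obtain L where L: "dim_row L = m - 2" "dim_col L = m - 2" "psd L" "impulse_free L D"
        "mrank L = m - 2 - (j - 2)" by blast
      have m: "m = 2 + (m - 2)" using T(2) by simp
      obtain L' where "dim_row L' = m" "dim_col L' = m" "psd L'" "impulse_free L' M"
        "mrank L' = (if False then 2 else 0) + mrank L"
        using pivot_lift[OF d T(1) m TMT[folded P_def] P dims L(1-4), of False] by blast
      moreover have "m - 2 - (j - 2) = m - j" using \<open>2 \<le> j\<close> by simp
      ultimately show ?thesis using L(5) by auto
    qed
  qed
qed

section \<open>Port-Hamiltonian systems through the matrix Q\<close>

text \<open>
The condition \<open>Q\<^sup>T P = 0\<close> removes \<open>P\<close> from the output equation, and \<open>J\<close> contributes nothing to the form of
\<open>Q\<^sup>T A = Q\<^sup>T (J - R) Q\<close>.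
\<close>

lemma port_hamiltonianD:
  assumes "port_hamiltonian n m E A B C"
  obtains Q M where "Q \<in> carrier_mat n n" "M \<in> carrier_mat n n" "A = M * Q" "C = B\<^sup>T * Q"
    "psd (Q\<^sup>T * E)" "dissipative (Q\<^sup>T * A)"
proof -
  obtain J R Q G P where c: "J \<in> carrier_mat n n" "R \<in> carrier_mat n n" "Q \<in> carrier_mat n n"
      "G \<in> carrier_mat n m" "P \<in> carrier_mat n m"
    and J: "skew_symmetric J" and A: "A = (J - R) * Q" and B: "B = G - P"
    and C: "C = (G + P)\<^sup>T * Q" and E: "psd (Q\<^sup>T * E)"
    and R: "psd (Q\<^sup>T * R * Q)" and P: "Q\<^sup>T * P = 0\<^sub>m n m"
    using assms unfolding port_hamiltonian_def by blast
  have "P\<^sup>T * Q = (Q\<^sup>T * P)\<^sup>T"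
    using mat_transpose_mult[of "Q\<^sup>T" P] c by simp
  hence PQ: "P\<^sup>T * Q = 0\<^sub>m m n" unfolding P by simp
  have "B\<^sup>T * Q = G\<^sup>T * Q - P\<^sup>T * Q"
    unfolding B transpose_minus[OF c(4,5)]
    by (rule minus_mult_distrib_mat[of _ m n]) (use c in auto)
  moreover have "C = G\<^sup>T * Q + P\<^sup>T * Q"
    unfolding C transpose_add[OF c(4,5)]
    by (rule add_mult_distrib_mat[of _ m n]) (use c in auto)
  moreover have "G\<^sup>T * Q - 0\<^sub>m m n = G\<^sup>T * Q + 0\<^sub>m m n"
    using c by (intro eq_matI) auto
  ultimately have CB: "C = B\<^sup>T * Q" unfolding PQ by simp
  have "dissipative (Q\<^sup>T * A)"
    unfolding dissipative_def
  proof (intro allI impI)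
    fix v :: "real vec" assume "dim_vec v = dim_col (Q\<^sup>T * A)"
    hence v: "dim_vec v = n" using c unfolding A by simp
    have "Q\<^sup>T * A = Q\<^sup>T * (J - R) * Q"
      unfolding A by (rule mat_assoc[symmetric]) (use c in auto)
    hence "v \<bullet> (Q\<^sup>T * A *\<^sub>v v) = (Q *\<^sub>v v) \<bullet> ((J - R) *\<^sub>v (Q *\<^sub>v v))"
      using form_transpose_mult[of "J - R" n Q v] c v by simp
    also have "\<dots> = (Q *\<^sub>v v) \<bullet> (J *\<^sub>v (Q *\<^sub>v v)) - (Q *\<^sub>v v) \<bullet> (R *\<^sub>v (Q *\<^sub>v v))"
      by (rule form_minus[OF c(1,2)]) (use c in simp)
    also have "(Q *\<^sub>v v) \<bullet> (J *\<^sub>v (Q *\<^sub>v v)) = 0"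
      by (rule skew_form_zero[of J n]) (use c J in auto)
    also have "(Q *\<^sub>v v) \<bullet> (R *\<^sub>v (Q *\<^sub>v v)) = v \<bullet> (Q\<^sup>T * R * Q *\<^sub>v v)"
      using form_transpose_mult[of R n Q v] c v by simp
    also have "0 - \<dots> \<le> 0" using psd_nonneg[OF R, of v] c v by simp
    finally show "v \<bullet> (Q\<^sup>T * A *\<^sub>v v) \<le> 0" .
  qed
  from that[OF c(3) minus_carrier_mat[OF c(2)] A CB E this] show thesis .
qed

text \<open>
For invertible \<open>Q\<close> one takes \<open>P = 0\<close>, and for \<open>J\<close> and \<open>- R\<close> the skew-symmetric and the symmetric part of
\<open>A Q\<^sup>-\<^sup>1\<close>.
\<close>

lemma port_hamiltonianI:
  assumes E: "E \<in> carrier_mat n n" and A: "A \<in> carrier_mat n n" and B: "B \<in> carrier_mat n m"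
    and Q: "inverses n Q Q'" and C: "C = B\<^sup>T * Q"
    and QE: "psd (Q\<^sup>T * E)" and QA: "dissipative (Q\<^sup>T * A)"
  shows "port_hamiltonian n m E A B C"
proof -
  define M where "M = A * Q'"
  define J where "J = mat n n (\<lambda>(i, j). (M $$ (i, j) - M $$ (j, i)) / 2)"
  define R where "R = mat n n (\<lambda>(i, j). - (M $$ (i, j) + M $$ (j, i)) / 2)"
  note dQ = inverses_dim[OF Q]
  have dM: "dim_row M = n" "dim_col M = n" using A dQ by (auto simp: M_def)
  have cJ: "J \<in> carrier_mat n n" and cR: "R \<in> carrier_mat n n" and cQ: "Q \<in> carrier_mat n n"
    using dQ by (auto simp: J_def R_def)
  have JR: "J - R = M" by (intro eq_matI) (auto simp: J_def R_def dM field_simps)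
  have skew: "skew_symmetric J"
    unfolding skew_symmetric_def by (intro eq_matI) (auto simp: J_def field_simps)
  have sR: "R\<^sup>T = R" by (intro eq_matI) (auto simp: R_def)
  have AM: "A = (J - R) * Q"
    unfolding JR M_def using A dQ by (simp add: mat_assoc inverses_cancel(6)[OF Q] mat_mult_one)
  have sym: "(Q\<^sup>T * R * Q)\<^sup>T = Q\<^sup>T * R * Q"
    using dQ cR by (simp add: mat_transpose_mult mat_assoc sR)
  have nonneg: "0 \<le> v \<bullet> (Q\<^sup>T * R * Q *\<^sub>v v)" if v: "dim_vec v = n" for v
  proof -
    have "v \<bullet> (Q\<^sup>T * A *\<^sub>v v) \<le> 0"
      by (rule dissipative_nonpos[OF QA]) (use v A in simp)
    also have "Q\<^sup>T * A = Q\<^sup>T * (J - R) * Q"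
      unfolding AM by (rule mat_assoc[symmetric]) (use cJ cR dQ in auto)
    also have "v \<bullet> (\<dots> *\<^sub>v v) = (Q *\<^sub>v v) \<bullet> ((J - R) *\<^sub>v (Q *\<^sub>v v))"
      using form_transpose_mult[of "J - R" n Q v] cJ cR dQ v by simp
    also have "\<dots> = (Q *\<^sub>v v) \<bullet> (J *\<^sub>v (Q *\<^sub>v v)) - (Q *\<^sub>v v) \<bullet> (R *\<^sub>v (Q *\<^sub>v v))"
      by (rule form_minus[OF cJ cR]) (use dQ in simp)
    also have "(Q *\<^sub>v v) \<bullet> (J *\<^sub>v (Q *\<^sub>v v)) = 0"
      by (rule skew_form_zero[of J n]) (use cJ dQ skew in auto)
    also have "(Q *\<^sub>v v) \<bullet> (R *\<^sub>v (Q *\<^sub>v v)) = v \<bullet> (Q\<^sup>T * R * Q *\<^sub>v v)"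
      using form_transpose_mult[of R n Q v] cR dQ v by simp
    finally show ?thesis by simp
  qed
  have psdR: "psd (Q\<^sup>T * R * Q)"
    unfolding psd_def using sym nonneg dQ by (auto dest: carrier_vecD)
  have dE: "dim_row E = n" "dim_col E = n" and dB: "dim_row B = n" "dim_col B = m"
    using E B by auto
  have "(Q\<^sup>T * E)\<^sup>T = Q\<^sup>T * E" using QE by (simp add: psd_def)
  moreover have "(Q\<^sup>T * E)\<^sup>T = E\<^sup>T * Q"
    using dQ dE by (simp add: mat_transpose_mult)
  ultimately have QEsym: "Q\<^sup>T * E = E\<^sup>T * Q" by simp
  have cC: "C \<in> carrier_mat m n" unfolding C using dQ dB by (intro carrier_matI) simp_all
  have B0: "B = B - 0\<^sub>m n m" "B + 0\<^sub>m n m = B" using dB by (auto intro!: eq_matI)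
  have QP: "Q\<^sup>T * 0\<^sub>m n m = 0\<^sub>m n m" using dQ by (simp add: mat_mult_zero)
  have C0: "C = (B + 0\<^sub>m n m)\<^sup>T * Q" unfolding B0(2) C ..
  have QR: "Q\<^sup>T * R * Q = Q\<^sup>T * R\<^sup>T * Q" unfolding sR ..
  show ?thesis
    unfolding port_hamiltonian_def
    using E A B cC cJ cR cQ skew AM B0(1) C0 QEsym QE QR psdR QP zero_carrier_mat[of n m] by blast
qed

text \<open>
A real vector in both null spaces is embedded into complex space, where the rank condition makes it zero.
\<close>

lemma stacked_trivial_kernel:
  fixes M N :: "real mat"
  assumes d: "dim_col M = n" "dim_col N = n" and rank: "mrank (cmat M @\<^sub>r cmat N) = n"
    and v: "dim_vec v = n" "M *\<^sub>v v = 0\<^sub>v (dim_row M)" "N *\<^sub>v v = 0\<^sub>v (dim_row N)"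
  shows "v = 0\<^sub>v n"
proof -
  let ?MN = "cmat M @\<^sub>r cmat N" and ?v = "map_vec complex_of_real v"
  have c: "v \<in> carrier_vec n" "M \<in> carrier_mat (dim_row M) n" "N \<in> carrier_mat (dim_row N) n"
    by (rule carrier_vecI[OF v(1)], rule carrier_matI[OF refl d(1)], rule carrier_matI[OF refl d(2)])
  have cc: "cmat M \<in> carrier_mat (dim_row M) n" "cmat N \<in> carrier_mat (dim_row N) n"
    by (rule carrier_matI; simp add: d)+
  have dMN: "dim_col ?MN = n" "dim_row ?MN = dim_row M + dim_row N"
    using carrier_matD[OF carrier_append_rows[OF cc]] by blast+
  have "mrank ?MN = dim_col ?MN" unfolding dMN(1) by (rule rank)
  from iffD1[OF full_rank_iff_trivial_kernel this] have tk: "trivial_kernel ?MN" .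
  have z: "cmat K *\<^sub>v ?v = 0\<^sub>v (dim_row K)"
    if K: "K \<in> carrier_mat (dim_row K) n" and 0: "K *\<^sub>v v = 0\<^sub>v (dim_row K)" for K
  proof -
    have "cmat K *\<^sub>v ?v = map_vec complex_of_real (K *\<^sub>v v)"
      by (rule of_real_hom.mult_mat_vec_hom[OF K c(1), symmetric])
    also have "\<dots> = 0\<^sub>v (dim_row K)" unfolding 0 by (intro eq_vecI) simp_all
    finally show ?thesis .
  qed
  have "?MN *\<^sub>v ?v = (cmat M *\<^sub>v ?v) @\<^sub>v (cmat N *\<^sub>v ?v)"
    by (rule mat_mult_append[OF cc]) (simp add: c(1))
  also have "\<dots> = 0\<^sub>v (dim_row ?MN)"
    unfolding z[OF c(2) v(2)] z[OF c(3) v(3)] dMN append_vec_zero ..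
  finally have "?MN *\<^sub>v ?v = 0\<^sub>v (dim_row ?MN)" .
  moreover have "dim_vec ?v = dim_col ?MN" unfolding dMN(1) using v(1) by simp
  ultimately have "?v = 0\<^sub>v (dim_col ?MN)" by (rule trivial_kernelD[OF tk, rotated])
  hence e: "?v = 0\<^sub>v n" unfolding dMN .
  have "v $ i = 0" if "i < n" for i
    using arg_cong[OF e, of "\<lambda>w. w $ i"] that v(1) by simp
  thus ?thesis using v(1) by (intro eq_vecI) simp_all
qed

lemma completely_observable_kernel:
  fixes E A C :: "real mat"
  assumes o: "completely_observable n E A C"
    and d: "dim_row E = n" "dim_col E = n" "dim_row A = n" "dim_col A = n" "dim_col C = n"
    and v: "dim_vec v = n" "C *\<^sub>v v = 0\<^sub>v (dim_row C)"
  shows "E *\<^sub>v v = 0\<^sub>v n \<Longrightarrow> v = 0\<^sub>v n" "A *\<^sub>v v = 0\<^sub>v n \<Longrightarrow> v = 0\<^sub>v n"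
proof -
  have pencil: "\<alpha> \<cdot>\<^sub>m cmat E - \<beta> \<cdot>\<^sub>m cmat A = cmat (a \<cdot>\<^sub>m E - b \<cdot>\<^sub>m A)"
    if "\<alpha> = complex_of_real a" "\<beta> = complex_of_real b" for \<alpha> \<beta> a b
    using d that by (intro eq_matI) auto
  have rank: "mrank (cmat (a \<cdot>\<^sub>m E - b \<cdot>\<^sub>m A) @\<^sub>r cmat C) = n" if "(a, b) \<noteq> (0, 0)" for a b :: real
  proof -
    have "(complex_of_real a, complex_of_real b) \<noteq> (0, 0)" using that by simp
    with o have "mrank ((complex_of_real a \<cdot>\<^sub>m cmat E - complex_of_real b \<cdot>\<^sub>m cmat A) @\<^sub>r cmat C) = n"
      unfolding completely_observable_def by blast
    thus ?thesis unfolding pencil[OF refl refl, of a b] .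
  qed
  show "v = 0\<^sub>v n" if "E *\<^sub>v v = 0\<^sub>v n"
  proof (rule stacked_trivial_kernel[OF _ d(5) rank[of 1 0] v(1) _ v(2)])
    have "1 \<cdot>\<^sub>m E - 0 \<cdot>\<^sub>m A = E" using d by (intro eq_matI) auto
    thus "(1 \<cdot>\<^sub>m E - 0 \<cdot>\<^sub>m A) *\<^sub>v v = 0\<^sub>v (dim_row (1 \<cdot>\<^sub>m E - 0 \<cdot>\<^sub>m A))" using that d by simp
  qed (use d in simp_all)
  show "v = 0\<^sub>v n" if "A *\<^sub>v v = 0\<^sub>v n"
  proof (rule stacked_trivial_kernel[OF _ d(5) rank[of 0 "-1"] v(1) _ v(2)])
    have "0 \<cdot>\<^sub>m E - (-1) \<cdot>\<^sub>m A = A" using d by (intro eq_matI) auto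
    thus "(0 \<cdot>\<^sub>m E - (-1) \<cdot>\<^sub>m A) *\<^sub>v v = 0\<^sub>v (dim_row (0 \<cdot>\<^sub>m E - (-1) \<cdot>\<^sub>m A))" using that d by simp
  qed (use d in simp_all)
qed

text \<open>
\<open>Q\<close> is injective because it is a right factor of both \<open>A\<close> and \<open>C\<close>.
\<close>

lemma observable_port_hamiltonian_inverses:
  assumes c: "E \<in> carrier_mat n n" "A \<in> carrier_mat n n" "B \<in> carrier_mat n m" "C \<in> carrier_mat m n"
    and ph: "port_hamiltonian n m E A B C" and obs: "completely_observable n E A C"
  obtains Q Q' where "inverses n Q Q'" "C = B\<^sup>T * Q"
    "psd (Q\<^sup>T * E)" "dissipative (Q\<^sup>T * A)"
proof -
  obtain Q M where Q: "Q \<in> carrier_mat n n" "M \<in> carrier_mat n n" "A = M * Q" "C = B\<^sup>T * Q"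
    "psd (Q\<^sup>T * E)" "dissipative (Q\<^sup>T * A)"
    by (rule port_hamiltonianD[OF ph])
  note d = carrier_matD[OF c(1)] carrier_matD[OF c(2)] carrier_matD[OF c(4)]
  have dQ: "dim_row Q = n" "dim_col Q = n" using Q(1) by auto
  have "trivial_kernel Q"
    unfolding trivial_kernel_def dQ
  proof (intro allI impI)
    fix v assume v: "dim_vec v = n" "Q *\<^sub>v v = 0\<^sub>v n"
    have "C *\<^sub>v v = B\<^sup>T *\<^sub>v (Q *\<^sub>v v)"
      unfolding Q(4) by (rule mat_vec_assoc) (use v dQ c in auto)
    hence Cv: "C *\<^sub>v v = 0\<^sub>v (dim_row C)" unfolding v(2) using c by (simp add: mult_zero_vec)
    have "A *\<^sub>v v = M *\<^sub>v (Q *\<^sub>v v)"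
      unfolding Q(3) by (rule mat_vec_assoc) (use v dQ Q(2) in auto)
    hence "A *\<^sub>v v = 0\<^sub>v n" unfolding v(2) using Q(2) by (simp add: mult_zero_vec)
    thus "v = 0\<^sub>v n" by (rule completely_observable_kernel(2)[OF obs d(1-4) d(6) v(1) Cv])
  qed
  then obtain Q' where "inverses n Q Q'" using trivial_kernel_imp_inverses[OF dQ] by blast
  with Q(4-6) that show thesis by blast
qed

section \<open>Coordinates adapted to output feedback\<close>

text \<open>
The bases \<open>[S, Z]\<close> and \<open>[E S, B]\<close> in which output feedback acts on an \<open>m \<times> m\<close> block. The equation \<open>E Z = B Y\<close>
is what makes the transformed \<open>E\<close> block diagonal.
\<close>

locale feedback_coordinates =
  fixes n m k :: nat and E B C Q S Z Y U' P' :: "real mat"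
  assumes dims: "dim_row E = n" "dim_col E = n" "dim_row B = n" "dim_col B = m" "dim_row C = m" "dim_col C = n"
      "dim_row Q = n" "dim_col Q = n" "dim_row S = n" "dim_col S = k" "dim_row Z = n" "dim_col Z = m"
      "dim_row Y = m" "dim_col Y = m"
    and n: "n = k + m"
    and U: "inverses n (hcat (E * S) B) U'" and P: "inverses n (hcat S Z) P'"
    and CS: "C * S = 0\<^sub>m m k" and CZ: "C * Z = 1\<^sub>m m" and EZ: "E * Z = B * Y"
    and CBQ: "C = B\<^sup>T * Q" and QE: "psd (Q\<^sup>T * E)"

begin

text \<open>
The lower right \<open>m \<times> m\<close> block of \<open>A\<close> in these bases; that \<open>(Q Z)\<^sup>T\<close> computes it is shown in \<open>left_inverse_row\<close>.
\<close>

abbreviation core :: "real mat \<Rightarrow> real mat" where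
  "core A \<equiv> (Q * Z)\<^sup>T * A * Z"

lemma closed_loop_columns:
  assumes "dim_row K = m" "dim_col K = m"
  shows "(E + B * K * C) * S = E * S" "(E + B * K * C) * Z = B * (Y + K)"
proof -
  have "(E + B * K * C) * S = E * S + B * K * C * S"
    by (rule mat_add_mult) (simp_all add: dims assms)
  also have "B * K * C * S = B * K * (C * S)" by (rule mat_assoc) (simp_all add: dims assms)
  also have "\<dots> = 0\<^sub>m n k" unfolding CS using assms dims by (simp add: mat_mult_zero)
  finally show "(E + B * K * C) * S = E * S" using dims by (simp add: mat_add_zero)
  have "(E + B * K * C) * Z = E * Z + B * K * C * Z"
    by (rule mat_add_mult) (simp_all add: dims assms)
  also have "B * K * C * Z = B * K * (C * Z)" by (rule mat_assoc) (simp_all add: dims assms)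
  also have "\<dots> = B * K" unfolding CZ using assms by (simp add: mat_mult_one)
  also have "E * Z + B * K = B * (Y + K)"
    unfolding EZ by (rule mat_mult_add[symmetric]) (simp_all add: dims assms)
  finally show "(E + B * K * C) * Z = B * (Y + K)" .
qed

lemma closed_loop_diag:
  assumes K: "dim_row K = m" "dim_col K = m"
  shows "U' * (E + B * K * C) * hcat S Z = four_block_mat (1\<^sub>m k) (0\<^sub>m k m) (0\<^sub>m m k) (Y + K)"
proof -
  have dU: "dim_row U' = n" "dim_col U' = n" using inverses_dim[OF U] by simp_all
  have "(E + B * K * C) * hcat S Z = hcat ((E + B * K * C) * S) ((E + B * K * C) * Z)"
    by (rule mult_hcat) (simp_all add: dims)
  also have "\<dots> = hcat (E * S * 1\<^sub>m k) (B * (Y + K))"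
    unfolding closed_loop_columns[OF K] using dims by (simp add: mat_mult_one)
  also have "\<dots> = hcat (E * S) B * four_block_mat (1\<^sub>m k) (0\<^sub>m k m) (0\<^sub>m m k) (Y + K)"
    using hcat_mult_diag[of B "E * S" "1\<^sub>m k" "Y + K"] dims K by simp
  finally have "U' * ((E + B * K * C) * hcat S Z) =
      U' * (hcat (E * S) B * four_block_mat (1\<^sub>m k) (0\<^sub>m k m) (0\<^sub>m m k) (Y + K))" by simp
  also have "\<dots> = four_block_mat (1\<^sub>m k) (0\<^sub>m k m) (0\<^sub>m m k) (Y + K)"
    by (rule inverses_cancel(2)[OF U]) (use K n dims in simp)
  finally show ?thesis using mat_assoc[of U' "E + B * K * C" "hcat S Z"] dU dims by simp
qed

lemma closed_loop_rank:
  assumes K: "dim_row K = m" "dim_col K = m"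
  shows "mrank (E + B * K * C) = k + mrank (Y + K)"
proof -
  have "mrank (U' * (E + B * K * C) * hcat S Z) = mrank (E + B * K * C)"
    by (rule rank_inverses_mult[where X' = "hcat (E * S) B" and Y' = P'])
      (use inverses_sym[OF U] P dims in simp_all)
  thus ?thesis
    unfolding closed_loop_diag[OF K] using rank_diag_one[of k "Y + K"] K dims by simp
qed

lemma closed_loop_rank_bounds:
  assumes K: "dim_row K = m" "dim_col K = m"
  shows "n - mrank (E + B * K * C) = m - mrank (Y + K)" "k \<le> mrank (E + B * K * C)" "mrank (E + B * K * C) \<le> n"
  using closed_loop_rank[OF K] rank_le_dims(1)[of "Y + K"] K n dims by simp_all

lemma W_mult_B: "(Q * Z)\<^sup>T * B = 1\<^sub>m m"
proof -
  have "(Q * Z)\<^sup>T * B = (C * Z)\<^sup>T"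
    unfolding CBQ using dims by (simp add: mat_transpose_mult mat_assoc)
  thus ?thesis unfolding CZ by simp
qed

lemma W_mult_ES: "(Q * Z)\<^sup>T * (E * S) = 0\<^sub>m m k"
proof -
  have "(Q\<^sup>T * E)\<^sup>T = Q\<^sup>T * E" using QE by (simp add: psd_def)
  hence sym: "Q\<^sup>T * E = E\<^sup>T * Q"
    using mat_transpose_mult[of "Q\<^sup>T" E] dims by simp
  have "(Q * Z)\<^sup>T * (E * S) = Z\<^sup>T * (Q\<^sup>T * E) * S"
    using dims by (simp add: mat_transpose_mult mat_assoc)
  also have "\<dots> = (E * Z)\<^sup>T * (Q * S)"
    unfolding sym using dims by (simp add: mat_transpose_mult mat_assoc)
  also have "\<dots> = Y\<^sup>T * (B\<^sup>T * Q * S)"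
    unfolding EZ using dims by (simp add: mat_transpose_mult mat_assoc)
  also have "\<dots> = 0\<^sub>m m k" unfolding CBQ[symmetric] CS using dims by (simp add: mat_mult_zero)
  finally show ?thesis .
qed

lemma rank_B: "mrank B = m"
proof -
  have "trivial_kernel ((Q * Z)\<^sup>T * B)"
    unfolding W_mult_B by (rule inverses_trivial_kernel[OF inverses_one])
  hence "trivial_kernel B" by (rule trivial_kernel_mult[rotated]) (simp add: dims)
  from iffD2[OF full_rank_iff_trivial_kernel this] show ?thesis using dims by simp
qed

text \<open>
The rows of \<open>U'\<close> (the inverse of \<open>[E S, B]\<close>) that read off the coordinates along \<open>B\<close> are \<open>(Q Z)\<^sup>T\<close>. The
symmetry of \<open>Q\<^sup>T E\<close> thus makes the left and the right transformation dual to each other on this block, which is why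
dissipativity survives in \<open>core A\<close>.
\<close>

lemma left_inverse_row: "(lower_identity k m)\<^sup>T * U' = (Q * Z)\<^sup>T"
proof -
  note dU = inverses_dim[OF U]
  let ?W = "(Q * Z)\<^sup>T"
  have "?W * hcat (E * S) B = hcat (?W * (E * S)) (?W * B)"
    by (rule mult_hcat) (simp_all add: dims)
  also have "\<dots> = (lower_identity k m)\<^sup>T"
    unfolding W_mult_ES W_mult_B by (intro eq_matI) (auto simp: hcat_def lower_identity_def)
  finally have "?W * hcat (E * S) B * U' = (lower_identity k m)\<^sup>T * U'" by simp
  moreover have "?W * hcat (E * S) B * U' = ?W"
    using inverses_cancel(5)[OF U] dims dU
    by (simp only: mat_assoc index_transpose_mat index_mult_mat hcat_dim mat_mult_one)
  ultimately show ?thesis by simp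
qed

lemma closed_loop_impulse_free:
  assumes K: "dim_row K = m" "dim_col K = m" and A: "dim_row A = n" "dim_col A = n"
  shows "impulse_free (E + B * K * C) A \<longleftrightarrow> impulse_free (Y + K) ((Q * Z)\<^sup>T * A * Z)"
proof -
  note dU = inverses_dim[OF U]
  have dims': "dim_row (U' * A * hcat S Z) = k + m" "dim_col (U' * A * hcat S Z) = k + m"
    using dU dims n by simp_all
  obtain A1 A2 A3 A4 where blk: "U' * A * hcat S Z = four_block_mat A1 A2 A3 A4"
    and dA: "dim_row A1 = k" "dim_col A1 = k" "dim_row A2 = k" "dim_col A2 = m"
      "dim_row A3 = m" "dim_col A3 = k" "dim_row A4 = m" "dim_col A4 = m"
    by (rule split_four_block[OF dims'])
  have "A4 = (lower_identity k m)\<^sup>T * (U' * A * hcat S Z) * lower_identity k m"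
    unfolding blk by (rule lower_right_compression[symmetric]) (simp_all add: dA)
  also have "\<dots> = ((lower_identity k m)\<^sup>T * U') * A * (hcat S Z * lower_identity k m)"
    using dU dims n A by (simp add: mat_assoc)
  also have "hcat S Z * lower_identity k m = Z" using hcat_lower_identity[of Z S] dims by simp
  finally have A4: "A4 = (Q * Z)\<^sup>T * A * Z" unfolding left_inverse_row .
  have "impulse_free (E + B * K * C) A \<longleftrightarrow>
      impulse_free (U' * (E + B * K * C) * hcat S Z) (U' * A * hcat S Z)"
    by (rule impulse_free_equivalence_iff[OF inverses_sym[OF U] P, symmetric]) (simp_all add: dims A)
  also have "\<dots> \<longleftrightarrow> impulse_free (Y + K) A4"
    unfolding closed_loop_diag[OF K] blk by (rule impulse_free_diag_one) (simp_all add: dA K dims)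
  finally show ?thesis unfolding A4 .
qed

text \<open>
The matrix \<open>Q2\<close> witnessing the closed loop need not be the original \<open>Q\<close>. As \<open>C = B\<^sup>T Q2\<close> and \<open>C Z = I\<close>, compressing
\<open>Q2\<^sup>T (E + B K C)\<close> to the columns of \<open>Z\<close> still gives exactly \<open>Y + K\<close>.
\<close>

lemma closed_loop_psd_necessary:
  assumes K: "dim_row K = m" "dim_col K = m" and Q2: "dim_row Q2 = n" "dim_col Q2 = n"
    and C: "C = B\<^sup>T * Q2" and psd: "psd (Q2\<^sup>T * (E + B * K * C))"
  shows "psd (Y + K)"
proof -
  have "Z\<^sup>T * (Q2\<^sup>T * (E + B * K * C)) * Z =
      Z\<^sup>T * Q2\<^sup>T * ((E + B * K * C) * Z)"
    using dims Q2 by (simp add: mat_assoc)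
  also have "\<dots> = (B\<^sup>T * Q2 * Z)\<^sup>T * (Y + K)"
    unfolding closed_loop_columns(2)[OF K] using dims Q2 K by (simp add: mat_transpose_mult mat_assoc)
  also have "\<dots> = Y + K"
    unfolding C[symmetric] CZ using dims K by (simp add: mat_mult_one)
  finally show ?thesis using psd_congruence[OF _ dims(11) psd] Q2 by simp
qed

text \<open>
In the basis \<open>[S, Z]\<close> the form of \<open>Q\<^sup>T (E + B K C)\<close> is block diagonal. Feedback changes only its second block, which
is \<open>Y + K\<close>; the first one is a compression of \<open>Q\<^sup>T E\<close>.
\<close>

lemma closed_loop_psd:
  assumes K: "dim_row K = m" "dim_col K = m" and L: "psd (Y + K)"
  shows "psd (Q\<^sup>T * (E + B * K * C))"
proof -
  note dP = inverses_dim[OF P]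
  let ?E = "E + B * K * C"
  let ?N = "Q\<^sup>T * ?E"
  have dE: "dim_row ?E = n" "dim_col ?E = n" using dims by simp_all
  have SE: "S\<^sup>T * ?N * S = S\<^sup>T * (Q\<^sup>T * E) * S"
  proof -
    have "S\<^sup>T * ?N * S = S\<^sup>T * (Q\<^sup>T * (?E * S))"
      using dims by (simp add: mat_assoc)
    thus ?thesis unfolding closed_loop_columns(1)[OF K] using dims by (simp add: mat_assoc)
  qed
  have SZ: "S\<^sup>T * ?N * Z = 0\<^sub>m k m"
  proof -
    have "S\<^sup>T * ?N * Z = S\<^sup>T * (Q\<^sup>T * (?E * Z))"
      using dims by (simp add: mat_assoc)
    also have "\<dots> = (B\<^sup>T * Q * S)\<^sup>T * (Y + K)"
      unfolding closed_loop_columns(2)[OF K] using dims K by (simp add: mat_transpose_mult mat_assoc)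
    finally show ?thesis unfolding CBQ[symmetric] CS using dims K by (simp add: mat_mult_zero)
  qed
  have ZS: "Z\<^sup>T * ?N * S = 0\<^sub>m m k"
  proof -
    have "Z\<^sup>T * ?N * S = (Q * Z)\<^sup>T * (?E * S)"
      using dims by (simp add: mat_assoc mat_transpose_mult)
    thus ?thesis unfolding closed_loop_columns(1)[OF K] W_mult_ES .
  qed
  have ZZ: "Z\<^sup>T * ?N * Z = Y + K"
  proof -
    have "Z\<^sup>T * ?N * Z = (Q * Z)\<^sup>T * (?E * Z)"
      using dims by (simp add: mat_assoc mat_transpose_mult)
    also have "\<dots> = (Q * Z)\<^sup>T * B * (Y + K)"
      unfolding closed_loop_columns(2)[OF K] using dims K by (simp add: mat_assoc)
    also have "\<dots> = Y + K" unfolding W_mult_B using dims K by (simp add: mat_mult_one)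
    finally show ?thesis .
  qed
  have "(hcat S Z)\<^sup>T * ?N * hcat S Z =
      four_block_mat (S\<^sup>T * ?N * S) (S\<^sup>T * ?N * Z)
        (Z\<^sup>T * ?N * S) (Z\<^sup>T * ?N * Z)"
    by (rule hcat_congruence[of _ n]) (simp_all add: dims)
  also have "\<dots> = four_block_mat (S\<^sup>T * (Q\<^sup>T * E) * S) (0\<^sub>m k m) (0\<^sub>m m k) (Y + K)"
    unfolding SE SZ ZS ZZ ..
  finally have cong: "(hcat S Z)\<^sup>T * ?N * hcat S Z =
      four_block_mat (S\<^sup>T * (Q\<^sup>T * E) * S) (0\<^sub>m k m) (0\<^sub>m m k) (Y + K)" .
  have "psd (S\<^sup>T * (Q\<^sup>T * E) * S)"
    by (rule psd_congruence[OF _ dims(9) QE]) (simp add: dims)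
  hence "psd ((hcat S Z)\<^sup>T * ?N * hcat S Z)"
    unfolding cong by (intro psd_block_diag L) (simp_all add: dims K)
  hence "psd (P'\<^sup>T * ((hcat S Z)\<^sup>T * ?N * hcat S Z) * P')"
    by (rule psd_congruence[of _ n, rotated 2]) (simp_all add: dims dP n)
  moreover have "P'\<^sup>T * ((hcat S Z)\<^sup>T * ?N * hcat S Z) * P' =
      P'\<^sup>T * ((hcat S Z)\<^sup>T * (?N * (hcat S Z * P')))"
    using dims dP n by (simp add: mat_assoc)
  moreover have "\<dots> = ?N"
    unfolding inverses_cancel(5)[OF P]
    using inverses_cancel(2)[OF inverses_transpose[OF P], of ?N] dims by (simp add: mat_mult_one)
  ultimately show ?thesis by simp
qed

text \<open>
\<open>Q\<^sup>T B F C = C\<^sup>T F C\<close> because \<open>C = B\<^sup>T Q\<close>.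
\<close>

lemma closed_loop_dissipative:
  assumes F: "dim_row F = m" "dim_col F = m" and A: "dim_row A = n" "dim_col A = n"
    and QA: "dissipative (Q\<^sup>T * A)" and dF: "dissipative F"
  shows "dissipative (Q\<^sup>T * (A + B * F * C))"
  unfolding dissipative_def
proof (intro allI impI)
  fix v :: "real vec" assume "dim_vec v = dim_col (Q\<^sup>T * (A + B * F * C))"
  hence v: "dim_vec v = n" using dims by simp
  have "Q\<^sup>T * (A + B * F * C) = Q\<^sup>T * A + Q\<^sup>T * (B * F * C)"
    by (rule mat_mult_add) (simp_all add: dims A F)
  also have "Q\<^sup>T * (B * F * C) = C\<^sup>T * F * C"
    unfolding CBQ using dims F by (simp add: mat_transpose_mult mat_assoc)
  finally have "Q\<^sup>T * (A + B * F * C) *\<^sub>v v = Q\<^sup>T * A *\<^sub>v v + C\<^sup>T * F * C *\<^sub>v v"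
    using v dims A F by (simp add: mat_add_vec)
  moreover have "v \<bullet> (Q\<^sup>T * A *\<^sub>v v + C\<^sup>T * F * C *\<^sub>v v) =
      v \<bullet> (Q\<^sup>T * A *\<^sub>v v) + v \<bullet> (C\<^sup>T * F * C *\<^sub>v v)"
    by (rule scalar_prod_add_distrib[of _ n]; rule carrier_vecI; simp add: v dims)
  moreover have "v \<bullet> (Q\<^sup>T * A *\<^sub>v v) \<le> 0"
    by (rule dissipative_nonpos[OF QA]) (simp add: v A)
  moreover have "v \<bullet> (C\<^sup>T * F * C *\<^sub>v v) \<le> 0"
  proof -
    have "v \<bullet> (C\<^sup>T * F * C *\<^sub>v v) = (C *\<^sub>v v) \<bullet> (F *\<^sub>v (C *\<^sub>v v))"
      by (rule form_transpose_mult[of F m]) (simp_all add: dims F v)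
    also have "\<dots> \<le> 0" by (rule dissipative_nonpos[OF dF]) (simp add: dims F)
    finally show ?thesis .
  qed
  ultimately show "v \<bullet> (Q\<^sup>T * (A + B * F * C) *\<^sub>v v) \<le> 0" by simp
qed

lemma core_dim: "dim_row (core A) = m" "dim_col (core A) = m"
  using dims by simp_all

lemma core_dissipative:
  assumes A: "dim_row A = n" "dim_col A = n" and QA: "dissipative (Q\<^sup>T * A)"
  shows "dissipative (core A)"
proof -
  have "core A = Z\<^sup>T * (Q\<^sup>T * A) * Z"
    using dims A by (simp add: mat_assoc mat_transpose_mult)
  thus ?thesis using dissipative_congruence[OF _ _ dims(11) QA] dims A by simp
qed

lemma core_feedback:
  assumes F: "dim_row F = m" "dim_col F = m" and A: "dim_row A = n" "dim_col A = n"
  shows "core (A + B * F * C) = core A + F"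
proof -
  let ?W = "(Q * Z)\<^sup>T"
  have "core (A + B * F * C) = ?W * ((A + B * F * C) * Z)"
    using dims A by (simp add: mat_assoc)
  also have "(A + B * F * C) * Z = A * Z + B * F * C * Z"
    by (rule mat_add_mult) (simp_all add: dims A)
  also have "?W * (A * Z + B * F * C * Z) = ?W * (A * Z) + ?W * (B * F * C * Z)"
    by (rule mat_mult_add) (simp_all add: dims A)
  also have "?W * (A * Z) = core A" by (rule mat_assoc[symmetric]) (simp_all add: dims A)
  also have "?W * (B * F * C * Z) = ?W * B * (F * (C * Z))"
    using dims F by (simp add: mat_assoc)
  also have "\<dots> = F" unfolding W_mult_B CZ using F by (simp add: mat_mult_one)
  finally show ?thesis .
qed

lemma closed_loop_necessary:
  assumes K: "dim_row K = m" "dim_col K = m" and A: "dim_row A = n" "dim_col A = n"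
    and ix: "has_index (E + B * K * C) A \<nu>" "\<nu> \<le> 1"
    and ph: "port_hamiltonian n m (E + B * K * C) A B C"
  shows "n - mrank (E + B * K * C) \<le> mrank (core A)"
    "skew_symmetric (core A) \<Longrightarrow> even (n - mrank (E + B * K * C))"
proof -
  obtain Q2 M where Q2: "Q2 \<in> carrier_mat n n" "C = B\<^sup>T * Q2"
    "psd (Q2\<^sup>T * (E + B * K * C))"
    by (rule port_hamiltonianD[OF ph])
  have dQ2: "dim_row Q2 = n" "dim_col Q2 = n" using Q2(1) by auto
  have psd: "psd (Y + K)" by (rule closed_loop_psd_necessary[OF K dQ2 Q2(2,3)])
  hence sym: "(Y + K)\<^sup>T = Y + K" by (simp add: psd_def)
  have free: "impulse_free (Y + K) (core A)"
    using index_le_one_imp_impulse_free[OF ix] closed_loop_impulse_free[OF K A] by blast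
  have dL: "dim_row (Y + K) = m" "dim_col (Y + K) = m" using K by simp_all
  show "n - mrank (E + B * K * C) \<le> mrank (core A)"
    unfolding closed_loop_rank_bounds(1)[OF K]
    by (rule impulse_free_kernel_dim(1)[OF dL core_dim sym free])
  show "even (n - mrank (E + B * K * C))" if "skew_symmetric (core A)"
    unfolding closed_loop_rank_bounds(1)[OF K]
    by (rule impulse_free_kernel_dim(2)[OF dL core_dim sym free that])
qed

lemma closed_loop_sufficient:
  assumes Q: "inverses n Q Q'" and A: "dim_row A = n" "dim_col A = n"
    and QA: "dissipative (Q\<^sup>T * A)"
    and L: "dim_row L = m" "dim_col L = m" "psd L" "impulse_free L (core A)"
  shows "\<exists>K \<in> carrier_mat m m. regular_pencil (E + B * K * C) A \<and>
    (\<exists>\<nu> \<le> 1. has_index (E + B * K * C) A \<nu>) \<and> mrank (E + B * K * C) = k + mrank L \<and>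
    port_hamiltonian n m (E + B * K * C) A B C"
proof
  define K where "K = L + - Y"
  have K: "dim_row K = m" "dim_col K = m" using dims by (simp_all add: K_def)
  have YK: "Y + K = L" using L(1,2) dims by (intro eq_matI) (simp_all add: K_def)
  have dE: "dim_row (E + B * K * C) = n" "dim_col (E + B * K * C) = n" using dims by simp_all
  have "impulse_free (E + B * K * C) A" using closed_loop_impulse_free[OF K A] L(4) unfolding YK by blast
  note index = impulse_free_imp_regular_index[OF dE A this]
  have "port_hamiltonian n m (E + B * K * C) A B C"
  proof (rule port_hamiltonianI[OF _ _ _ Q CBQ _ QA])
    show "psd (Q\<^sup>T * (E + B * K * C))"
      by (rule closed_loop_psd[OF K]) (simp add: YK L(3))
  qed (rule carrier_matI; simp add: dims A)+
  with index closed_loop_rank[OF K] YK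
  show "regular_pencil (E + B * K * C) A \<and> (\<exists>\<nu> \<le> 1. has_index (E + B * K * C) A \<nu>) \<and>
    mrank (E + B * K * C) = k + mrank L \<and> port_hamiltonian n m (E + B * K * C) A B C" by simp
  show "K \<in> carrier_mat m m" by (rule carrier_matI[OF K])
qed

lemma derivative_feedback_sufficient:
  assumes Q: "inverses n Q Q'" and A: "dim_row A = n" "dim_col A = n"
    and QA: "dissipative (Q\<^sup>T * A)"
    and j: "j \<le> mrank (core A)" "skew_symmetric (core A) \<Longrightarrow> even j"
  shows "\<exists>K \<in> carrier_mat m m. regular_pencil (E + B * K * C) A \<and>
    (\<exists>\<nu> \<le> 1. has_index (E + B * K * C) A \<nu>) \<and> mrank (E + B * K * C) = n - j \<and>
    port_hamiltonian n m (E + B * K * C) A B C"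
proof -
  obtain L where L: "dim_row L = m" "dim_col L = m" "psd L" "impulse_free L (core A)" "mrank L = m - j"
    using psd_impulse_free_exists[OF core_dim core_dissipative[OF A QA] j] by blast
  have "j \<le> m" using j(1) rank_le_dims(1)[of "core A"] core_dim[of A] by simp
  hence "k + mrank L = n - j" using L(5) n by simp
  with closed_loop_sufficient[OF Q A QA L(1-4)] show ?thesis by simp
qed

lemma proportional_derivative_feedback_sufficient:
  assumes Q: "inverses n Q Q'" and A: "dim_row A = n" "dim_col A = n"
    and QA: "dissipative (Q\<^sup>T * A)" and j: "j \<le> m"
  shows "\<exists>F \<in> carrier_mat m m. \<exists>K \<in> carrier_mat m m. regular_pencil (E + B * K * C) (A + B * F * C) \<and>
    (\<exists>\<nu> \<le> 1. has_index (E + B * K * C) (A + B * F * C) \<nu>) \<and> mrank (E + B * K * C) = n - j \<and>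
    port_hamiltonian n m (E + B * K * C) (A + B * F * C) B C"
proof -
  define F :: "real mat" where "F = - 1\<^sub>m m"
  define L :: "real mat" where "L = partial_identity m m (m - j)"
  have F: "dim_row F = m" "dim_col F = m" by (simp_all add: F_def)
  have Fx: "x \<bullet> (F *\<^sub>v x) = - (x \<bullet> x)" if "dim_vec x = m" for x
    using that one_mult_vec[OF that] uminus_mult_mat_vec[of x "1\<^sub>m m"] by (simp add: F_def)
  have dF: "dissipative F"
    unfolding dissipative_def using Fx scalar_prod_self_nonneg F by simp
  have dL: "dim_row L = m" "dim_col L = m" by (simp_all add: L_def)
  have Lsym: "L\<^sup>T = L" by (intro eq_matI) (auto simp: L_def partial_identity_def)
  have LL: "L = L\<^sup>T * 1\<^sub>m m * L"
    unfolding Lsym mat_mult_one(1)[OF dL(2)] by (simp add: L_def partial_identity_mult)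
  have psdL: "psd L" by (subst LL, rule psd_congruence[OF _ dL(1) psd_one]) simp
  have "equivalent_mats L (partial_identity (dim_row L) (dim_col L) (m - j))"
    unfolding dL using equivalent_mats_refl[of L] by (simp add: L_def)
  hence rL: "mrank L = m - j" using rank_of_equivalent_partial_identity[of "m - j" L] dL by simp
  have dA: "dim_row (A + B * F * C) = n" "dim_col (A + B * F * C) = n" using dims by simp_all
  have "impulse_free L (core A + F)"
  proof (rule strictly_dissipative_impulse_free[OF dL _ _ Lsym])
    fix x :: "real vec" assume x: "dim_vec x = m" "x \<noteq> 0\<^sub>v m"
    have "(core A + F) *\<^sub>v x = core A *\<^sub>v x + F *\<^sub>v x"
      by (rule mat_add_vec) (simp_all add: x F dims)
    moreover have "x \<bullet> (core A *\<^sub>v x + F *\<^sub>v x) = x \<bullet> (core A *\<^sub>v x) + x \<bullet> (F *\<^sub>v x)"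
      by (rule scalar_prod_add_distrib[of _ m]; rule carrier_vecI; simp add: x F dims)
    moreover have "x \<bullet> (core A *\<^sub>v x) \<le> 0"
      by (rule dissipative_nonpos[OF core_dissipative[OF A QA]]) (simp add: x dims)
    moreover have "0 < x \<bullet> x" using scalar_prod_self_zero[of x m] x by fastforce
    ultimately show "x \<bullet> ((core A + F) *\<^sub>v x) < 0" using Fx[OF x(1)] by simp
  qed (simp_all add: F dims)
  hence "impulse_free L (core (A + B * F * C))" unfolding core_feedback[OF F A] .
  from closed_loop_sufficient[OF Q dA closed_loop_dissipative[OF F A QA dF] dL psdL this]
  have "\<exists>K \<in> carrier_mat m m. regular_pencil (E + B * K * C) (A + B * F * C) \<and>
    (\<exists>\<nu> \<le> 1. has_index (E + B * K * C) (A + B * F * C) \<nu>) \<and> mrank (E + B * K * C) = k + mrank L \<and>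
    port_hamiltonian n m (E + B * K * C) (A + B * F * C) B C" .
  moreover have "k + mrank L = n - j" using rL j n by simp
  ultimately show ?thesis using carrier_matI[OF F] by metis
qed

end

section \<open>The coordinates obtained from the null-space matrices\<close>

lemma transpose_zero_iff:
  fixes M :: "'a :: comm_semiring_0 mat"
  assumes "M\<^sup>T * N = 0\<^sub>m a b" "dim_row M = dim_row N"
  shows "N\<^sup>T * M = 0\<^sub>m b a"
proof -
  have "N\<^sup>T * M = (M\<^sup>T * N)\<^sup>T"
    using assms(2) by (simp add: mat_transpose_mult)
  thus ?thesis unfolding assms(1) by simp
qed

text \<open>
The equation \<open>T = (R U')\<^sup>T G\<^sup>T\<close> passes the injectivity of \<open>T\<close> on to \<open>G\<^sup>T\<close>.
\<close>

lemma row_selection_inverses: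
  fixes T :: "'a :: field mat"
  assumes U: "inverses n U U'" and d: "dim_row T = n" "dim_col T = s" "dim_row R = s" "dim_col R = n"
      "dim_row G = s" "dim_col G = s"
    and T: "trivial_kernel T" and e: "T\<^sup>T * U = G * R"
  obtains G' where "inverses s G G'" "T\<^sup>T = G * (R * U')"
proof -
  note dU = inverses_dim[OF U]
  have "T\<^sup>T = T\<^sup>T * U * U'"
    using mat_assoc[of "T\<^sup>T" U U'] inverses_cancel(5)[OF U] d dU by (simp add: mat_mult_one)
  also have "\<dots> = G * (R * U')" unfolding e by (rule mat_assoc) (simp_all add: d dU)
  finally have TG: "T\<^sup>T = G * (R * U')" .
  have "T = (T\<^sup>T)\<^sup>T" by simp
  also have "\<dots> = (R * U')\<^sup>T * G\<^sup>T"
    unfolding TG using d dU by (simp add: mat_transpose_mult)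
  finally have "trivial_kernel ((R * U')\<^sup>T * G\<^sup>T)" using T by simp
  hence "trivial_kernel (G\<^sup>T)" by (rule trivial_kernel_mult[rotated]) (simp add: d)
  then obtain N where "inverses s (G\<^sup>T) N"
    using trivial_kernel_imp_inverses[of "G\<^sup>T" s] d by auto
  from inverses_transpose[OF this] show thesis using that TG by simp
qed

text \<open>
Suppose \<open>E u + B y = 0\<close> with \<open>u\<close> in the null space of \<open>C\<close>. Applying \<open>u\<^sup>T Q\<^sup>T\<close> removes the second
term, since \<open>Q\<^sup>T B = C\<^sup>T\<close>; so the form of \<open>Q\<^sup>T E\<close> vanishes at \<open>u\<close>, whence \<open>E u = 0\<close>, and \<open>u = 0\<close> by
observability.
\<close>

lemma feedback_basis_trivial_kernel:
  fixes E B C Q S1 :: "real mat"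
  assumes d: "dim_row E = n" "dim_col E = n" "dim_row B = n" "dim_col B = m" "dim_row C = m" "dim_col C = n"
    and Q: "inverses n Q Q'" and CBQ: "C = B\<^sup>T * Q" and QE: "psd (Q\<^sup>T * E)"
    and obs: "\<And>v. dim_vec v = n \<Longrightarrow> E *\<^sub>v v = 0\<^sub>v n \<Longrightarrow> C *\<^sub>v v = 0\<^sub>v m \<Longrightarrow> v = 0\<^sub>v n"
    and dS1: "dim_row S1 = n" "dim_col S1 = k" and CS1: "C * S1 = 0\<^sub>m m k"
    and S1: "trivial_kernel S1" and tkB: "trivial_kernel B"
  shows "trivial_kernel (hcat (E * S1) B)"
proof -
  note dQ = inverses_dim[OF Q]
  define U where "U = hcat (E * S1) B"
  have dU: "dim_row U = n" "dim_col U = k + m" using d dS1 by (simp_all add: U_def)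
  have "trivial_kernel U"
    unfolding trivial_kernel_def dU
  proof (intro allI impI)
    fix v assume v: "dim_vec v = k + m" "U *\<^sub>v v = 0\<^sub>v n"
    obtain x y where xy: "v = x @\<^sub>v y" "dim_vec x = k" "dim_vec y = m" by (rule split_vec[OF v(1)])
    define u where "u = S1 *\<^sub>v x"
    have du: "dim_vec u = n" using dS1 by (simp add: u_def)
    have Cu: "C *\<^sub>v u = 0\<^sub>v m"
      using mat_vec_assoc[of C S1 x] CS1 d dS1 xy(2) by (simp add: u_def zero_mult_vec)
    have "U *\<^sub>v v = E * S1 *\<^sub>v x + B *\<^sub>v y"
      unfolding U_def xy(1) by (rule hcat_mult_vec) (simp_all add: d dS1 xy)
    also have "E * S1 *\<^sub>v x = E *\<^sub>v u" unfolding u_def by (rule mat_vec_assoc) (simp_all add: d dS1 xy)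
    finally have sum: "E *\<^sub>v u + B *\<^sub>v y = 0\<^sub>v n" using v(2) by simp
    have "Q\<^sup>T *\<^sub>v (E *\<^sub>v u + B *\<^sub>v y) = Q\<^sup>T *\<^sub>v (E *\<^sub>v u) + Q\<^sup>T *\<^sub>v (B *\<^sub>v y)"
      by (rule mat_vec_add) (simp_all add: dQ d)
    hence "0\<^sub>v n = Q\<^sup>T * E *\<^sub>v u + Q\<^sup>T *\<^sub>v (B *\<^sub>v y)"
      unfolding sum using du d dQ by (simp add: mult_zero_vec mat_vec_assoc)
    also have "Q\<^sup>T *\<^sub>v (B *\<^sub>v y) = C\<^sup>T *\<^sub>v y"
      unfolding CBQ using d dQ xy(3) by (simp add: mat_transpose_mult mat_vec_assoc)
    finally have e: "Q\<^sup>T * E *\<^sub>v u + C\<^sup>T *\<^sub>v y = 0\<^sub>v n" by simp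
    have "u \<bullet> (Q\<^sup>T * E *\<^sub>v u + C\<^sup>T *\<^sub>v y) =
        u \<bullet> (Q\<^sup>T * E *\<^sub>v u) + u \<bullet> (C\<^sup>T *\<^sub>v y)"
      by (rule scalar_prod_add_distrib[of _ n]; rule carrier_vecI; simp add: du d dQ)
    moreover have "u \<bullet> (C\<^sup>T *\<^sub>v y) = (C *\<^sub>v u) \<bullet> y"
      using transpose_scalar_prod[of "C\<^sup>T" y u] d du xy(3) by simp
    moreover have "(C *\<^sub>v u) \<bullet> y = 0" unfolding Cu using xy(3) by (simp add: scalar_prod_def)
    moreover have "u \<bullet> 0\<^sub>v n = 0" using du by (simp add: scalar_prod_def)
    ultimately have form: "u \<bullet> (Q\<^sup>T * E *\<^sub>v u) = 0" unfolding e by simp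
    have "Q\<^sup>T * E *\<^sub>v u = 0\<^sub>v n"
      by (rule psd_zero_form[OF QE _ du form]) (simp add: dQ)
    hence "Q\<^sup>T *\<^sub>v (E *\<^sub>v u) = 0\<^sub>v (dim_row (Q\<^sup>T))"
      using mat_vec_assoc[of "Q\<^sup>T" E u] d dQ du by simp
    from trivial_kernelD[OF inverses_trivial_kernel[OF inverses_transpose[OF Q]] _ this]
    have Eu: "E *\<^sub>v u = 0\<^sub>v n" using d dQ by simp
    have "u = 0\<^sub>v n" by (rule obs[OF du Eu Cu])
    hence "S1 *\<^sub>v x = 0\<^sub>v (dim_row S1)" using dS1 by (simp add: u_def)
    from trivial_kernelD[OF S1 _ this] have x: "x = 0\<^sub>v k" using xy(2) dS1 by simp
    have "B *\<^sub>v y = 0\<^sub>v (dim_row B)" using sum unfolding Eu using d by (simp add: vec_add_zero)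
    from trivial_kernelD[OF tkB _ this] have y: "y = 0\<^sub>v m" using xy(3) d by simp
    show "v = 0\<^sub>v (k + m)" unfolding xy(1) x y append_vec_zero ..
  qed
  thus ?thesis unfolding U_def .
qed

text \<open>
Any admissible null-space matrices give rise to the coordinates, with \<open>Z = S2 (C S2)\<^sup>-\<^sup>1\<close>. The matrices \<open>T1\<close>
and \<open>T2\<close> annihilate the columns \<open>E S1\<close> and \<open>B\<close>, respectively, so up to invertible factors they select the two
groups of rows of \<open>[E S1, B]\<^sup>-\<^sup>1\<close>. In particular \<open>T2\<^sup>T E Z = 0\<close> places the columns of \<open>E Z\<close> in the range of \<open>B\<close>.
\<close>

lemma feedback_coordinates_exist:
  fixes E B C Q S1 T1 T2 S2 :: "real mat"
  assumes d: "dim_row E = n" "dim_col E = n" "dim_row B = n" "dim_col B = m" "dim_row C = m" "dim_col C = n"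
    and rC: "mrank C = m" and Q: "inverses n Q Q'"
    and CBQ: "C = B\<^sup>T * Q" and QE: "psd (Q\<^sup>T * E)"
    and obs: "\<And>v. dim_vec v = n \<Longrightarrow> E *\<^sub>v v = 0\<^sub>v n \<Longrightarrow> C *\<^sub>v v = 0\<^sub>v m \<Longrightarrow> v = 0\<^sub>v n"
    and S1: "kernel_basis C S1" and T1: "kernel_basis ((E * S1)\<^sup>T) T1"
    and T2: "kernel_basis (B\<^sup>T) T2" and S2: "kernel_basis (T2\<^sup>T * E) S2"
  obtains Y U' P' G1 G3 where "inverses m (T1\<^sup>T * B) G1" "inverses m (C * S2) G3"
    "feedback_coordinates n m (n - m) E B C Q S1 (S2 * G3) Y U' P'"
    "T1\<^sup>T = T1\<^sup>T * B * (Q * (S2 * G3))\<^sup>T"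
    "dim_row S2 = n" "dim_col S2 = m" "dim_row T1 = n" "dim_col T1 = m"
proof -
  define k where "k = n - m"
  note dQ = inverses_dim[OF Q]
  have mn: "m \<le> n" using rank_le_dims(2)[of C] rC d by simp
  have n: "n = k + m" using mn by (simp add: k_def)
  have dS1: "dim_row S1 = n" "dim_col S1 = k"
    using kernel_basisD(1,2)[OF S1] d rC by (simp_all add: k_def)
  have CS1: "C * S1 = 0\<^sub>m m k" using kernel_basisD(4)[OF S1] d dS1 by simp
  have tkB: "trivial_kernel B"
  proof -
    have "mrank (C\<^sup>T) = m" using rank_transpose[of C] rC by simp
    hence "mrank (C\<^sup>T) = dim_col (C\<^sup>T)" using d by simp
    from iffD1[OF full_rank_iff_trivial_kernel this] have tk: "trivial_kernel (C\<^sup>T)" .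
    have "C\<^sup>T = Q\<^sup>T * B" unfolding CBQ using d dQ by (simp add: mat_transpose_mult)
    with tk have "trivial_kernel (Q\<^sup>T * B)" by simp
    thus ?thesis by (rule trivial_kernel_mult[rotated]) (simp add: d dQ)
  qed
  define U where "U = hcat (E * S1) B"
  have dU: "dim_row U = n" "dim_col U = n" using d dS1 n by (simp_all add: U_def)
  have tkU: "trivial_kernel U"
    unfolding U_def
    by (rule feedback_basis_trivial_kernel[OF d Q CBQ QE obs dS1 CS1 kernel_basisD(3)[OF S1] tkB])
  obtain U' where U: "inverses n U U'" by (rule trivial_kernel_imp_inverses[OF dU tkU])
  note dU' = inverses_dim[OF U]
  let ?low = "lower_identity k m :: real mat" and ?up = "partial_identity k (k + m) k :: real mat"
  have tkES: "trivial_kernel (E * S1)"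
    by (rule hcat_trivial_kernel_left[OF _ tkU[unfolded U_def]]) (simp add: d)
  have rES: "mrank ((E * S1)\<^sup>T) = k"
    using rank_transpose[of "E * S1"] iffD2[OF full_rank_iff_trivial_kernel tkES] dS1 by simp
  have dT1: "dim_row T1 = n" "dim_col T1 = m"
    using kernel_basisD(1,2)[OF T1] rES d n by simp_all
  have T1ES: "T1\<^sup>T * (E * S1) = 0\<^sub>m m k"
  proof (rule transpose_zero_iff)
    show "(E * S1)\<^sup>T * T1 = 0\<^sub>m k m" using kernel_basisD(4)[OF T1] dT1 dS1 by simp
  qed (simp add: d dT1)
  have rB: "mrank (B\<^sup>T) = m"
    using rank_transpose[of B] iffD2[OF full_rank_iff_trivial_kernel tkB] d by simp
  have dT2: "dim_row T2 = n" "dim_col T2 = k"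
    using kernel_basisD(1,2)[OF T2] rB d n by simp_all
  have T2B: "T2\<^sup>T * B = 0\<^sub>m k m"
  proof (rule transpose_zero_iff)
    show "B\<^sup>T * T2 = 0\<^sub>m m k" using kernel_basisD(4)[OF T2] dT2 d by simp
  qed (simp add: d dT2)
  define G where "G = T1\<^sup>T * B"
  have dG: "dim_row G = m" "dim_col G = m" using dT1 d by (simp_all add: G_def)
  have T1U0: "T1\<^sup>T * U = G * ?low\<^sup>T"
  proof -
    have "T1\<^sup>T * U = hcat (T1\<^sup>T * (E * S1)) (T1\<^sup>T * B)"
      unfolding U_def by (rule mult_hcat) (simp_all add: d dT1)
    also have "\<dots> = hcat (0\<^sub>m m k) G" unfolding T1ES G_def ..
    also have "\<dots> = hcat (G * 0\<^sub>m m k) (G * 1\<^sub>m m)" using dG by (simp add: mat_mult_zero mat_mult_one)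
    also have "\<dots> = G * hcat (0\<^sub>m m k) (1\<^sub>m m)" by (rule mult_hcat[symmetric]) (simp_all add: dG)
    also have "hcat (0\<^sub>m m k) (1\<^sub>m m) = ?low\<^sup>T"
      by (intro eq_matI) (auto simp: hcat_def lower_identity_def)
    finally show ?thesis .
  qed
  obtain G1 where G1: "inverses m G G1" and T1U: "T1\<^sup>T = G * (?low\<^sup>T * U')"
    by (rule row_selection_inverses[OF U dT1 _ _ dG kernel_basisD(3)[OF T1] T1U0]) (simp_all add: n)
  define H where "H = T2\<^sup>T * (E * S1)"
  have dH: "dim_row H = k" "dim_col H = k" using dT2 d dS1 by (simp_all add: H_def)
  have T2U: "T2\<^sup>T * U = H * ?up"
  proof -
    have "T2\<^sup>T * U = hcat (T2\<^sup>T * (E * S1)) (T2\<^sup>T * B)"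
      unfolding U_def by (rule mult_hcat) (simp_all add: d dT2)
    also have "\<dots> = hcat (H * 1\<^sub>m k) (H * 0\<^sub>m k m)"
      unfolding T2B H_def[symmetric] using dH by (simp add: mat_mult_zero mat_mult_one)
    also have "\<dots> = H * hcat (1\<^sub>m k) (0\<^sub>m k m)" by (rule mult_hcat[symmetric]) (simp_all add: dH)
    also have "hcat (1\<^sub>m k) (0\<^sub>m k m) = ?up"
      by (intro eq_matI) (auto simp: hcat_def partial_identity_def)
    finally show ?thesis .
  qed
  obtain H' where H': "inverses k H H'" and T2e: "T2\<^sup>T = H * (?up * U')"
    by (rule row_selection_inverses[OF U dT2 _ _ dH kernel_basisD(3)[OF T2] T2U]) (simp_all add: n)
  have rT2E: "mrank (T2\<^sup>T * E) = k"
  proof (rule antisym)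
    show "mrank (T2\<^sup>T * E) \<le> k" using rank_le_dims(1)[of "T2\<^sup>T * E"] dT2 by simp
    have "k = mrank H" using iffD2[OF full_rank_iff_trivial_kernel inverses_trivial_kernel[OF H']] dH by simp
    also have "H = T2\<^sup>T * E * S1"
      unfolding H_def by (rule mat_assoc[symmetric]) (simp_all add: d dT2 dS1)
    also have "mrank \<dots> \<le> mrank (T2\<^sup>T * E)" by (rule rank_mult_le) (simp add: d dS1)
    finally show "k \<le> mrank (T2\<^sup>T * E)" .
  qed
  have dS2: "dim_row S2 = n" "dim_col S2 = m"
    using kernel_basisD(1,2)[OF S2] rT2E d n by simp_all
  have T2ES2: "T2\<^sup>T * E * S2 = 0\<^sub>m k m" using kernel_basisD(4)[OF S2] dS2 dT2 by simp
  have "trivial_kernel (C * S2)"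
    unfolding trivial_kernel_def
  proof (intro allI impI)
    fix x assume x: "dim_vec x = dim_col (C * S2)" "C * S2 *\<^sub>v x = 0\<^sub>v (dim_row (C * S2))"
    have dx: "dim_vec x = m" using x(1) dS2 by simp
    have "C *\<^sub>v (S2 *\<^sub>v x) = 0\<^sub>v (dim_row C)"
      using x(2) mat_vec_assoc[of C S2 x] d dS2 dx by simp
    from kernel_basisD(5)[OF S1 _ this] obtain w where "dim_vec w = dim_col S1" and w2: "S2 *\<^sub>v x = S1 *\<^sub>v w"
      unfolding dim_mult_mat_vec d dS2 by blast
    hence w: "dim_vec w = k" "S2 *\<^sub>v x = S1 *\<^sub>v w" using dS1 by simp_all
    have "H *\<^sub>v w = T2\<^sup>T * E *\<^sub>v (S1 *\<^sub>v w)"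
      unfolding H_def using d dS1 dT2 w(1) by (simp add: mat_vec_assoc)
    also have "\<dots> = T2\<^sup>T * E * S2 *\<^sub>v x"
      unfolding w(2)[symmetric] by (rule mat_vec_assoc[symmetric]) (simp_all add: d dS2 dx)
    also have "\<dots> = 0\<^sub>v (dim_row H)" unfolding T2ES2 using dx dH by (simp add: zero_mult_vec)
    finally have "w = 0\<^sub>v k"
      using trivial_kernelD[OF inverses_trivial_kernel[OF H']] w(1) dH by simp
    hence "S2 *\<^sub>v x = 0\<^sub>v (dim_row S2)" using w(2) dS1 dS2 by (simp add: mult_zero_vec)
    from trivial_kernelD[OF kernel_basisD(3)[OF S2] _ this]
    show "x = 0\<^sub>v (dim_col (C * S2))" using dx dS2 by simp
  qed
  then obtain G3 where G3: "inverses m (C * S2) G3"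
    using trivial_kernel_imp_inverses[of "C * S2" m] d dS2 by auto
  note dG3 = inverses_dim[OF G3]
  define Z where "Z = S2 * G3"
  have dZ: "dim_row Z = n" "dim_col Z = m" using dS2 dG3 by (simp_all add: Z_def)
  have CZ: "C * Z = 1\<^sub>m m"
    unfolding Z_def using mat_assoc[of C S2 G3] inverses_cancel(5)[OF G3] d dS2 dG3 by simp
  define Y where "Y = ?low\<^sup>T * (U' * E * Z)"
  have EZ: "E * Z = B * Y"
  proof -
    let ?X = "U' * E * Z"
    have dX: "dim_row ?X = k + m" "dim_col ?X = m" using dU' dZ n by simp_all
    have "H * (?up * ?X) = H * (?up * U') * (E * Z)"
      using dH dU' d dZ n by (simp add: mat_assoc)
    also have "\<dots> = T2\<^sup>T * (E * Z)" unfolding T2e[symmetric] ..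
    also have "\<dots> = T2\<^sup>T * E * S2 * G3"
      unfolding Z_def using d dT2 dS2 dG3 by (simp add: mat_assoc)
    also have "\<dots> = 0\<^sub>m k m" unfolding T2ES2 using dG3 by (simp add: mat_mult_zero)
    finally have "H' * (H * (?up * ?X)) = H' * 0\<^sub>m k m" by simp
    moreover have "H' * (H * (?up * ?X)) = ?up * ?X"
      by (rule inverses_cancel(2)[OF H']) simp
    moreover have "H' * 0\<^sub>m k m = (0\<^sub>m k m :: real mat)"
      using inverses_dim[OF H'] by (simp add: mat_mult_zero)
    ultimately have "?up * ?X = 0\<^sub>m k (dim_col ?X)" using dX by simp
    from partial_identity_lower_identity_split[OF dX(1) this] have X: "?X = ?low * Y" unfolding Y_def .
    have "E * Z = U * (U' * (E * Z))"
      by (rule inverses_cancel(1)[OF U, symmetric]) (simp add: d)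
    also have "U' * (E * Z) = ?X" by (rule mat_assoc[symmetric]) (simp_all add: d dZ dU')
    also have "U * ?X = U * ?low * Y"
      unfolding X by (rule mat_assoc[symmetric]) (simp_all add: dU n Y_def)
    also have "U * ?low = B"
      unfolding U_def using hcat_lower_identity[of B "E * S1"] d dS1 by simp
    finally show ?thesis .
  qed
  have dY: "dim_row Y = m" "dim_col Y = m" using dZ by (simp_all add: Y_def)
  have dPm: "dim_row (hcat S1 Z) = n" "dim_col (hcat S1 Z) = n" using dS1 dZ n by simp_all
  have "trivial_kernel (hcat S1 Z)"
    unfolding trivial_kernel_def dPm
  proof (intro allI impI)
    fix v assume v: "dim_vec v = n" "hcat S1 Z *\<^sub>v v = 0\<^sub>v n"
    have "dim_vec v = k + m" using v(1) n by simp
    then obtain x y where xy: "v = x @\<^sub>v y" "dim_vec x = k" "dim_vec y = m" by (rule split_vec)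
    have "hcat S1 Z *\<^sub>v v = S1 *\<^sub>v x + Z *\<^sub>v y"
      unfolding xy(1) by (rule hcat_mult_vec) (simp_all add: dS1 dZ xy)
    hence sum: "S1 *\<^sub>v x + Z *\<^sub>v y = 0\<^sub>v n" using v(2) by simp
    have "C *\<^sub>v (S1 *\<^sub>v x + Z *\<^sub>v y) = C *\<^sub>v (S1 *\<^sub>v x) + C *\<^sub>v (Z *\<^sub>v y)"
      by (rule mat_vec_add) (simp_all add: d dS1 dZ)
    also have "C *\<^sub>v (S1 *\<^sub>v x) = C * S1 *\<^sub>v x"
      by (rule mat_vec_assoc[symmetric]) (simp_all add: d dS1 xy)
    also have "C *\<^sub>v (Z *\<^sub>v y) = C * Z *\<^sub>v y"
      by (rule mat_vec_assoc[symmetric]) (simp_all add: d dZ xy)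
    finally have "y = 0\<^sub>v m"
      unfolding sum CS1 CZ using xy d by (simp add: zero_mult_vec one_mult_vec vec_add_zero mult_zero_vec)
    hence "S1 *\<^sub>v x = 0\<^sub>v (dim_row S1)" using sum dS1 dZ by (simp add: mult_zero_vec vec_add_zero)
    from trivial_kernelD[OF kernel_basisD(3)[OF S1] _ this] have "x = 0\<^sub>v k" using xy(2) dS1 by simp
    thus "v = 0\<^sub>v n" unfolding xy(1) \<open>y = 0\<^sub>v m\<close> n append_vec_zero by simp
  qed
  then obtain P' where P: "inverses n (hcat S1 Z) P'"
    using trivial_kernel_imp_inverses[OF dPm] by blast
  have coords: "feedback_coordinates n m k E B C Q S1 Z Y U' P'"
    by (rule feedback_coordinates.intro)
      (fact d dQ(1,2) dS1 dZ dY n U[unfolded U_def] P CS1 CZ EZ CBQ QE)+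
  interpret feedback_coordinates n m k E B C Q S1 Z Y U' P' by (rule coords)
  show thesis
  proof (rule that[of G1 G3 Y U' P'])
    show "inverses m (T1\<^sup>T * B) G1" using G1 unfolding G_def .
    show "feedback_coordinates n m (n - m) E B C Q S1 (S2 * G3) Y U' P'"
      using coords unfolding Z_def k_def .
    show "T1\<^sup>T = T1\<^sup>T * B * (Q * (S2 * G3))\<^sup>T"
      using T1U unfolding left_inverse_row unfolding G_def Z_def .
  qed (fact G3 dS2 dT1)+
qed

section \<open>The attainable ranks\<close>

text \<open>
The matrix \<open>T1\<^sup>T A S2\<close> differs from \<open>core A\<close> by the invertible factors \<open>T1\<^sup>T B\<close> and \<open>C S2\<close>, so both
have the same rank, and the displayed product with the inverses of these factors is \<open>core A\<close> itself.
\<close>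

theorem theorem5:
  fixes n m :: nat and E A B C :: "real mat" and r :: int
  assumes "E \<in> carrier_mat n n" and "A \<in> carrier_mat n n"
    and "B \<in> carrier_mat n m" and "C \<in> carrier_mat m n"
    and "mrank C = m"
    and "port_hamiltonian n m E A B C"
    and "completely_observable n E A C"
  shows
    "(\<forall>S1 T1 T2 S2.
        is_S_infty C S1 \<and> is_T_infty (E * S1) T1 \<and>
        is_T_infty B T2 \<and> is_S_infty (transpose_mat T2 * E) S2 \<longrightarrow>
        ((\<exists>K \<in> carrier_mat m m.
            regular_pencil (E + B * K * C) A \<and>
            (\<exists>\<nu> \<le> 1. has_index (E + B * K * C) A \<nu>) \<and>
            int (mrank (E + B * K * C)) = r \<and>
            port_hamiltonian n m (E + B * K * C) A B C)
         \<longleftrightarrow>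
         (int n - int (mrank (transpose_mat T1 * A * S2)) \<le> r \<and> r \<le> int n \<and>
          (mrank (transpose_mat T1 * A * S2) > 0 \<and>
           even (mrank (transpose_mat T1 * A * S2)) \<and>
           skew_symmetric (mat_inv (transpose_mat T1 * B) *
             (transpose_mat T1 * A * S2) * mat_inv (C * S2))
           \<longrightarrow> even (int n - r)))))
     \<and>
     ((\<exists>F \<in> carrier_mat m m. \<exists>K \<in> carrier_mat m m.
         regular_pencil (E + B * K * C) (A + B * F * C) \<and>
         (\<exists>\<nu> \<le> 1. has_index (E + B * K * C) (A + B * F * C) \<nu>) \<and>
         int (mrank (E + B * K * C)) = r \<and>
         port_hamiltonian n m (E + B * K * C) (A + B * F * C) B C)
      \<longleftrightarrow>
      (int n - int (mrank B) \<le> r \<and> r \<le> int n))"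
proof -
  note d = carrier_matD[OF assms(1)] carrier_matD[OF assms(3)] carrier_matD[OF assms(4)]
  note dA = carrier_matD[OF assms(2)]
  obtain Q Q' where Q: "inverses n Q Q'" and CBQ: "C = B\<^sup>T * Q"
    and QE: "psd (Q\<^sup>T * E)" and QA: "dissipative (Q\<^sup>T * A)"
    by (rule observable_port_hamiltonian_inverses[OF assms(1-4,6,7)])
  have obs: "v = 0\<^sub>v n" if "dim_vec v = n" "E *\<^sub>v v = 0\<^sub>v n" "C *\<^sub>v v = 0\<^sub>v m" for v
    using completely_observable_kernel(1)[OF assms(7) d(1,2) dA d(6) that(1) _ that(2)] that(3) d by simp
  note exist = feedback_coordinates_exist[OF d assms(5) Q CBQ QE obs]
  show ?thesis
  proof (intro conjI allI impI)
    fix S1 T1 T2 S2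
    assume "is_S_infty C S1 \<and> is_T_infty (E * S1) T1 \<and> is_T_infty B T2 \<and> is_S_infty (T2\<^sup>T * E) S2"
    hence S: "kernel_basis C S1" "kernel_basis ((E * S1)\<^sup>T) T1"
      "kernel_basis (B\<^sup>T) T2" "kernel_basis (T2\<^sup>T * E) S2"
      unfolding is_T_infty_def by (blast intro: S_infty_kernel_basis)+
    obtain Y U' P' G1 G3 where G1: "inverses m (T1\<^sup>T * B) G1" and G3: "inverses m (C * S2) G3"
      and coords: "feedback_coordinates n m (n - m) E B C Q S1 (S2 * G3) Y U' P'"
      and T1: "T1\<^sup>T = T1\<^sup>T * B * (Q * (S2 * G3))\<^sup>T"
      and dT: "dim_row S2 = n" "dim_col S2 = m" "dim_row T1 = n" "dim_col T1 = m"
      by (rule exist[OF _ _ _ S])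
    interpret feedback_coordinates n m "n - m" E B C Q S1 "S2 * G3" Y U' P' by (rule coords)
    let ?N = "T1\<^sup>T * A * S2"
    note dG = inverses_dim[OF G1] inverses_dim[OF G3]
    have S2: "S2 * G3 * (C * S2) = S2"
    proof -
      have "S2 * G3 * (C * S2) = S2 * (G3 * (C * S2))" by (rule mat_assoc) (simp_all add: dT dG d)
      thus ?thesis unfolding inverses_cancel(6)[OF G3] using dT by (simp add: mat_mult_one)
    qed
    have N: "?N = T1\<^sup>T * B * core A * (C * S2)"
    proof -
      have "?N = T1\<^sup>T * B * (Q * (S2 * G3))\<^sup>T * A * (S2 * G3 * (C * S2))"
        unfolding T1[symmetric] S2 ..
      thus ?thesis using dims dT d dG dA by (simp add: mat_assoc)
    qed
    have rank: "mrank ?N = mrank (core A)"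
      unfolding N by (rule rank_inverses_mult) (use G1 G3 core_dim[of A] in \<open>simp_all only:\<close>)
    have core: "mat_inv (T1\<^sup>T * B) * ?N * mat_inv (C * S2) = core A"
    proof -
      have "G1 * ?N * G3 = G1 * (T1\<^sup>T * B * (core A * (C * S2 * G3)))"
        unfolding N using dims dT d dG by (simp add: mat_assoc)
      also have "\<dots> = core A"
        unfolding inverses_cancel(5)[OF G3] mat_mult_one(1)[OF core_dim(2)]
        by (rule inverses_cancel(2)[OF G1 core_dim(1)])
      finally show ?thesis unfolding mat_inv_eq[OF G1] mat_inv_eq[OF G3] .
    qed
    show "(\<exists>K \<in> carrier_mat m m.
            regular_pencil (E + B * K * C) A \<and>
            (\<exists>\<nu> \<le> 1. has_index (E + B * K * C) A \<nu>) \<and>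
            int (mrank (E + B * K * C)) = r \<and>
            port_hamiltonian n m (E + B * K * C) A B C)
         \<longleftrightarrow>
         (int n - int (mrank ?N) \<le> r \<and> r \<le> int n \<and>
          (mrank ?N > 0 \<and> even (mrank ?N) \<and>
           skew_symmetric (mat_inv (T1\<^sup>T * B) * ?N * mat_inv (C * S2))
           \<longrightarrow> even (int n - r)))" (is "?closed \<longleftrightarrow> ?range")
      unfolding rank core
    proof
      assume ?closed
      then obtain K \<nu> where K: "K \<in> carrier_mat m m" and ix: "\<nu> \<le> 1" "has_index (E + B * K * C) A \<nu>"
        and r: "int (mrank (E + B * K * C)) = r" and ph: "port_hamiltonian n m (E + B * K * C) A B C"
        by blast
      note dK = carrier_matD[OF K]
      have le: "mrank (E + B * K * C) \<le> n" by (rule closed_loop_rank_bounds(3)[OF dK])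
      hence nr: "int n - r = int (n - mrank (E + B * K * C))" using r by simp
      show "int n - int (mrank (core A)) \<le> r \<and> r \<le> int n \<and>
        (mrank (core A) > 0 \<and> even (mrank (core A)) \<and> skew_symmetric (core A) \<longrightarrow> even (int n - r))"
        using closed_loop_necessary[OF dK dA ix(2,1) ph] le r unfolding nr by auto
    next
      assume range: "int n - int (mrank (core A)) \<le> r \<and> r \<le> int n \<and>
        (mrank (core A) > 0 \<and> even (mrank (core A)) \<and> skew_symmetric (core A) \<longrightarrow> even (int n - r))"
      define j where "j = nat (int n - r)"
      have j: "int j = int n - r" using range by (simp add: j_def)
      have "j \<le> mrank (core A)" using range j by linarith
      \<comment> \<open>The rank of a skew-symmetric matrix is even, so for positive rank the parity condition applies; for rank
        zero it is vacuous, but then \<open>j = 0\<close>.\<close>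
      moreover have "even j" if sk: "skew_symmetric (core A)"
      proof (cases "mrank (core A) = 0")
        case True
        thus ?thesis using \<open>j \<le> mrank (core A)\<close> by simp
      next
        case False
        hence "even (int n - r)" using range sk rank_skew_even[OF core_dim sk] by simp
        thus ?thesis unfolding j[symmetric] by simp
      qed
      ultimately obtain K where K: "K \<in> carrier_mat m m" "regular_pencil (E + B * K * C) A"
        "\<exists>\<nu> \<le> 1. has_index (E + B * K * C) A \<nu>" "mrank (E + B * K * C) = n - j"
        "port_hamiltonian n m (E + B * K * C) A B C"
        using derivative_feedback_sufficient[OF Q dA QA] by blast
      have "j \<le> n" using \<open>j \<le> mrank (core A)\<close> rank_le_dims(1)[of "core A"] core_dim(1)[of A] n by linarith
      hence "int (mrank (E + B * K * C)) = r" using K(4) j by simp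
      with K show ?closed by blast
    qed
  next
    obtain S1 where S1: "kernel_basis C S1" by (rule kernel_basis_ex)
    obtain T1 where T1: "kernel_basis ((E * S1)\<^sup>T) T1" by (rule kernel_basis_ex)
    obtain T2 where T2: "kernel_basis (B\<^sup>T) T2" by (rule kernel_basis_ex)
    obtain S2 where S2: "kernel_basis (T2\<^sup>T * E) S2" by (rule kernel_basis_ex)
    obtain Y U' P' G1 G3 where coords: "feedback_coordinates n m (n - m) E B C Q S1 (S2 * G3) Y U' P'"
      by (rule exist[OF _ _ _ S1 T1 T2 S2])
    interpret feedback_coordinates n m "n - m" E B C Q S1 "S2 * G3" Y U' P' by (rule coords)
    show "(\<exists>F \<in> carrier_mat m m. \<exists>K \<in> carrier_mat m m.
         regular_pencil (E + B * K * C) (A + B * F * C) \<and>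
         (\<exists>\<nu> \<le> 1. has_index (E + B * K * C) (A + B * F * C) \<nu>) \<and>
         int (mrank (E + B * K * C)) = r \<and>
         port_hamiltonian n m (E + B * K * C) (A + B * F * C) B C)
      \<longleftrightarrow> (int n - int (mrank B) \<le> r \<and> r \<le> int n)" (is "?closed \<longleftrightarrow> _")
      unfolding rank_B
    proof
      assume ?closed
      then obtain K where K: "K \<in> carrier_mat m m" and r: "int (mrank (E + B * K * C)) = r" by blast
      show "int n - int m \<le> r \<and> r \<le> int n"
        using closed_loop_rank_bounds(2,3)[OF carrier_matD[OF K]] r n by linarith
    next
      assume range: "int n - int m \<le> r \<and> r \<le> int n"
      define j where "j = nat (int n - r)"
      have j: "int j = int n - r" "j \<le> m" using range unfolding j_def by linarith+
      have "int (n - j) = r" using j n by linarith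
      thus ?closed using proportional_derivative_feedback_sufficient[OF Q dA QA j(2)] by metis
    qed
  qed
qed

end
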